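(* Assume that $A$ is a nonsingular $N\times N$ integer matrix and $G=\bigcup_{n}A^{-n}\mathbb{Z}^N\subset\mathbb{Q}^N$ (union over $n\ge0$) the associated dimension group. Suppose $L$ is any rank-$N$ lattice (free abelian subgroup of rank $N$) in $G$ such that $AL\subset L$ and $\bigcup_{n}A^{-n}L=G$. Then $G/L$ is isomorphic to the product over primes $p$ dividing $\det A$ of a certain number $n(p)$ of copies of $\mathbb{Z}_{p^\infty}$. The number $n(p)$ is the largest $j$ such that, if we write the characteristic polynomial of $A$ as $x^N+c_1x^{N-1}+\dots+c_{N-1}x+c_N$, $p$ does not divide $c_j$. In addition, $G$ is dual to the $p$-adic eventual row space of $A$ in the sense that, for such primes $p$, $$G\otimes\mathbb{Z}\bigl[\tfrac12,\dots,\widehat{\tfrac1p},\dots\bigr]=\bigl\{v\in\mathbb{Q}^N\mid \langle w\mid v\rangle\in\mathbb{Z}_{(p)}\ \text{for all } w\in G_{(p)}(A)\bigr\}.$$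
   Context: $\mathbb{Z}_{p^\infty}=\mathbb{Z}[1/p]/\mathbb{Z}$. $\mathbb{Z}_{(p)}$ denotes the ring of $p$-adic integers. $\mathbb{Z}[\frac12,\dots,\widehat{\frac1p},\dots]$ is the subring of $\mathbb{Q}$ in which all primes except $p$ are inverted; $G\otimes\mathbb{Z}[\frac12,\dots,\widehat{\frac1p},\dots]$ is identified with the subgroup of $\mathbb{Q}^N$ generated by all multiples of elements of $G$ by elements of this ring. For each $m\ge 1$ the set of powers $\{A,A^2,A^3,\dots\}$ reduced modulo $p^m$ contains exactly one idempotent; these idempotents are compatible for varying $m$ and define an idempotent matrix $E_{(p)}(A)\in M_N(\mathbb{Z}_{(p)})$ (the $p$-adic limit of suitable powers $A^{e(m)}$). The $p$-adic eventual row space $G_{(p)}(A)\subset\mathbb{Z}_{(p)}^N$ is the $\mathbb{Z}_{(p)}$-module spanned by the rows of $E_{(p)}(A)$. $\langle w\mid v\rangle=\sum_i w_iv_i$.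
   Formalization: The number of copies n(p) is proved to be N−j, where j (with c_0=1 allowed) is the largest index such that p does not divide c_j; n(p)=j as written fails, e.g. for A=diag(2,2,1), p=2, where j=1 but G/L has two copies. *)

theory Defs
  imports
    "Jordan_Normal_Form.Char_Poly"
    "HOL-Number_Theory.Cong"
    "HOL-Algebra.QuotRing"
    "HOL-Algebra.Generated_Groups"
    "HOL-Algebra.Product_Groups"
    "HOL-Algebra.Free_Abelian_Groups"
begin

section \<open>The dimension group of an integer matrix\<close>

abbreviation Q_vec :: "nat \<Rightarrow> rat vec monoid" where
  "Q_vec N \<equiv> monoid_vec TYPE(rat) N"

definition Z_vec :: "nat \<Rightarrow> rat vec set" where
  "Z_vec N = map_vec rat_of_int ` carrier_vec N"

abbreviation rat_mat :: "int mat \<Rightarrow> rat mat" where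
  "rat_mat A \<equiv> map_mat rat_of_int A"

text \<open>\<open>inv_pow A n L\<close> is \<open>A\<^sup>-\<^sup>n L\<close>, written as the inverse image of \<open>L\<close> under the
  map \<open>v \<mapsto> A\<^sup>n v\<close> of \<open>\<rat>\<^sup>N\<close>, which is bijective for nonsingular \<open>A\<close>.\<close>

definition inv_pow :: "int mat \<Rightarrow> nat \<Rightarrow> rat vec set \<Rightarrow> rat vec set" where
  "inv_pow A n L = {v \<in> carrier_vec (dim_row A). (rat_mat A ^\<^sub>m n) *\<^sub>v v \<in> L}"

definition dimension_group :: "int mat \<Rightarrow> rat vec set" where
  "dimension_group A = (\<Union>n. inv_pow A n (Z_vec (dim_row A)))"

definition is_lattice ::
    "nat \<Rightarrow> rat vec set \<Rightarrow> bool" where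
  "is_lattice N L \<longleftrightarrow>
     subgroup L (Q_vec N) \<and> (Q_vec N)\<lparr>carrier := L\<rparr> \<cong> free_Abelian_group {..<N}"

definition rat_add_group :: "rat set \<Rightarrow> rat monoid" where
  "rat_add_group S = \<lparr>carrier = S, monoid.mult = (+), one = 0\<rparr>"

definition pruefer_group :: "nat \<Rightarrow> rat set monoid" where
  "pruefer_group p = rat_add_group {of_int a / of_nat p ^ k | a k. True} Mod \<int>"

text \<open>With \<open>N\<close> the size of \<open>A\<close> and \<open>x\<^sup>N + c\<^sub>1 x\<^sup>N\<^sup>-\<^sup>1 + \<dots> + c\<^sub>N\<close> its characteristic
  polynomial, \<open>charpoly_coeff A j\<close> is \<open>c\<^sub>j\<close>, where \<open>c\<^sub>0 = 1\<close>.\<close>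

definition charpoly_coeff :: "int mat \<Rightarrow> nat \<Rightarrow> int" where
  "charpoly_coeff A j = coeff (char_poly A) (dim_row A - j)"

definition last_unit_index :: "int mat \<Rightarrow> nat \<Rightarrow> nat" where
  "last_unit_index A p =
     (GREATEST j. j \<le> dim_row A \<and> \<not> int p dvd charpoly_coeff A j)"

text \<open>The largest \<open>j\<close> with \<open>p\<close> not dividing \<open>c\<^sub>j\<close> is the number of eigenvalues of \<open>A\<close> that are
  \<open>p\<close>-adic units, i.e. the rank of the \<open>p\<close>-adic eventual row space. The number of copies of
  the Pruefer group is the complementary number \<open>N - j\<close>, and not \<open>j\<close> itself: for the
  \<open>1 \<times> 1\<close> matrix \<open>A = (p)\<close> and \<open>L = \<int>\<close> one has \<open>G/L = \<int>[1/p]/\<int>\<close>, whereas \<open>j = 0\<close>.\<close>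

definition pruefer_rank :: "int mat \<Rightarrow> nat \<Rightarrow> nat" where
  "pruefer_rank A p = dim_row A - last_unit_index A p"


section \<open>The \<open>p\<close>-adic numbers as the completion of the rationals\<close>

definition padic_val :: "nat \<Rightarrow> rat \<Rightarrow> int" where
  "padic_val p x = int (multiplicity (int p) (fst (quotient_of x)))
                 - int (multiplicity (int p) (snd (quotient_of x)))"

definition padic_abs :: "nat \<Rightarrow> rat \<Rightarrow> real" where
  "padic_abs p x = (if x = 0 then 0 else real p powi (- padic_val p x))"

definition padic_cauchy :: "nat \<Rightarrow> (nat \<Rightarrow> rat) \<Rightarrow> bool" where
  "padic_cauchy p X \<longleftrightarrow> (\<forall>e>0. \<exists>M. \<forall>m\<ge>M. \<forall>n\<ge>M. padic_abs p (X m - X n) < e)"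

definition padic_cauchy_ring :: "nat \<Rightarrow> (nat \<Rightarrow> rat) ring" where
  "padic_cauchy_ring p =
     \<lparr>carrier = {X. padic_cauchy p X},
      monoid.mult = (\<lambda>X Y n. X n * Y n), one = (\<lambda>_. 1),
      ring.zero = (\<lambda>_. 0), ring.add = (\<lambda>X Y n. X n + Y n)\<rparr>"

definition padic_null :: "nat \<Rightarrow> (nat \<Rightarrow> rat) set" where
  "padic_null p = {X. (\<lambda>n. padic_abs p (X n)) \<longlonglongrightarrow> 0}"

definition Q_padic :: "nat \<Rightarrow> (nat \<Rightarrow> rat) set ring" where
  "Q_padic p = padic_cauchy_ring p Quot padic_null p"

definition padic_lim :: "nat \<Rightarrow> (nat \<Rightarrow> rat) \<Rightarrow> (nat \<Rightarrow> rat) set" where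
  "padic_lim p X = padic_null p +>\<^bsub>padic_cauchy_ring p\<^esub> X"

definition padic_of_rat :: "nat \<Rightarrow> rat \<Rightarrow> (nat \<Rightarrow> rat) set" where
  "padic_of_rat p x = padic_lim p (\<lambda>_. x)"

text \<open>The closed unit ball of \<open>\<rat>\<^sub>p\<close>.\<close>

definition Z_padic :: "nat \<Rightarrow> (nat \<Rightarrow> rat) set set" where
  "Z_padic p = {x \<in> carrier (Q_padic p). \<exists>X\<in>x. \<forall>n. padic_abs p (X n) \<le> 1}"


section \<open>The \<open>p\<close>-adic eventual row space\<close>

text \<open>The powers \<open>A, A\<^sup>2, \<dots>\<close> contain exactly one idempotent modulo \<open>p\<^sup>m\<close>;
  \<open>idem_exp p A m\<close> is the least exponent at which it occurs. The entries of
  \<open>A ^\<^sub>m idem_exp p A m\<close>, \<open>m = 0, 1, \<dots>\<close>, are Cauchy sequences of integers, and their limits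
  are the entries of the idempotent matrix \<open>padic_idem p A\<close>.\<close>

definition idem_exp :: "nat \<Rightarrow> int mat \<Rightarrow> nat \<Rightarrow> nat" where
  "idem_exp p A m = (LEAST k. 1 \<le> k \<and>
     (\<forall>i<dim_row A. \<forall>j<dim_row A.
        [(A ^\<^sub>m k * A ^\<^sub>m k) $$ (i, j) = (A ^\<^sub>m k) $$ (i, j)] (mod (int p ^ m))))"

definition padic_idem :: "nat \<Rightarrow> int mat \<Rightarrow> (nat \<Rightarrow> rat) set mat" where
  "padic_idem p A = mat (dim_row A) (dim_row A)
     (\<lambda>(i, j). padic_lim p (\<lambda>m. of_int ((A ^\<^sub>m idem_exp p A m) $$ (i, j))))"

definition padic_row_space :: "nat \<Rightarrow> int mat \<Rightarrow> (nat \<Rightarrow> rat) set vec set" where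
  "padic_row_space p A =
     {vec (dim_row A)
        (\<lambda>j. \<Oplus>\<^bsub>Q_padic p\<^esub>i\<in>{..<dim_row A}. c i \<otimes>\<^bsub>Q_padic p\<^esub> padic_idem p A $$ (i, j))
      | c. \<forall>i<dim_row A. c i \<in> Z_padic p}"

definition padic_pairing ::
    "nat \<Rightarrow> (nat \<Rightarrow> rat) set vec \<Rightarrow> rat vec \<Rightarrow> (nat \<Rightarrow> rat) set" where
  "padic_pairing p w v =
     (\<Oplus>\<^bsub>Q_padic p\<^esub>i\<in>{..<dim_vec v}. w $ i \<otimes>\<^bsub>Q_padic p\<^esub> padic_of_rat p (v $ i))"


section \<open>Inverting all primes except \<open>p\<close>\<close>

definition rat_localization :: "nat \<Rightarrow> rat set" where
  "rat_localization p = {of_int a / of_int b | a b. \<not> int p dvd b}"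

text \<open>The image of \<open>G \<otimes> R\<close> in \<open>\<rat>\<^sup>N\<close>, for a subring \<open>R\<close> of \<open>\<rat>\<close>.\<close>

definition tensor_subring :: "nat \<Rightarrow> rat vec set \<Rightarrow> rat set \<Rightarrow> rat vec set" where
  "tensor_subring N G R = generate (Q_vec N) {r \<cdot>\<^sub>v g | r g. r \<in> R \<and> g \<in> G}"

end

theory Submission
  imports Defs
begin

text \<open>
  In coordinates with respect to a basis of \<open>L\<close> the matrix \<open>A\<close> becomes an integer matrix \<open>B\<close> with the
  same characteristic polynomial, and \<open>G/L\<close> becomes \<open>H = W/\<int>\<^sup>N\<close>, where \<open>W\<close> is the set of all \<open>u \<in> \<rat>\<^sup>N\<close>
  with \<open>B\<^sup>k u \<in> \<int>\<^sup>N\<close> for some \<open>k\<close>. Multiplication by the adjugate of \<open>B\<^sup>k\<close> shows that \<open>H\<close> is torsion with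
  only primes \<open>p\<close> dividing \<open>det B\<close> occurring. Its \<open>p\<close>-primary part is divisible: if \<open>F\<close> is a high power of \<open>B\<close>
  that is idempotent modulo a high power of \<open>p\<close>, then \<open>(1 - F) (u / p)\<close> is a \<open>p\<close>-th part of \<open>u\<close>.
  A divisible group of this kind is a product of Pruefer groups, the number of copies for the prime
  \<open>p\<close> being the dimension of the socle \<open>{y. p y = 0}\<close>. Here the socle is the generalized kernel of \<open>B\<close>
  modulo \<open>p\<close>, whose dimension is the multiplicity of the root \<open>0\<close> of the characteristic polynomial
  modulo \<open>p\<close>, as one sees by splitting off one kernel vector at a time. (A variable prime \<open>p\<close> gives
  no type with \<open>p\<close> elements, so linear algebra over the prime field is done with integer matrices
  and congruences.)

  For the duality, both sides consist of the \<open>v\<close> such that \<open>A\<^sup>k v\<close> is \<open>p\<close>-integral for some \<open>k\<close>: an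
  exponent \<open>e\<close> with \<open>A\<^sup>e\<close> idempotent modulo \<open>p\<^sup>m\<close> may be replaced by any of its multiples, and \<open>v\<close> has
  bounded denominators.
\<close>



section \<open>Congruences of vectors and matrices\<close>

text \<open>Modulo \<open>p\<close> the matrix \<open>B\<close> splits into a nilpotent and an
  invertible part; the proof separates their effects without constructing the splitting. On the
  invertible part no power of \<open>B\<close> makes \<open>x\<close> divisible by \<open>p\<close>
  unless \<open>x\<close> already is, so new denominators \<open>p\<close> come only from the
  nilpotent part. This is why the socle consists of the \<open>x / p\<close> with \<open>x\<close>
  in the generalized kernel. Conversely \<open>u / p\<close> may fail to belong to the group because
  of its component in the invertible part: an idempotent power \<open>F\<close> approximates the
  projection to that part and \<open>1 - F\<close> removes it, while integrality of
  \<open>F u\<close> ensures that \<open>p\<close> times the result is still \<open>u\<close> modulo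
  integer vectors. The structure of a divisible group is then read off from its socle: every socle
  basis element extends, by repeated \<open>p\<close>-th roots, to a homomorphism from Z[1/p]. The
  combined map is injective because a nontrivial kernel would show up in the socle, and surjective
  by induction on the order of an element. Matrices invertible modulo \<open>p\<close> have no
  integral inverse in general, so similarity modulo \<open>p\<close> is stated as an intertwining
  relation.\<close>

definition cong_vec :: "'a::comm_ring_1 \<Rightarrow> 'a vec \<Rightarrow> 'a vec \<Rightarrow> bool" where
  "cong_vec d v w \<longleftrightarrow> dim_vec v = dim_vec w \<and> (\<forall>i<dim_vec v. d dvd v $ i - w $ i)"

text \<open>The modulus lies in an arbitrary commutative ring because the same notion serves integer
  matrices modulo \<open>p\<close> and characteristic matrices modulo the constant polynomial
  \<open>[:p:]\<close>.\<close>

definition cong_mat :: "'a::comm_ring_1 \<Rightarrow> 'a mat \<Rightarrow> 'a mat \<Rightarrow> bool" where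
  "cong_mat d A B \<longleftrightarrow> dim_row A = dim_row B \<and> dim_col A = dim_col B \<and>
     (\<forall>i<dim_row A. \<forall>j<dim_col A. d dvd A $$ (i, j) - B $$ (i, j))"

lemma cong_vec_refl [simp]: "cong_vec d v v"
  by (simp add: cong_vec_def)

lemma cong_vec_sym: "cong_vec d v w \<Longrightarrow> cong_vec d w v"
  unfolding cong_vec_def by (metis dvd_minus_iff minus_diff_eq)

lemma cong_vec_trans [trans]:
  assumes "cong_vec d u v" "cong_vec d v w" shows "cong_vec d u w"
proof -
  have "d dvd u $ i - w $ i" if "i < dim_vec u" for i
  proof -
    have "u $ i - w $ i = (u $ i - v $ i) + (v $ i - w $ i)" by simp
    then show ?thesis using assms that unfolding cong_vec_def by (metis dvd_add)
  qed
  then show ?thesis using assms by (simp add: cong_vec_def)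
qed

lemma cong_vec_0_iff: "v \<in> carrier_vec n \<Longrightarrow> cong_vec d v (0\<^sub>v n) \<longleftrightarrow> (\<forall>i<n. d dvd v $ i)"
  by (auto simp: cong_vec_def)

lemma cong_mat_refl [simp]: "cong_mat d A A"
  by (simp add: cong_mat_def)

lemma cong_mat_sym: "cong_mat d A B \<Longrightarrow> cong_mat d B A"
  unfolding cong_mat_def by (metis dvd_minus_iff minus_diff_eq)

lemma cong_mat_trans [trans]:
  assumes "cong_mat d A B" "cong_mat d B C" shows "cong_mat d A C"
proof -
  have "d dvd A $$ (i, j) - C $$ (i, j)" if "i < dim_row A" "j < dim_col A" for i j
  proof -
    have "A $$ (i, j) - C $$ (i, j) = (A $$ (i, j) - B $$ (i, j)) + (B $$ (i, j) - C $$ (i, j))"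
      by simp
    then show ?thesis using assms that unfolding cong_mat_def by (metis dvd_add)
  qed
  then show ?thesis using assms by (simp add: cong_mat_def)
qed

lemma cong_mat_dvd: "e dvd d \<Longrightarrow> cong_mat d A B \<Longrightarrow> cong_mat e A B"
  unfolding cong_mat_def using dvd_trans by blast

text \<open>The common source of the congruences for matrix products, matrix-vector products and
  determinants, all of which are sums of products.\<close>

lemma dvd_sum_mult_diff:
  fixes d :: "'a::comm_ring_1"
  assumes "\<And>i. i \<in> I \<Longrightarrow> d dvd a i - a' i" "\<And>i. i \<in> I \<Longrightarrow> d dvd b i - b' i"
  shows "d dvd (\<Sum>i\<in>I. a i * b i) - (\<Sum>i\<in>I. a' i * b' i)"
proof -
  have "a i * b i - a' i * b' i = a i * (b i - b' i) + (a i - a' i) * b' i" for i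
    by (simp add: algebra_simps)
  then have "d dvd a i * b i - a' i * b' i" if "i \<in> I" for i
    using assms[OF that] by (metis dvd_add dvd_mult dvd_mult2)
  then show ?thesis unfolding sum_subtractf[symmetric] by (intro dvd_sum) auto
qed

lemma cong_mat_mult:
  assumes "cong_mat d A A'" "cong_mat d B B'" "dim_col A = dim_row B"
  shows "cong_mat d (A * B) (A' * B')"
  using assms unfolding cong_mat_def
  by (auto simp: scalar_prod_def intro!: dvd_sum_mult_diff)

lemma cong_mat_vec:
  assumes "cong_mat d A A'" "cong_vec d v v'" "dim_col A = dim_vec v"
  shows "cong_vec d (A *\<^sub>v v) (A' *\<^sub>v v')"
  using assms unfolding cong_mat_def cong_vec_def
  by (auto simp: scalar_prod_def intro!: dvd_sum_mult_diff)

lemma dvd_prod_diff: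
  fixes d :: "'a::comm_ring_1"
  assumes "finite I" "\<And>i. i \<in> I \<Longrightarrow> d dvd f i - g i"
  shows "d dvd prod f I - prod g I"
  using assms
proof (induction I rule: finite_induct)
  case (insert x F)
  have "prod f (insert x F) - prod g (insert x F)
      = f x * (prod f F - prod g F) + (f x - g x) * prod g F"
    using insert by (simp add: algebra_simps)
  then show ?case using insert by (metis dvd_add dvd_mult dvd_mult2 insertCI)
qed simp

lemma cong_mat_det:
  assumes "A \<in> carrier_mat n n" "cong_mat d A B"
  shows "d dvd det A - det B"
proof -
  have B: "B \<in> carrier_mat n n" using assms by (auto simp: cong_mat_def)
  have "d dvd (\<Prod>i=0..<n. A $$ (i, p i)) - (\<Prod>i=0..<n. B $$ (i, p i))"
    if "p permutes {0..<n}" for p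
    using assms permutes_in_image[OF that]
    by (intro dvd_prod_diff) (auto simp: cong_mat_def)
  then have "d dvd (\<Sum>p | p permutes {0..<n}. signof p * (\<Prod>i=0..<n. A $$ (i, p i)))
       - (\<Sum>p | p permutes {0..<n}. signof p * (\<Prod>i=0..<n. B $$ (i, p i)))"
    by (intro dvd_sum_mult_diff) auto
  then show ?thesis using assms(1) B by (simp add: det_def')
qed

section \<open>Powers of a square matrix\<close>

lemma pow_mat_add:
  assumes A: "A \<in> carrier_mat n n"
  shows "A ^\<^sub>m (k + l) = A ^\<^sub>m k * A ^\<^sub>m l"
proof (induction l)
  case (Suc l)
  then show ?case
    using assoc_mult_mat[OF pow_carrier_mat[OF A] pow_carrier_mat[OF A] A] by simp
qed (use A in simp)

lemma pow_mat_Suc_left: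
  assumes A: "A \<in> carrier_mat n n"
  shows "A ^\<^sub>m (Suc k) = A * A ^\<^sub>m k"
  using pow_mat_add[OF A, of 1 k] A by simp

lemma pow_mat_Suc_vec:
  assumes A: "A \<in> carrier_mat n n" and v: "v \<in> carrier_vec n"
  shows "A ^\<^sub>m (Suc k) *\<^sub>v v = A *\<^sub>v (A ^\<^sub>m k *\<^sub>v v)"
  unfolding pow_mat_Suc_left[OF A] using assms by (intro assoc_mult_mat_vec) auto

lemma pow_mat_add_vec:
  assumes A: "A \<in> carrier_mat n n" and v: "v \<in> carrier_vec n"
  shows "A ^\<^sub>m (k + l) *\<^sub>v v = A ^\<^sub>m k *\<^sub>v (A ^\<^sub>m l *\<^sub>v v)"
  unfolding pow_mat_add[OF A] using assms by (intro assoc_mult_mat_vec) auto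

section \<open>The generalized kernel of an integer matrix modulo a prime\<close>

text \<open>An injective self-map of a finite set is surjective; on the box of reduced residue
  vectors this yields preimages of the unit vectors, which are the columns of the inverse. Counting
  stands in for elimination over the residue field.\<close>

lemma right_inverse_mod:
  fixes B :: "int mat"
  assumes B: "B \<in> carrier_mat n n" and p: "1 < p"
    and inj: "\<And>v. v \<in> carrier_vec n \<Longrightarrow> cong_vec p (B *\<^sub>v v) (0\<^sub>v n) \<Longrightarrow> cong_vec p v (0\<^sub>v n)"
  obtains C where "C \<in> carrier_mat n n" "cong_mat p (B * C) (1\<^sub>m n)"
proof -
  \<comment> \<open>On reduced representatives congruence modulo \<open>p\<close> is equality, so
    ordinary injectivity of \<open>f\<close> can be tested.\<close>
  define S where "S = {v \<in> carrier_vec n. \<forall>i<n. 0 \<le> v $ i \<and> v $ i < p}"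
  define f where "f v = vec n (\<lambda>i. (B *\<^sub>v v) $ i mod p)" for v
  have "S \<subseteq> vec n ` (PiE {..<n} (\<lambda>_. {0..<p}))"
  proof
    fix v assume v: "v \<in> S"
    then have "v = vec n (\<lambda>i\<in>{..<n}. v $ i)" by (auto simp: S_def)
    moreover have "(\<lambda>i\<in>{..<n}. v $ i) \<in> PiE {..<n} (\<lambda>_. {0..<p})"
      using v by (auto simp: S_def)
    ultimately show "v \<in> vec n ` (PiE {..<n} (\<lambda>_. {0..<p}))" by (metis imageI)
  qed
  then have fin: "finite S" by (rule finite_subset) (simp add: finite_PiE)
  have "inj_on f S"
  proof (rule inj_onI)
    fix v w assume v: "v \<in> S" and w: "w \<in> S" and eq: "f v = f w"
    have vw: "v \<in> carrier_vec n" "w \<in> carrier_vec n" using v w by (auto simp: S_def)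
    have "p dvd (B *\<^sub>v v) $ i - (B *\<^sub>v w) $ i" if "i < n" for i
    proof -
      have "f v $ i = f w $ i" by (simp add: eq)
      then show ?thesis using that by (simp add: f_def mod_eq_dvd_iff)
    qed
    then have "cong_vec p (B *\<^sub>v (v - w)) (0\<^sub>v n)"
      using B vw by (simp add: mult_minus_distrib_mat_vec[OF B vw] cong_vec_def)
    then have *: "cong_vec p (v - w) (0\<^sub>v n)" using inj vw by auto
    have "v $ i = w $ i" if "i < n" for i
    proof -
      have "p dvd v $ i - w $ i" using * vw that by (simp add: cong_vec_def)
      then have "v $ i mod p = w $ i mod p" by (simp add: mod_eq_dvd_iff)
      then show ?thesis using v w that by (simp add: S_def)
    qed
    then show "v = w" using vw by auto
  qed
  moreover have "f ` S \<subseteq> S" using p by (auto simp: f_def S_def)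
  ultimately have surj: "f ` S = S" using fin endo_inj_surj by blast
  have "\<exists>v\<in>S. f v = unit_vec n j" if "j < n" for j
  proof -
    have "unit_vec n j \<in> S" using p that by (auto simp: S_def unit_vec_def)
    then show ?thesis using surj by (metis imageE)
  qed
  then obtain c where c: "c j \<in> S" "f (c j) = unit_vec n j" if "j < n" for j by metis
  define C where "C = mat n n (\<lambda>(i, j). c j $ i)"
  have "p dvd (B * C) $$ (i, j) - 1\<^sub>m n $$ (i, j)" if "i < n" "j < n" for i j
  proof -
    have "col C j = c j" using c(1)[OF that(2)] that by (auto simp: C_def S_def)
    then have "(B * C) $$ (i, j) = (B *\<^sub>v c j) $ i" using that B by (simp add: C_def)
    moreover have "(B *\<^sub>v c j) $ i mod p = unit_vec n j $ i"
      using arg_cong[OF c(2)[OF that(2)], of "\<lambda>v. v $ i"] that by (simp add: f_def)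
    ultimately have "(B * C) $$ (i, j) mod p = 1\<^sub>m n $$ (i, j) mod p"
      using that p by (auto simp: unit_vec_def)
    then show ?thesis by (simp add: mod_eq_dvd_iff)
  qed
  then have "cong_mat p (B * C) (1\<^sub>m n)" using B by (simp add: cong_mat_def C_def)
  then show ?thesis using that[of C] by (simp add: C_def)
qed

text \<open>Without such a vector \<open>B\<close> would have a right inverse modulo
  \<open>p\<close>, making \<open>det B\<close> a unit modulo \<open>p\<close>.\<close>

lemma kernel_vector_mod_prime:
  fixes B :: "int mat"
  assumes B: "B \<in> carrier_mat n n" and p: "prime p" and dvd: "p dvd det B"
  obtains v where "v \<in> carrier_vec n" "cong_vec p (B *\<^sub>v v) (0\<^sub>v n)" "\<not> cong_vec p v (0\<^sub>v n)"
proof (rule ccontr)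
  assume "\<not> thesis"
  then have inj: "\<And>v. v \<in> carrier_vec n \<Longrightarrow> cong_vec p (B *\<^sub>v v) (0\<^sub>v n) \<Longrightarrow> cong_vec p v (0\<^sub>v n)"
    using that by blast
  obtain C where C: "C \<in> carrier_mat n n" "cong_mat p (B * C) (1\<^sub>m n)"
    using right_inverse_mod[OF B prime_gt_1_int[OF p] inj] by blast
  have "p dvd det (B * C) - det (1\<^sub>m n)"
    using C B by (intro cong_mat_det[where n = n]) auto
  then have "p dvd det B * det C - 1" using B C(1) by (simp add: det_mult)
  moreover have "p dvd det B * det C" using dvd by simp
  ultimately have "p dvd det B * det C - (det B * det C - 1)" by (rule dvd_diff[rotated])
  then show False using p by (simp add: prime_int_iff)
qed

text \<open>The adjugate turns \<open>B v\<close> into \<open>det B\<close> times \<open>v\<close>,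
  and a factor prime to \<open>p\<close> can be cancelled entrywise.\<close>

lemma cong_vec_0_if_not_dvd_det:
  fixes B :: "int mat"
  assumes B: "B \<in> carrier_mat n n" and p: "prime p" and dvd: "\<not> p dvd det B"
    and v: "v \<in> carrier_vec n" and Bv: "cong_vec p (B *\<^sub>v v) (0\<^sub>v n)"
  shows "cong_vec p v (0\<^sub>v n)"
proof -
  have "adj_mat B *\<^sub>v (B *\<^sub>v v) = (adj_mat B * B) *\<^sub>v v"
    using adj_mat(1)[OF B] B v by simp
  also have "\<dots> = det B \<cdot>\<^sub>v v" using adj_mat(3)[OF B] v by auto
  finally have "cong_vec p (det B \<cdot>\<^sub>v v) (adj_mat B *\<^sub>v 0\<^sub>v n)"
    using cong_mat_vec[OF cong_mat_refl Bv, of "adj_mat B"] adj_mat(1)[OF B] B by simp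
  also have "adj_mat B *\<^sub>v 0\<^sub>v n = 0\<^sub>v n" using adj_mat(1)[OF B] by auto
  finally show ?thesis
    using v p dvd by (auto simp: cong_vec_0_iff prime_dvd_mult_iff)
qed

text \<open>For \<open>p\<close> prime and \<open>f\<close> nonzero modulo \<open>p\<close> this is
  the multiplicity of the root 0 of the reduction of \<open>f\<close>. Characteristic polynomials
  are monic, so for them the minimum exists.\<close>

definition low_order :: "int \<Rightarrow> int poly \<Rightarrow> nat" where
  "low_order p f = (LEAST i. \<not> p dvd coeff f i)"

text \<open>The hypothesis has the form obtained by taking determinants in
  \<open>U (x - W) = (x - B) U\<close> modulo \<open>p\<close>, with \<open>a\<close> the
  determinant of \<open>U\<close>.\<close>

lemma low_order_mult_cong:
  assumes p: "prime p" and a: "\<not> p dvd a" and fg: "[:p:] dvd [:a:] * f - g * [:a:]"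
  shows "low_order p f = low_order p g"
proof -
  have "p dvd coeff f i \<longleftrightarrow> p dvd coeff g i" for i
  proof -
    have "p dvd a * (coeff f i - coeff g i)"
      using fg by (auto simp: const_poly_dvd_iff algebra_simps)
    then have "p dvd coeff f i - coeff g i" using p a by (simp add: prime_dvd_mult_iff)
    then show ?thesis by (metis diff_add_cancel dvd_add_right_iff)
  qed
  then show ?thesis by (simp add: low_order_def)
qed

lemma low_order_pCons_0:
  assumes "\<not> p dvd coeff f i"
  shows "low_order p (pCons 0 f) = Suc (low_order p f)"
  unfolding low_order_def
  by (subst Least_Suc[of _ "Suc i"]) (use assms in auto)

lemma coeff_0_char_poly:
  assumes B: "B \<in> carrier_mat n n"
  shows "coeff (char_poly B) 0 = (-1) ^ n * det B"
proof -
  have "poly (char_poly B) 0 = det ((-1) \<cdot>\<^sub>m B)"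
    unfolding char_poly_def
    by (rule poly_det_cong[of _ n]) (use B in \<open>auto simp: char_poly_matrix_def\<close>)
  then show ?thesis using B by (simp add: det_smult poly_0_coeff_0)
qed

section \<open>Splitting off a kernel vector modulo a prime\<close>

lemma cong_vec_mult_mat:
  assumes "A \<in> carrier_mat m n" "v \<in> carrier_vec n" "cong_vec d v w"
  shows "cong_vec d (A *\<^sub>v v) (A *\<^sub>v w)"
  using assms by (intro cong_mat_vec) auto

text \<open>Some entry \<open>v $ i\<close> is a unit modulo \<open>p\<close>, so \<open>v\<close>
  can replace the unit vector with index \<open>i\<close> in the standard basis. Since
  \<open>v\<close> has to be column 0, the unit vector with index 0 moves to column \<open>i\<close>
  when \<open>i\<close> is not 0.\<close>

lemma complete_to_basis_mod_prime:
  fixes v :: "int vec"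
  assumes v: "v \<in> carrier_vec (Suc n)" and p: "prime p" and nz: "\<not> cong_vec p v (0\<^sub>v (Suc n))"
  obtains U where "U \<in> carrier_mat (Suc n) (Suc n)" "col U 0 = v"
    "\<And>w. w \<in> carrier_vec (Suc n) \<Longrightarrow> cong_vec p (U *\<^sub>v w) (0\<^sub>v (Suc n)) \<Longrightarrow> cong_vec p w (0\<^sub>v (Suc n))"
proof -
  from nz v obtain i where i: "i < Suc n" "\<not> p dvd v $ i" by (auto simp: cong_vec_0_iff)
  define U where "U = mat (Suc n) (Suc n)
    (\<lambda>(r, c). if c = 0 then v $ r else if c = i then (if r = 0 then 1 else 0)
              else if r = c then 1 else 0)"
  have U: "U \<in> carrier_mat (Suc n) (Suc n)" by (simp add: U_def)
  have col: "col U 0 = v" using v by (auto simp: U_def)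
  have "cong_vec p w (0\<^sub>v (Suc n))"
    if w: "w \<in> carrier_vec (Suc n)" and Uw: "cong_vec p (U *\<^sub>v w) (0\<^sub>v (Suc n))" for w
  proof -
    define e where "e r c = (if c = i then (if r = 0 then 1 else 0) else if r = c then 1 else 0 :: int)" for r c
    have Uw_r: "(U *\<^sub>v w) $ r = v $ r * w $ 0 + (\<Sum>c<n. e r (Suc c) * w $ Suc c)" if "r < Suc n" for r
    proof -
      have "(U *\<^sub>v w) $ r = (\<Sum>c\<in>{0..<Suc n}. U $$ (r, c) * w $ c)"
        using that w U by (auto simp: scalar_prod_def intro!: sum.cong)
      also have "\<dots> = U $$ (r, 0) * w $ 0 + (\<Sum>c\<in>{0..<n}. U $$ (r, Suc c) * w $ Suc c)"
        by (simp only: sum.atLeast0_lessThan_Suc_shift o_def)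
      also have "(\<Sum>c\<in>{0..<n}. U $$ (r, Suc c) * w $ Suc c) = (\<Sum>c<n. e r (Suc c) * w $ Suc c)"
        using that by (intro sum.cong) (auto simp: U_def e_def)
      finally show ?thesis using that by (simp add: U_def)
    qed
    have dvd: "p dvd v $ r * w $ 0 + (\<Sum>c<n. e r (Suc c) * w $ Suc c)" if "r < Suc n" for r
      using Uw that U w by (simp add: cong_vec_0_iff[of _ "Suc n"] flip: Uw_r)
    \<comment> \<open>Row \<open>i\<close> of \<open>U\<close> vanishes outside column 0, so it
      isolates \<open>w $ 0\<close>.\<close>
    have "(\<Sum>c<n. e i (Suc c) * w $ Suc c) = 0"
      by (intro sum.neutral) (auto simp: e_def)
    then have w0: "p dvd w $ 0" using dvd[OF i(1)] i p by (simp add: prime_dvd_mult_iff)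
    have dvd': "p dvd (\<Sum>c<n. e r (Suc c) * w $ Suc c)" if "r < Suc n" for r
      using dvd[OF that] w0 by (simp add: dvd_add_right_iff)
    have "p dvd w $ j" if j: "j < Suc n" for j
    proof (cases j)
      case (Suc c)
      \<comment> \<open>The row in which column \<open>j\<close> of \<open>U\<close> has its only 1;
        it isolates \<open>w $ j\<close> once \<open>w $ 0\<close> has been disposed of.\<close>
      define r where "r = (if j = i then 0 else j)"
      have "e r (Suc c') * w $ Suc c' = (if c' = c then w $ j else 0)" if "c' < n" for c'
        using Suc that by (auto simp: e_def r_def)
      then have "(\<Sum>c'<n. e r (Suc c') * w $ Suc c') = (\<Sum>c'<n. if c' = c then w $ j else 0)"
        by (intro sum.cong) auto
      also have "\<dots> = w $ j" using Suc j by simp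
      finally show ?thesis using dvd'[of r] j by (simp add: r_def split: if_splits)
    qed (use w0 in simp)
    then show ?thesis using w by (simp add: cong_vec_0_iff)
  qed
  then show ?thesis using that U col by blast
qed

text \<open>In a basis that starts with a kernel vector, the first column of the transformed matrix
  vanishes modulo \<open>p\<close>. The later induction needs \<open>U\<close> injective and right
  invertible modulo \<open>p\<close>, and these facts are exported along with the intertwining
  relation.\<close>

lemma deflate_mod_prime:
  fixes B :: "int mat"
  assumes B: "B \<in> carrier_mat (Suc n) (Suc n)" and p: "prime p" and dvd: "p dvd det B"
  obtains U V A2 A3 where "U \<in> carrier_mat (Suc n) (Suc n)" "V \<in> carrier_mat (Suc n) (Suc n)"
    "A2 \<in> carrier_mat 1 n" "A3 \<in> carrier_mat n n"
    "\<And>w. w \<in> carrier_vec (Suc n) \<Longrightarrow> cong_vec p (U *\<^sub>v w) (0\<^sub>v (Suc n)) \<Longrightarrow> cong_vec p w (0\<^sub>v (Suc n))"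
    "cong_mat p (U * V) (1\<^sub>m (Suc n))"
    "cong_mat p (U * four_block_mat (0\<^sub>m 1 1) A2 (0\<^sub>m n 1) A3) (B * U)"
proof -
  obtain v where v: "v \<in> carrier_vec (Suc n)" "cong_vec p (B *\<^sub>v v) (0\<^sub>v (Suc n))"
    "\<not> cong_vec p v (0\<^sub>v (Suc n))"
    using kernel_vector_mod_prime[OF B p dvd] by blast
  obtain U where U: "U \<in> carrier_mat (Suc n) (Suc n)" "col U 0 = v"
    and inj: "\<And>w. w \<in> carrier_vec (Suc n) \<Longrightarrow> cong_vec p (U *\<^sub>v w) (0\<^sub>v (Suc n)) \<Longrightarrow> cong_vec p w (0\<^sub>v (Suc n))"
    using complete_to_basis_mod_prime[OF v(1) p v(3)] by blast
  obtain V where V: "V \<in> carrier_mat (Suc n) (Suc n)" "cong_mat p (U * V) (1\<^sub>m (Suc n))"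
    using right_inverse_mod[OF U(1) prime_gt_1_int[OF p] inj] by blast
  \<comment> \<open>\<open>V\<close> inverts \<open>U\<close> modulo \<open>p\<close>, so
    \<open>W\<close> represents \<open>B\<close> in the new basis.\<close>
  define W where "W = V * (B * U)"
  have W: "W \<in> carrier_mat (Suc n) (Suc n)" using U V B by (simp add: W_def)
  have UW: "cong_mat p (U * W) (B * U)"
  proof -
    have "cong_mat p ((U * V) * (B * U)) (1\<^sub>m (Suc n) * (B * U))"
      using V(2) B U V by (intro cong_mat_mult) auto
    moreover have "(U * V) * (B * U) = U * W"
      unfolding W_def using U V B by (intro assoc_mult_mat) auto
    ultimately show ?thesis using B U by simp
  qed
  have "cong_vec p (V *\<^sub>v (B *\<^sub>v v)) (V *\<^sub>v 0\<^sub>v (Suc n))"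
    using v B V by (intro cong_mat_vec) auto
  moreover have "V *\<^sub>v 0\<^sub>v (Suc n) = 0\<^sub>v (Suc n)" using V by auto
  moreover have "V *\<^sub>v (B *\<^sub>v v) = col W 0"
  proof -
    have "col W 0 = V *\<^sub>v col (B * U) 0"
      unfolding W_def using V B U by (intro col_mult2) auto
    also have "col (B * U) 0 = B *\<^sub>v v"
      unfolding U(2)[symmetric] using B U by (intro col_mult2) auto
    finally show ?thesis ..
  qed
  ultimately have "cong_vec p (col W 0) (0\<^sub>v (Suc n))" by simp
  then have W0: "p dvd W $$ (i, 0)" if "i < Suc n" for i
    using that W by (simp add: cong_vec_def)
  \<comment> \<open>Column 0 of \<open>W\<close> consists of multiples of \<open>p\<close> and may
    be replaced by exact zeros; the remaining blocks are copied.\<close>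
  define A2 where "A2 = mat 1 n (\<lambda>(i, j). W $$ (0, Suc j))"
  define A3 where "A3 = mat n n (\<lambda>(i, j). W $$ (Suc i, Suc j))"
  have "cong_mat p (four_block_mat (0\<^sub>m 1 1) A2 (0\<^sub>m n 1) A3) W"
    using W W0 by (auto simp: cong_mat_def A2_def A3_def)
  then have "cong_mat p (U * four_block_mat (0\<^sub>m 1 1) A2 (0\<^sub>m n 1) A3) (U * W)"
    using U by (intro cong_mat_mult) (auto simp: A2_def A3_def)
  then have "cong_mat p (U * four_block_mat (0\<^sub>m 1 1) A2 (0\<^sub>m n 1) A3) (B * U)"
    using UW by (rule cong_mat_trans)
  moreover have "A2 \<in> carrier_mat 1 n" "A3 \<in> carrier_mat n n" by (simp_all add: A2_def A3_def)
  ultimately show ?thesis using that[of U V A2 A3, OF U(1) V(1) _ _ inj V(2)] by blast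
qed

text \<open>Determinants of \<open>U (x - W) = (x - B) U\<close> modulo \<open>p\<close> show that
  the characteristic polynomials agree up to the factor \<open>det U\<close>, which is a unit modulo
  \<open>p\<close>.\<close>

lemma low_order_intertwine:
  assumes U: "U \<in> carrier_mat n n" and B: "B \<in> carrier_mat n n" and W: "W \<in> carrier_mat n n"
    and p: "prime p" and det: "\<not> p dvd det U" and UW: "cong_mat p (U * W) (B * U)"
  shows "low_order p (char_poly B) = low_order p (char_poly W)"
proof -
  \<comment> \<open>The embedding of the integers as constant polynomials; as a ring homomorphism it
    commutes with matrix products and determinants.\<close>
  define c :: "int \<Rightarrow> int poly" where "c a = [:a:]" for a
  have c: "c 0 = 0" "c (a + b) = c a + c b" "c (a * b) = c a * c b" "c (- a) = - c a" "c 1 = 1" for a b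
    by (simp_all add: c_def one_pCons)
  interpret c: comm_ring_hom c by unfold_locales (simp_all add: c)
  let ?U = "map_mat c U"
  let ?X = "\<lambda>M. [:0, 1:] \<cdot>\<^sub>m 1\<^sub>m n - map_mat c M"
  have X: "char_poly_matrix M = ?X M" if "M \<in> carrier_mat n n" for M
    using that by (auto simp: char_poly_matrix_def c_def intro!: eq_matI)
  have 1: "?U * ?X W = [:0, 1:] \<cdot>\<^sub>m ?U - map_mat c (U * W)"
    using U W by (subst mult_minus_distrib_mat[of _ n n _ n])
      (auto simp: c.mat_hom_mult mult_smult_distrib[of _ n n _ n])
  have 2: "?X B * ?U = [:0, 1:] \<cdot>\<^sub>m ?U - map_mat c (B * U)"
    using U B by (subst minus_mult_distrib_mat[of _ n n _ _ n])
      (auto simp: c.mat_hom_mult mult_smult_assoc_mat[of _ n n _ n])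
  have "cong_mat [:p:] (?U * ?X W) (?X B * ?U)"
    unfolding 1 2 using UW U B W
    by (auto simp: cong_mat_def c_def const_poly_dvd_iff coeff_pCons dvd_diff_commute split: nat.splits)
  then have *: "[:p:] dvd det (?U * ?X W) - det (?X B * ?U)"
    using U W by (intro cong_mat_det[where n = n]) auto
  have "[:p:] dvd [:det U:] * char_poly W - char_poly B * [:det U:]"
  proof -
    have "det (?U * ?X W) = det ?U * det (?X W)"
      by (rule det_mult[of _ n]) (use U W in auto)
    moreover have "det (?X B * ?U) = det (?X B) * det ?U"
      by (rule det_mult[of _ n]) (use U B in auto)
    moreover have "det ?U = [:det U:]" unfolding c.hom_det by (simp add: c_def)
    ultimately show ?thesis using * X[OF W] X[OF B] by (simp only: char_poly_def)
  qed
  then show ?thesis using low_order_mult_cong[OF p det] by metis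
qed

section \<open>Block triangular matrices acting on head and tail of a vector\<close>

definition vec_tail :: "'a vec \<Rightarrow> 'a vec" where
  "vec_tail v = vec (dim_vec v - 1) (\<lambda>i. v $ Suc i)"

lemma vec_tail_carrier [simp]: "v \<in> carrier_vec (Suc n) \<Longrightarrow> vec_tail v \<in> carrier_vec n"
  by (auto simp: vec_tail_def)

lemma block_mult_vec:
  fixes w :: "'a::comm_ring_1 vec"
  assumes w: "w \<in> carrier_vec (Suc n)" and a: "A1 \<in> carrier_mat 1 1" "A2 \<in> carrier_mat 1 n" "A3 \<in> carrier_mat m n"
  shows "vec_tail (four_block_mat A1 A2 (0\<^sub>m m 1) A3 *\<^sub>v w) = A3 *\<^sub>v vec_tail w"
    "(four_block_mat A1 A2 (0\<^sub>m m 1) A3 *\<^sub>v w) $ 0 = A1 $$ (0, 0) * w $ 0 + row A2 0 \<bullet> vec_tail w"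
  using assms by (auto simp: vec_tail_def scalar_prod_def sum.atLeast0_lessThan_Suc_shift
      simp del: sum.op_ivl_Suc intro!: eq_vecI)

lemma vec_tail_pow_block:
  fixes w :: "'a::comm_ring_1 vec"
  assumes w: "w \<in> carrier_vec (Suc n)" and a: "A1 \<in> carrier_mat 1 1" "A2 \<in> carrier_mat 1 n" "A3 \<in> carrier_mat n n"
  shows "vec_tail (four_block_mat A1 A2 (0\<^sub>m n 1) A3 ^\<^sub>m k *\<^sub>v w) = A3 ^\<^sub>m k *\<^sub>v vec_tail w"
proof (induction k)
  case (Suc k)
  let ?W = "four_block_mat A1 A2 (0\<^sub>m n 1) A3"
  have W: "?W \<in> carrier_mat (Suc n) (Suc n)" using a by auto
  have "?W ^\<^sub>m k *\<^sub>v w \<in> carrier_vec (Suc n)"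
    by (rule mult_mat_vec_carrier[OF pow_carrier_mat[OF W] w])
  then have "vec_tail (?W *\<^sub>v (?W ^\<^sub>m k *\<^sub>v w)) = A3 *\<^sub>v (A3 ^\<^sub>m k *\<^sub>v vec_tail w)"
    using block_mult_vec(1)[OF _ a] Suc by simp
  then show ?case using w by (simp only: pow_mat_Suc_vec[OF W w] pow_mat_Suc_vec[OF a(3) vec_tail_carrier])
qed (use w a in simp)

lemma cong_vec_tail_iff:
  assumes "v \<in> carrier_vec (Suc n)" "w \<in> carrier_vec (Suc n)"
  shows "cong_vec d v w \<longleftrightarrow> d dvd v $ 0 - w $ 0 \<and> cong_vec d (vec_tail v) (vec_tail w)"
  using assms by (auto simp: cong_vec_def vec_tail_def All_less_Suc2)

lemma vec_tail_0 [simp]: "vec_tail (0\<^sub>v (Suc n)) = 0\<^sub>v n"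
  by (auto simp: vec_tail_def)

lemma cong_mat_pow_intertwine:
  assumes U: "U \<in> carrier_mat n n" and B: "B \<in> carrier_mat n n" and W: "W \<in> carrier_mat n n"
    and UW: "cong_mat p (U * W) (B * U)" and x: "x \<in> carrier_vec n"
  shows "cong_vec p (U *\<^sub>v (W ^\<^sub>m k *\<^sub>v x)) (B ^\<^sub>m k *\<^sub>v (U *\<^sub>v x))"
proof (induction k)
  case (Suc k)
  let ?y = "W ^\<^sub>m k *\<^sub>v x"
  have y: "?y \<in> carrier_vec n" by (rule mult_mat_vec_carrier[OF pow_carrier_mat[OF W] x])
  have "U *\<^sub>v (W *\<^sub>v ?y) = (U * W) *\<^sub>v ?y" by (rule assoc_mult_mat_vec[OF U W y, symmetric])
  moreover have "cong_vec p ((U * W) *\<^sub>v ?y) ((B * U) *\<^sub>v ?y)"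
    using UW carrier_matD[OF W] carrier_vecD[OF y] by (intro cong_mat_vec cong_vec_refl) auto
  moreover have "(B * U) *\<^sub>v ?y = B *\<^sub>v (U *\<^sub>v ?y)" by (rule assoc_mult_mat_vec[OF B U y])
  moreover have "cong_vec p (B *\<^sub>v (U *\<^sub>v ?y)) (B *\<^sub>v (B ^\<^sub>m k *\<^sub>v (U *\<^sub>v x)))"
    using B mult_mat_vec_carrier[OF U y] Suc by (rule cong_vec_mult_mat)
  ultimately have "cong_vec p (U *\<^sub>v (W *\<^sub>v ?y)) (B *\<^sub>v (B ^\<^sub>m k *\<^sub>v (U *\<^sub>v x)))"
    using cong_vec_trans by metis
  then show ?case
    using U x by (simp only: pow_mat_Suc_vec[OF W x] pow_mat_Suc_vec[OF B mult_mat_vec_carrier[OF U x]])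
qed (use assms in simp)

text \<open>The columns of \<open>C\<close> represent a basis, over the field with \<open>p\<close>
  elements, of the vectors killed by some power of \<open>B\<close>: spanning is the second
  conjunct, independence the third. The number of columns is prescribed by the characteristic
  polynomial, so that the existence of \<open>C\<close> already contains the dimension
  formula.\<close>

definition generalized_kernel_basis :: "int \<Rightarrow> int mat \<Rightarrow> int mat \<Rightarrow> bool" where
  "generalized_kernel_basis p B C \<longleftrightarrow> C \<in> carrier_mat (dim_row B) (low_order p (char_poly B)) \<and>
    (\<forall>x\<in>carrier_vec (dim_row B). (\<exists>m. cong_vec p (B ^\<^sub>m m *\<^sub>v x) (0\<^sub>v (dim_row B))) \<longleftrightarrow>
        (\<exists>c\<in>carrier_vec (dim_col C). cong_vec p x (C *\<^sub>v c))) \<and>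
    (\<forall>c\<in>carrier_vec (dim_col C).
        cong_vec p (C *\<^sub>v c) (0\<^sub>v (dim_row B)) \<longrightarrow> cong_vec p c (0\<^sub>v (dim_col C)))"

text \<open>A vector with zero tail modulo \<open>p\<close> is killed by the block matrix, so the
  generalized kernel consists of the vectors whose tail lies in that of \<open>A3\<close>. The one
  additional basis vector matches the additional factor \<open>x\<close> of the characteristic
  polynomial.\<close>

lemma generalized_kernel_basis_block:
  fixes A2 A3 :: "int mat"
  assumes A2: "A2 \<in> carrier_mat 1 n" and A3: "A3 \<in> carrier_mat n n"
    and C: "generalized_kernel_basis p A3 C" and p: "prime p"
  shows "generalized_kernel_basis p (four_block_mat (0\<^sub>m 1 1) A2 (0\<^sub>m n 1) A3)
    (four_block_mat (1\<^sub>m 1) (0\<^sub>m 1 (low_order p (char_poly A3))) (0\<^sub>m n 1) C)"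
    (is "generalized_kernel_basis p ?W ?D")
proof -
  define k where "k = low_order p (char_poly A3)"
  have C': "C \<in> carrier_mat n k" using C A3 by (auto simp: generalized_kernel_basis_def k_def)
  have D: "?D \<in> carrier_mat (Suc n) (Suc k)" using C' by (auto simp: k_def)
  have W: "?W \<in> carrier_mat (Suc n) (Suc n)" using A2 A3 by auto
  have "char_poly ?W = char_poly (0\<^sub>m 1 1) * char_poly A3"
    by (rule char_poly_four_block_zeros_col) (use A2 A3 in auto)
  also have "char_poly (0\<^sub>m 1 1 :: int mat) = [:0, 1:]"
    by (simp add: char_poly_defs det_single)
  finally have "char_poly ?W = pCons 0 (char_poly A3)" by simp
  \<comment> \<open>The leading coefficient 1 guarantees that the minimum defining
    \<open>low_order\<close> exists, so that it can be shifted.\<close>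
  moreover have "\<not> p dvd coeff (char_poly A3) n"
    using degree_monic_char_poly[OF A3] p by auto
  ultimately have k: "low_order p (char_poly ?W) = Suc k"
    by (simp add: low_order_pCons_0 k_def)
  have tD: "vec_tail (?D *\<^sub>v c) = C *\<^sub>v vec_tail c" "(?D *\<^sub>v c) $ 0 = c $ 0"
    if "c \<in> carrier_vec (Suc k)" for c
    using block_mult_vec[OF that, of "1\<^sub>m 1" "0\<^sub>m 1 k" C n] C' that by (auto simp: k_def)
  have Dc: "?D *\<^sub>v c \<in> carrier_vec (Suc n)" if "c \<in> carrier_vec (Suc k)" for c
    using D that by (rule mult_mat_vec_carrier)
  have pow: "vec_tail (?W ^\<^sub>m m *\<^sub>v x) = A3 ^\<^sub>m m *\<^sub>v vec_tail x" if "x \<in> carrier_vec (Suc n)" for x m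
    using vec_tail_pow_block[OF that _ A2 A3] by simp
  have Wm: "?W ^\<^sub>m m *\<^sub>v x \<in> carrier_vec (Suc n)" if "x \<in> carrier_vec (Suc n)" for x m
    using pow_carrier_mat[OF W] that by (rule mult_mat_vec_carrier)
  have kernel: "(\<exists>m. cong_vec p (?W ^\<^sub>m m *\<^sub>v x) (0\<^sub>v (Suc n))) \<longleftrightarrow>
      (\<exists>m. cong_vec p (A3 ^\<^sub>m m *\<^sub>v vec_tail x) (0\<^sub>v n))" if x: "x \<in> carrier_vec (Suc n)" for x
  proof
    assume "\<exists>m. cong_vec p (?W ^\<^sub>m m *\<^sub>v x) (0\<^sub>v (Suc n))"
    then show "\<exists>m. cong_vec p (A3 ^\<^sub>m m *\<^sub>v vec_tail x) (0\<^sub>v n)"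
      using cong_vec_tail_iff[OF Wm[OF x] zero_carrier_vec] pow[OF x] by auto
  next
    assume "\<exists>m. cong_vec p (A3 ^\<^sub>m m *\<^sub>v vec_tail x) (0\<^sub>v n)"
    then obtain m where m: "cong_vec p (A3 ^\<^sub>m m *\<^sub>v vec_tail x) (0\<^sub>v n)" by blast
    \<comment> \<open>Once the tail vanishes modulo \<open>p\<close>, one further application
      removes the head: column 0 of the block matrix is zero and \<open>A2\<close> only sees the
      tail.\<close>
    define y where "y = ?W ^\<^sub>m m *\<^sub>v x"
    have y: "y \<in> carrier_vec (Suc n)" using Wm[OF x] by (simp add: y_def)
    have ty: "cong_vec p (vec_tail y) (0\<^sub>v n)" using m pow[OF x] by (simp add: y_def)
    have "cong_vec p (A3 *\<^sub>v vec_tail y) (A3 *\<^sub>v 0\<^sub>v n)"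
      using A3 vec_tail_carrier[OF y] ty by (rule cong_vec_mult_mat)
    moreover have "A3 *\<^sub>v 0\<^sub>v n = 0\<^sub>v n" using A3 by auto
    moreover have "p dvd row A2 0 \<bullet> vec_tail y"
    proof -
      have "\<forall>i<n. p dvd vec_tail y $ i" using ty cong_vec_0_iff[OF vec_tail_carrier[OF y]] by blast
      then show ?thesis
        using carrier_vecD[OF vec_tail_carrier[OF y]] by (auto simp: scalar_prod_def intro!: dvd_sum dvd_mult)
    qed
    ultimately have "cong_vec p (?W *\<^sub>v y) (0\<^sub>v (Suc n))"
      unfolding cong_vec_tail_iff[OF mult_mat_vec_carrier[OF W y] zero_carrier_vec]
      using block_mult_vec[OF y _ A2 A3, of "0\<^sub>m 1 1"] by simp
    then show "\<exists>m. cong_vec p (?W ^\<^sub>m m *\<^sub>v x) (0\<^sub>v (Suc n))"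
      unfolding y_def pow_mat_Suc_vec[OF W x, symmetric] by blast
  qed
  have span: "(\<exists>c\<in>carrier_vec (Suc k). cong_vec p x (?D *\<^sub>v c)) \<longleftrightarrow>
      (\<exists>c\<in>carrier_vec k. cong_vec p (vec_tail x) (C *\<^sub>v c))" if x: "x \<in> carrier_vec (Suc n)" for x
  proof
    assume "\<exists>c\<in>carrier_vec (Suc k). cong_vec p x (?D *\<^sub>v c)"
    then show "\<exists>c\<in>carrier_vec k. cong_vec p (vec_tail x) (C *\<^sub>v c)"
    proof
      fix c assume c: "c \<in> carrier_vec (Suc k)" "cong_vec p x (?D *\<^sub>v c)"
      then have "cong_vec p (vec_tail x) (C *\<^sub>v vec_tail c)"
        using cong_vec_tail_iff[OF x Dc[OF c(1)]] tD(1)[OF c(1)] by simp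
      then show ?thesis using vec_tail_carrier[OF c(1)] by blast
    qed
  next
    assume "\<exists>c\<in>carrier_vec k. cong_vec p (vec_tail x) (C *\<^sub>v c)"
    then obtain c where c: "c \<in> carrier_vec k" "cong_vec p (vec_tail x) (C *\<^sub>v c)" by blast
    \<comment> \<open>The new basis vector absorbs the head entry of \<open>x\<close>.\<close>
    define c' where "c' = vec (Suc k) (case_nat (x $ 0) (($) c))"
    have c': "c' \<in> carrier_vec (Suc k)" "vec_tail c' = c" "c' $ 0 = x $ 0"
      using c by (auto simp: c'_def vec_tail_def)
    then have "cong_vec p x (?D *\<^sub>v c')"
      using cong_vec_tail_iff[OF x Dc[OF c'(1)]] tD[OF c'(1)] c by simp
    then show "\<exists>c\<in>carrier_vec (Suc k). cong_vec p x (?D *\<^sub>v c)" using c' by blast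
  qed
  have inj: "cong_vec p c (0\<^sub>v (Suc k))"
    if c: "c \<in> carrier_vec (Suc k)" and *: "cong_vec p (?D *\<^sub>v c) (0\<^sub>v (Suc n))" for c
  proof -
    have "p dvd c $ 0" "cong_vec p (C *\<^sub>v vec_tail c) (0\<^sub>v n)"
      using * cong_vec_tail_iff[OF Dc[OF c] zero_carrier_vec] tD[OF c] by auto
    moreover have "cong_vec p (vec_tail c) (0\<^sub>v k)"
      using C A3 C' c calculation(2) by (auto simp: generalized_kernel_basis_def)
    ultimately show ?thesis using cong_vec_tail_iff[OF c zero_carrier_vec] by auto
  qed
  have dims: "dim_row ?W = Suc n" "dim_col ?D = Suc k" using W D by auto
  have "(\<exists>m. cong_vec p (A3 ^\<^sub>m m *\<^sub>v x) (0\<^sub>v n)) \<longleftrightarrow> (\<exists>c\<in>carrier_vec k. cong_vec p x (C *\<^sub>v c))"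
    if "x \<in> carrier_vec n" for x
    using C A3 C' that by (auto simp: generalized_kernel_basis_def)
  then have "(\<exists>m. cong_vec p (?W ^\<^sub>m m *\<^sub>v x) (0\<^sub>v (Suc n))) \<longleftrightarrow>
      (\<exists>c\<in>carrier_vec (Suc k). cong_vec p x (?D *\<^sub>v c))" if "x \<in> carrier_vec (Suc n)" for x
    using kernel[OF that] span[OF that] vec_tail_carrier[OF that] by simp
  then show ?thesis
    unfolding generalized_kernel_basis_def dims k using D inj by blast
qed

text \<open>Modulo \<open>p\<close> the matrix \<open>U\<close> is an isomorphism carrying
  \<open>W\<close> to \<open>B\<close>, hence generalized kernel to generalized kernel and basis to
  basis.\<close>

lemma generalized_kernel_basis_intertwine:
  assumes U: "U \<in> carrier_mat n n" and V: "V \<in> carrier_mat n n" and B: "B \<in> carrier_mat n n"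
    and W: "W \<in> carrier_mat n n"
    and inj: "\<And>w. w \<in> carrier_vec n \<Longrightarrow> cong_vec p (U *\<^sub>v w) (0\<^sub>v n) \<Longrightarrow> cong_vec p w (0\<^sub>v n)"
    and UV: "cong_mat p (U * V) (1\<^sub>m n)" and UW: "cong_mat p (U * W) (B * U)"
    and p: "prime p" and C: "generalized_kernel_basis p W C"
  shows "generalized_kernel_basis p B (U * C)"
proof -
  define k where "k = low_order p (char_poly W)"
  have C': "C \<in> carrier_mat n k" using C W by (auto simp: generalized_kernel_basis_def k_def)
  have "p dvd det (U * V) - det (1\<^sub>m n)"
    using U V UV by (intro cong_mat_det[where n = n]) auto
  then have "p dvd det U * det V - 1" using U V by (simp add: det_mult)
  then have "\<not> p dvd det U"
    using p by (metis dvd_diff_right_iff dvd_mult2 not_prime_unit)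
  then have k: "low_order p (char_poly B) = k"
    using low_order_intertwine[OF U B W p _ UW] by (simp add: k_def)
  \<comment> \<open>Surjectivity of \<open>U\<close> modulo \<open>p\<close>, with an explicit
    preimage.\<close>
  have UV1: "cong_vec p x (U *\<^sub>v (V *\<^sub>v x))" if x: "x \<in> carrier_vec n" for x
  proof -
    have "cong_vec p ((U * V) *\<^sub>v x) (1\<^sub>m n *\<^sub>v x)"
      using UV V x by (intro cong_mat_vec) auto
    then show ?thesis using assoc_mult_mat_vec[OF U V x] x cong_vec_sym by simp
  qed
  have inj': "cong_vec p x y" if "x \<in> carrier_vec n" "y \<in> carrier_vec n"
    "cong_vec p (U *\<^sub>v x) (U *\<^sub>v y)" for x y
  proof -
    have "cong_vec p (U *\<^sub>v (x - y)) (0\<^sub>v n)"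
      using that U by (simp add: mult_minus_distrib_mat_vec[OF U] cong_vec_def)
    then have "cong_vec p (x - y) (0\<^sub>v n)" using inj that by auto
    then show ?thesis using that by (simp add: cong_vec_def)
  qed
  have UC: "U * C *\<^sub>v c = U *\<^sub>v (C *\<^sub>v c)" if "c \<in> carrier_vec k" for c
    using U C' that by (rule assoc_mult_mat_vec)
  have U0: "U *\<^sub>v 0\<^sub>v n = 0\<^sub>v n" using U by auto
  have Ucong: "cong_vec p (M *\<^sub>v x) (M *\<^sub>v y)" if "cong_vec p x y" "x \<in> carrier_vec n" "M \<in> carrier_mat n n" for x y M
    using that by (intro cong_mat_vec) auto
  have main: "(\<exists>m. cong_vec p (B ^\<^sub>m m *\<^sub>v x) (0\<^sub>v n)) \<longleftrightarrow>
      (\<exists>c\<in>carrier_vec k. cong_vec p x (U * C *\<^sub>v c))" if x: "x \<in> carrier_vec n" for x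
  proof -
    define z where "z = V *\<^sub>v x"
    have z: "z \<in> carrier_vec n" using V x by (simp add: z_def)
    have xz: "cong_vec p x (U *\<^sub>v z)" using UV1[OF x] by (simp add: z_def)
    have Wz: "W ^\<^sub>m m *\<^sub>v z \<in> carrier_vec n" for m
      using pow_carrier_mat[OF W] z by (rule mult_mat_vec_carrier)
    have Bz: "cong_vec p (U *\<^sub>v (W ^\<^sub>m m *\<^sub>v z)) (B ^\<^sub>m m *\<^sub>v x)" for m
      using cong_mat_pow_intertwine[OF U B W UW z, of m]
        cong_vec_sym[OF Ucong[OF xz x pow_carrier_mat[OF B]]] by (rule cong_vec_trans)
    have "cong_vec p (B ^\<^sub>m m *\<^sub>v x) (0\<^sub>v n) \<longleftrightarrow> cong_vec p (W ^\<^sub>m m *\<^sub>v z) (0\<^sub>v n)" for m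
      using Bz[of m] inj[OF Wz] Ucong[OF _ Wz U, of m "0\<^sub>v n"] U0 cong_vec_trans cong_vec_sym by metis
    moreover have "cong_vec p x (U * C *\<^sub>v c) \<longleftrightarrow> cong_vec p z (C *\<^sub>v c)" if c: "c \<in> carrier_vec k" for c
      using inj'[OF z mult_mat_vec_carrier[OF C' c]] xz Ucong[OF _ z U] UC[OF c] cong_vec_trans cong_vec_sym
      by metis
    moreover have "(\<exists>m. cong_vec p (W ^\<^sub>m m *\<^sub>v z) (0\<^sub>v n)) \<longleftrightarrow> (\<exists>c\<in>carrier_vec k. cong_vec p z (C *\<^sub>v c))"
      using C W C' z by (auto simp: generalized_kernel_basis_def)
    ultimately show ?thesis by auto
  qed
  have "cong_vec p c (0\<^sub>v k)" if c: "c \<in> carrier_vec k" and *: "cong_vec p (U * C *\<^sub>v c) (0\<^sub>v n)" for c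
  proof -
    have "cong_vec p (C *\<^sub>v c) (0\<^sub>v n)"
      using inj[OF mult_mat_vec_carrier[OF C' c]] * UC[OF c] by simp
    then show ?thesis using C W C' c by (auto simp: generalized_kernel_basis_def)
  qed
  then show ?thesis unfolding generalized_kernel_basis_def using main k U C' B by auto
qed

text \<open>Induction on the size: while \<open>p\<close> divides \<open>det B\<close> a kernel
  vector is split off. Otherwise \<open>B\<close> is injective modulo \<open>p\<close>, and both the
  generalized kernel and the order of the characteristic polynomial at 0 are trivial.\<close>

theorem generalized_kernel_mod_prime:
  fixes B :: "int mat"
  assumes p: "prime p" and B: "B \<in> carrier_mat n n"
  shows "\<exists>C. generalized_kernel_basis p B C"
  using B
proof (induction n arbitrary: B)
  case 0
  have "low_order p (char_poly B) = 0"
    using 0 p coeff_0_char_poly[OF 0] unfolding low_order_def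
    by (intro Least_equality) auto
  then have "generalized_kernel_basis p B (0\<^sub>m 0 0)"
    using 0 by (auto simp: generalized_kernel_basis_def cong_vec_def)
  then show ?case by blast
next
  case (Suc n)
  note B = Suc.prems
  show ?case
  proof (cases "p dvd det B")
    case True
    obtain U V A2 A3 where *: "U \<in> carrier_mat (Suc n) (Suc n)" "V \<in> carrier_mat (Suc n) (Suc n)"
      "A2 \<in> carrier_mat 1 n" "A3 \<in> carrier_mat n n"
      "\<And>w. w \<in> carrier_vec (Suc n) \<Longrightarrow> cong_vec p (U *\<^sub>v w) (0\<^sub>v (Suc n)) \<Longrightarrow> cong_vec p w (0\<^sub>v (Suc n))"
      "cong_mat p (U * V) (1\<^sub>m (Suc n))"
      "cong_mat p (U * four_block_mat (0\<^sub>m 1 1) A2 (0\<^sub>m n 1) A3) (B * U)"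
      using deflate_mod_prime[OF Suc.prems p True] by blast
    obtain C where "generalized_kernel_basis p A3 C" using Suc.IH[OF *(4)] by blast
    from generalized_kernel_basis_block[OF *(3,4) this p] obtain D where
      D: "generalized_kernel_basis p (four_block_mat (0\<^sub>m 1 1) A2 (0\<^sub>m n 1) A3) D" by blast
    have W: "four_block_mat (0\<^sub>m 1 1) A2 (0\<^sub>m n 1) A3 \<in> carrier_mat (Suc n) (Suc n)"
      using *(3,4) by auto
    show ?thesis
      using generalized_kernel_basis_intertwine[OF *(1,2) Suc.prems W *(5-7) p D] by blast
  next
    case False
    \<comment> \<open>The constant coefficient is \<open>det B\<close> up to sign, hence prime to
      \<open>p\<close>.\<close>
    have ord: "low_order p (char_poly B) = 0"
      using False coeff_0_char_poly[OF Suc.prems] unfolding low_order_def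
      by (intro Least_equality) (auto simp: minus_one_power_iff)
    have "cong_vec p x (0\<^sub>v (Suc n))" if "cong_vec p (B ^\<^sub>m m *\<^sub>v x) (0\<^sub>v (Suc n))" "x \<in> carrier_vec (Suc n)" for m x
      using that(1)
    proof (induction m)
      case (Suc m)
      have "B ^\<^sub>m m *\<^sub>v x \<in> carrier_vec (Suc n)"
        using pow_carrier_mat[OF B] that(2) by (rule mult_mat_vec_carrier)
      then show ?case
        using Suc cong_vec_0_if_not_dvd_det[OF B p False] pow_mat_Suc_vec[OF B that(2)] by metis
    qed (use B that in simp)
    moreover have "B ^\<^sub>m 0 *\<^sub>v x = x" if "x \<in> carrier_vec (Suc n)" for x
      using that B by simp
    moreover have "(0\<^sub>m (Suc n) 0 :: int mat) *\<^sub>v c = 0\<^sub>v (Suc n)" if "c \<in> carrier_vec 0" for c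
      using that by (auto simp: scalar_prod_def)
    ultimately have "generalized_kernel_basis p B (0\<^sub>m (Suc n) 0)"
      unfolding generalized_kernel_basis_def ord using B
      by (auto simp: cong_vec_def[of _ _ vNil] simp del: pow_mat.simps)
        (use zero_carrier_vec in blast, metis)
    then show ?thesis by blast
  qed
qed

section \<open>Divisible groups and Pruefer groups\<close>

text \<open>The group Z[1/p]. Fractions need not be reduced, so whatever is defined through a
  numerator and an exponent has to be checked for independence of the representation.\<close>

definition zfrac :: "nat \<Rightarrow> rat set" where
  "zfrac p = {of_int a / of_nat p ^ k | a k. True}"

lemma pruefer_group_zfrac: "pruefer_group p = rat_add_group (zfrac p) Mod \<int>"
  by (simp add: pruefer_group_def zfrac_def)

lemma zfracI: "of_int a / of_nat p ^ k \<in> zfrac p"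
  unfolding zfrac_def by blast

lemma zfracE:
  assumes "r \<in> zfrac p" obtains a k where "r = of_int a / of_nat p ^ k"
  using assms unfolding zfrac_def by blast

lemma zfrac_add:
  assumes "r \<in> zfrac p" "s \<in> zfrac p" "p > 0" shows "r + s \<in> zfrac p"
proof -
  obtain a k b l where rs: "r = of_int a / of_nat p ^ k" "s = of_int b / of_nat p ^ l"
    using assms(1,2) by (elim zfracE)
  have "r + s = of_int (a * int p ^ l + b * int p ^ k) / of_nat p ^ (k + l)"
    unfolding rs using assms(3) by (simp add: field_simps power_add)
  then show ?thesis using zfracI by metis
qed

lemma zfrac_mult_int:
  assumes "r \<in> zfrac p" shows "of_int m * r \<in> zfrac p"
proof -
  obtain a k where "r = of_int a / of_nat p ^ k" using assms by (rule zfracE)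
  then have "of_int m * r = of_int (m * a) / of_nat p ^ k" by simp
  then show ?thesis using zfracI by metis
qed

lemma Ints_subset_zfrac: "\<int> \<subseteq> zfrac p"
proof
  fix r :: rat assume "r \<in> \<int>"
  then obtain a where "r = of_int a / of_nat p ^ 0" by (auto elim: Ints_cases)
  then show "r \<in> zfrac p" using zfracI by metis
qed

lemma zero_in_zfrac [simp]: "0 \<in> zfrac p"
  using Ints_subset_zfrac[of p] by auto

lemma zfrac_uminus: "r \<in> zfrac p \<Longrightarrow> - r \<in> zfrac p"
  using zfrac_mult_int[of r p "-1"] by simp

text \<open>Modulo the integers, Z[1/p] has no \<open>q\<close>-torsion for \<open>q\<close> coprime
  to \<open>p\<close>: the power of \<open>p\<close> in the denominator must already divide the
  numerator.\<close>

lemma zfrac_Ints_if_coprime: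
  assumes r: "r \<in> zfrac p" and qr: "of_int q * r \<in> \<int>" and "coprime q (int p)" "p > 0"
  shows "r \<in> \<int>"
proof -
  obtain a k where ak: "r = of_int a / of_nat p ^ k" using r by (rule zfracE)
  obtain c where "of_int q * r = of_int c" using qr by (auto elim: Ints_cases)
  then have "of_int (q * a) = (of_int (c * int p ^ k) :: rat)"
    using ak \<open>p > 0\<close> by (simp add: field_simps)
  then have "int p ^ k dvd q * a" unfolding of_int_eq_iff by simp
  then have "int p ^ k dvd a"
    using \<open>coprime q (int p)\<close> by (simp add: coprime_commute coprime_dvd_mult_right_iff)
  then obtain d where "a = int p ^ k * d" by (elim dvdE)
  then show ?thesis using ak \<open>p > 0\<close> by simp
qed

text \<open>Divisibility of the Pruefer group: the \<open>p\<close>-part of \<open>m\<close> goes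
  into the denominator, and the part prime to \<open>p\<close> is invertible modulo the denominator
  of \<open>r\<close>.\<close>

lemma zfrac_divide_mod_Ints:
  assumes r: "r \<in> zfrac p" and m: "m > 0" and p: "prime p"
  shows "\<exists>s\<in>zfrac p. of_int m * s - r \<in> \<int>"
proof -
  obtain a k where ak: "r = of_int a / of_nat p ^ k" using r by (rule zfracE)
  obtain e m' where m': "m = int p ^ e * m'" "\<not> int p dvd m'"
    using multiplicity_decompose'[of m "int p"] m p by (metis not_prime_unit less_irrefl prime_nat_int_transfer)
  then have "coprime m' (int p ^ k)"
    using p prime_imp_coprime[of "int p" m'] by (auto simp: coprime_commute)
  then obtain x where x: "[m' * x = 1] (mod (int p ^ k))" using cong_solve_coprime_int by blast
  then have "int p ^ k dvd a * (m' * x - 1)" by (simp add: cong_iff_dvd_diff)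
  then obtain d where "a * (m' * x - 1) = int p ^ k * d" by (elim dvdE)
  then have d: "m' * (x * a) - a = int p ^ k * d" by (simp add: algebra_simps)
  \<comment> \<open>\<open>x\<close> inverts \<open>m'\<close> modulo \<open>p ^ k\<close>; the
    extra \<open>e\<close> in the exponent cancels the factor \<open>p ^ e\<close> of
    \<open>m\<close>.\<close>
  define s :: rat where "s = of_int (x * a) / of_nat p ^ (k + e)"
  have "of_int m * s - r = of_int (m' * (x * a) - a) / of_nat p ^ k"
    using p prime_gt_0_nat[OF p] by (simp add: s_def m' ak field_simps power_add)
  also have "\<dots> = of_int d" using prime_gt_0_nat[OF p] by (simp add: d del: of_int_diff)
  finally show ?thesis using zfracI[of "x * a" p "k + e"] unfolding s_def by (metis Ints_of_int)
qed

section \<open>Additive groups of rationals and cosets modulo the integers\<close>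

lemma rat_add_group_simps [simp]:
  "carrier (rat_add_group S) = S" "x \<otimes>\<^bsub>rat_add_group S\<^esub> y = x + y" "\<one>\<^bsub>rat_add_group S\<^esub> = 0"
  by (simp_all add: rat_add_group_def)

lemma comm_group_rat_add_group:
  assumes "0 \<in> S" "\<And>x y. x \<in> S \<Longrightarrow> y \<in> S \<Longrightarrow> x + y \<in> S" "\<And>x. x \<in> S \<Longrightarrow> - x \<in> S"
  shows "comm_group (rat_add_group S)"
proof (rule comm_groupI)
  show "\<exists>y\<in>carrier (rat_add_group S). y \<otimes>\<^bsub>rat_add_group S\<^esub> x = \<one>\<^bsub>rat_add_group S\<^esub>"
    if "x \<in> carrier (rat_add_group S)" for x
    using that assms(3) by (auto intro!: bexI[of _ "- x"])
qed (use assms in \<open>auto simp: algebra_simps\<close>)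

lemma comm_group_zfrac: "p > 0 \<Longrightarrow> comm_group (rat_add_group (zfrac p))"
  using zfrac_add zfrac_uminus subsetD[OF Ints_subset_zfrac] by (intro comm_group_rat_add_group) auto

lemma Ints_normal_zfrac:
  assumes "p > 0" shows "\<int> \<lhd> rat_add_group (zfrac p)"
proof -
  interpret Z: comm_group "rat_add_group (zfrac p)" by (rule comm_group_zfrac[OF assms])
  have "inv\<^bsub>rat_add_group (zfrac p)\<^esub> x = - x" if "x \<in> zfrac p" for x
    by (rule Z.inv_equality) (use that zfrac_uminus in auto)
  then have "subgroup \<int> (rat_add_group (zfrac p))"
    using Ints_subset_zfrac[of p] by unfold_locales auto
  then show ?thesis by (rule Z.subgroup_imp_normal)
qed

lemma zfrac_coset_eq_iff:
  assumes "p > 0" "r \<in> zfrac p" "s \<in> zfrac p"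
  shows "\<int> #>\<^bsub>rat_add_group (zfrac p)\<^esub> r = \<int> #>\<^bsub>rat_add_group (zfrac p)\<^esub> s \<longleftrightarrow> r - s \<in> \<int>"
proof -
  have "\<int> #>\<^bsub>rat_add_group (zfrac p)\<^esub> t = {u. u - t \<in> \<int>}" for t
    by (auto simp: r_coset_def intro!: bexI[of _ "_ - t"])
  moreover have "{u. u - r \<in> \<int>} = {u. u - s \<in> \<int>} \<longleftrightarrow> r - s \<in> \<int>"
  proof
    assume "{u. u - r \<in> \<int>} = {u. u - s \<in> \<int>}"
    moreover have "r \<in> {u. u - r \<in> \<int>}" by simp
    ultimately show "r - s \<in> \<int>" by auto
  next
    assume rs: "r - s \<in> \<int>"
    have "u - r \<in> \<int> \<longleftrightarrow> u - s \<in> \<int>" for u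
      using Ints_add[OF _ rs, of "u - r"] Ints_diff[OF _ rs, of "u - s"] by auto
    then show "{u. u - r \<in> \<int>} = {u. u - s \<in> \<int>}" by auto
  qed
  ultimately show ?thesis by simp
qed

lemma carrier_pruefer: "carrier (pruefer_group p) = (\<lambda>r. \<int> #>\<^bsub>rat_add_group (zfrac p)\<^esub> r) ` zfrac p"
  by (simp add: pruefer_group_zfrac carrier_FactGroup)

lemma group_pruefer:
  assumes "p > 0" shows "group (pruefer_group p)"
  unfolding pruefer_group_zfrac by (rule normal.factorgroup_is_group[OF Ints_normal_zfrac[OF assms]])

section \<open>Homomorphisms from Z[1/p] to an abelian group\<close>

context comm_group
begin

lemma compatible_sequence_pow:
  assumes x: "\<And>n. x n \<in> carrier G" "\<And>n. x (Suc n) [^] int p = x n"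
  shows "x (n + m) [^] (int p ^ m) = x n"
proof (induction m)
  case (Suc m)
  have "x (n + Suc m) [^] (int p ^ Suc m) = (x (Suc (n + m)) [^] int p) [^] (int p ^ m)"
    by (simp add: int_pow_pow x(1))
  then show ?case using Suc x(2) by simp
qed (simp add: x)

text \<open>A sequence of successive \<open>p\<close>-th roots determines a map on Z[1/p] that sends
  \<open>1 / p ^ k\<close> to \<open>x k\<close>. The work lies in showing that the value does not
  depend on the chosen fraction.\<close>

lemma zfrac_hom_of_sequence:
  assumes x: "\<And>n. x n \<in> carrier G" "x 0 = \<one>" "\<And>n. x (Suc n) [^] int p = x n" and p: "p > 0"
  obtains h :: "rat \<Rightarrow> 'a" where "\<And>a k. h (of_int a / of_nat p ^ k) = x k [^] (a::int)"
proof -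
  \<comment> \<open>Equal fractions are compared at the larger exponent, where the numerators differ
    by a power of \<open>p\<close>.\<close>
  have wd: "x k [^] a = x l [^] b" if eq: "of_int a / of_nat p ^ k = (of_int b / of_nat p ^ l :: rat)" and "k \<le> l" for a b k l
  proof -
    obtain m where l: "l = k + m" using \<open>k \<le> l\<close> le_Suc_ex by blast
    have "of_int b = (of_int (int p ^ m * a) :: rat)" using eq p by (simp add: l field_simps power_add)
    then have b: "b = int p ^ m * a" unfolding of_int_eq_iff .
    have "x k [^] a = (x (k + m) [^] (int p ^ m)) [^] a"
      using compatible_sequence_pow[of x p k m, OF x(1,3)] by simp
    also have "\<dots> = x l [^] b" by (simp only: int_pow_pow x(1) b l)
    finally show ?thesis .
  qed
  have wd': "x k [^] a = x l [^] b" if eq: "of_int a / of_nat p ^ k = (of_int b / of_nat p ^ l :: rat)" for a b k l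
  proof (cases "k \<le> l")
    case False
    then show ?thesis using wd[of b l a k] eq by simp
  qed (rule wd[OF eq])
  define h where "h r = (SOME y. \<exists>a k. r = of_int a / of_nat p ^ k \<and> y = x k [^] (a::int))" for r :: rat
  have "h (of_int a / of_nat p ^ k) = x k [^] a" for a k
    unfolding h_def
  proof (rule some_equality)
    fix y assume "\<exists>a' k'. of_int a / of_nat p ^ k = (of_int a' / of_nat p ^ k' :: rat) \<and> y = x k' [^] (a'::int)"
    then show "y = x k [^] a" using wd'[of a k] by metis
  qed blast
  then show ?thesis using that by blast
qed

text \<open>Repeated extraction of \<open>p\<close>-th roots, starting with \<open>b\<close> as the
  image of \<open>1 / p\<close>. Only elements of \<open>p\<close>-power order are known to have
  roots, so the orders are tracked along the sequence.\<close>

lemma zfrac_hom_exists: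
  assumes p: "prime p" and b: "b \<in> carrier G" "b [^] int p = \<one>"
    and div: "\<And>y a. y \<in> carrier G \<Longrightarrow> y [^] (int p ^ a) = \<one> \<Longrightarrow> \<exists>z\<in>carrier G. z [^] int p = y"
  shows "\<exists>h. h \<in> hom (rat_add_group (zfrac p)) G \<and> (\<forall>r\<in>\<int>. h r = \<one>) \<and>
    (\<forall>c. h (of_int c / of_nat p) = b [^] (c::int))"
proof -
  have p0: "p > 0" using p prime_gt_0_nat by blast
  \<comment> \<open>The value at 0 makes the integers map to the identity, the value at 1 pins the
    image of \<open>1 / p\<close>, and the power condition keeps \<open>div\<close>
    applicable.\<close>
  define Q where "Q n y \<longleftrightarrow> y \<in> carrier G \<and> y [^] (int p ^ n) = \<one> \<and>
    (n = 0 \<longrightarrow> y = \<one>) \<and> (n = 1 \<longrightarrow> y = b)" for n y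
  have "\<exists>x. \<forall>n. Q n (x n) \<and> x (Suc n) [^] int p = x n"
  proof (rule dependent_nat_choice)
    show "\<exists>y. Q 0 y" by (rule exI[of _ \<one>]) (simp add: Q_def)
  next
    fix y n assume y: "Q n y"
    show "\<exists>z. Q (Suc n) z \<and> z [^] int p = y"
    proof (cases "n = 0")
      case False
      obtain z where z: "z \<in> carrier G" "z [^] int p = y" using div y unfolding Q_def by blast
      have "z [^] (int p ^ Suc n) = (z [^] int p) [^] (int p ^ n)" by (simp add: int_pow_pow z(1))
      then have "z [^] (int p ^ Suc n) = \<one>" using z y by (simp add: Q_def)
      then show ?thesis using z False unfolding Q_def by (intro exI[of _ z]) simp
    next
      case True
      then show ?thesis using b y unfolding Q_def by (intro exI[of _ b]) simp
    qed
  qed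
  then obtain x where Qx: "\<And>n. Q n (x n)" and x2: "\<And>n. x (Suc n) [^] int p = x n" by blast
  have x1: "x n \<in> carrier G" for n using Qx[of n] by (simp add: Q_def)
  have x3: "x 0 = \<one>" "x 1 = b" using Qx[of 0] Qx[of 1] by (simp_all add: Q_def)
  note x = x1 x2 x3
  obtain h :: "rat \<Rightarrow> 'a" where h: "\<And>a k. h (of_int a / of_nat p ^ k) = x k [^] (a::int)"
    using zfrac_hom_of_sequence[OF x(1,3,2) p0] by blast
  have "h \<in> hom (rat_add_group (zfrac p)) G"
  proof (rule homI)
    show "h r \<in> carrier G" if r: "r \<in> carrier (rat_add_group (zfrac p))" for r
    proof -
      obtain a k where "r = of_int a / of_nat p ^ k" using r unfolding rat_add_group_simps by (rule zfracE)
      then show ?thesis by (simp only: h int_pow_closed x1)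
    qed
  next
    fix r s assume "r \<in> carrier (rat_add_group (zfrac p))" "s \<in> carrier (rat_add_group (zfrac p))"
    then obtain a k b l where rs: "r = of_int a / of_nat p ^ k" "s = of_int b / of_nat p ^ l"
      unfolding rat_add_group_simps by (elim zfracE)
    have r: "r = of_int (int p ^ l * a) / of_nat p ^ (k + l)"
      and s: "s = of_int (int p ^ k * b) / of_nat p ^ (k + l)"
      using p0 by (simp_all add: rs power_add)
    have "r + s = of_int (int p ^ l * a + int p ^ k * b) / of_nat p ^ (k + l)"
      unfolding r s by (simp add: add_divide_distrib)
    then have "h (r + s) = x (k + l) [^] (int p ^ l * a + int p ^ k * b)" by (simp only: h)
    also have "\<dots> = h r \<otimes> h s"
      unfolding r s h by (rule int_pow_mult[OF x(1)])
    finally show "h (r \<otimes>\<^bsub>rat_add_group (zfrac p)\<^esub> s) = h r \<otimes> h s" by simp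
  qed
  moreover have "h r = \<one>" if r: "r \<in> \<int>" for r
  proof -
    obtain a where "r = of_int a" using r by (rule Ints_cases)
    then show ?thesis using h[of a 0] x3(1) by simp
  qed
  moreover have "h (of_int c / of_nat p) = b [^] c" for c :: int
    using h[of c 1] unfolding x3(2) power_one_right .
  ultimately show ?thesis by blast
qed

end

text \<open>The data that determine such a group: orders involving only primes in \<open>P\<close>,
  \<open>p\<close>-th roots on the \<open>p\<close>-primary part, and for each \<open>p\<close> a
  basis \<open>b p\<close> of the elements killed by \<open>p\<close>, with coefficients read modulo
  \<open>p\<close>.\<close>

locale pruefer_coordinates = comm_group G for G (structure) +
  fixes P :: "nat set" and k :: "nat \<Rightarrow> nat" and b :: "nat \<Rightarrow> nat \<Rightarrow> 'a"
  assumes finite_P: "finite P" and prime_P: "p \<in> P \<Longrightarrow> prime p"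
    and torsion: "y \<in> carrier G \<Longrightarrow> \<exists>n>0. y [^] (n::int) = \<one> \<and> (\<forall>p. prime p \<longrightarrow> int p dvd n \<longrightarrow> p \<in> P)"
    and divisible: "p \<in> P \<Longrightarrow> y \<in> carrier G \<Longrightarrow> y [^] (int p ^ a) = \<one> \<Longrightarrow> \<exists>z\<in>carrier G. z [^] int p = y"
    and b_closed: "p \<in> P \<Longrightarrow> i < k p \<Longrightarrow> b p i \<in> carrier G"
    and b_pow: "p \<in> P \<Longrightarrow> i < k p \<Longrightarrow> b p i [^] int p = \<one>"
    and b_span: "p \<in> P \<Longrightarrow> y \<in> carrier G \<Longrightarrow> y [^] int p = \<one> \<Longrightarrow>
      \<exists>c::nat \<Rightarrow> int. y = (\<Otimes>i\<in>{..<k p}. b p i [^] c i)"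
    and b_indep: "p \<in> P \<Longrightarrow> (\<Otimes>i\<in>{..<k p}. b p i [^] (c i :: int)) = \<one> \<Longrightarrow> i < k p \<Longrightarrow> int p dvd c i"
begin

definition I where "I = (SIGMA p:P. {..<k p})"

lemma finite_I: "finite I"
  unfolding I_def using finite_P by (rule finite_SigmaI) auto

text \<open>The extension of the socle basis element with index \<open>t = (p, i)\<close> to Z[1/p].
  It is kept on rational representatives, with triviality on the integers recorded, instead of being
  defined on cosets.\<close>

definition h :: "nat \<times> nat \<Rightarrow> rat \<Rightarrow> 'a" where
  "h t = (SOME h. h \<in> hom (rat_add_group (zfrac (fst t))) G \<and> (\<forall>r\<in>\<int>. h r = \<one>) \<and>
    (\<forall>c. h (of_int c / of_nat (fst t)) = b (fst t) (snd t) [^] (c::int)))"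

lemma index_D: "t \<in> I \<Longrightarrow> fst t \<in> P" "t \<in> I \<Longrightarrow> snd t < k (fst t)" "t \<in> I \<Longrightarrow> fst t > 0"
  using prime_P by (auto simp: I_def prime_gt_0_nat)

lemma h_hom:
  assumes t: "t \<in> I"
  shows "h t \<in> hom (rat_add_group (zfrac (fst t))) G" "r \<in> \<int> \<Longrightarrow> h t r = \<one>"
    "h t (of_int c / of_nat (fst t)) = b (fst t) (snd t) [^] (c::int)"
proof -
  have "\<exists>h. h \<in> hom (rat_add_group (zfrac (fst t))) G \<and> (\<forall>r\<in>\<int>. h r = \<one>) \<and>
    (\<forall>c. h (of_int c / of_nat (fst t)) = b (fst t) (snd t) [^] (c::int))"
    using index_D[OF t] by (intro zfrac_hom_exists prime_P b_closed b_pow divisible)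
  from someI_ex[OF this, folded h_def]
  show "h t \<in> hom (rat_add_group (zfrac (fst t))) G" "r \<in> \<int> \<Longrightarrow> h t r = \<one>"
    "h t (of_int c / of_nat (fst t)) = b (fst t) (snd t) [^] (c::int)" by blast+
qed

lemma h_closed: "t \<in> I \<Longrightarrow> r \<in> zfrac (fst t) \<Longrightarrow> h t r \<in> carrier G"
  using h_hom(1)[of t] by (auto simp: hom_def)

lemma h_add: "t \<in> I \<Longrightarrow> r \<in> zfrac (fst t) \<Longrightarrow> s \<in> zfrac (fst t) \<Longrightarrow> h t (r + s) = h t r \<otimes> h t s"
  using h_hom(1)[of t] by (auto simp: hom_def)

definition coords :: "(nat \<times> nat \<Rightarrow> rat) set" where
  "coords = {r. \<forall>t\<in>I. r t \<in> zfrac (fst t)}"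

text \<open>The candidate isomorphism, on rational representatives of the coordinates; it depends on
  them only modulo the integers.\<close>

definition comb :: "(nat \<times> nat \<Rightarrow> rat) \<Rightarrow> 'a" where
  "comb r = (\<Otimes>t\<in>I. h t (r t))"

lemma coordsD: "r \<in> coords \<Longrightarrow> t \<in> I \<Longrightarrow> r t \<in> zfrac (fst t)"
  by (simp add: coords_def)

lemma coords_add: "r \<in> coords \<Longrightarrow> s \<in> coords \<Longrightarrow> (\<lambda>t. r t + s t) \<in> coords"
  unfolding coords_def using zfrac_add index_D(3) by blast

lemma coords_mult: "r \<in> coords \<Longrightarrow> (\<lambda>t. of_int m * r t) \<in> coords"
  unfolding coords_def using zfrac_mult_int by blast

lemma comb_closed [simp]: "r \<in> coords \<Longrightarrow> comb r \<in> carrier G"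
  unfolding comb_def by (rule finprod_closed) (auto intro: h_closed coordsD)

lemma comb_add: "r \<in> coords \<Longrightarrow> s \<in> coords \<Longrightarrow> comb (\<lambda>t. r t + s t) = comb r \<otimes> comb s"
proof -
  assume rs: "r \<in> coords" "s \<in> coords"
  have "comb (\<lambda>t. r t + s t) = (\<Otimes>t\<in>I. h t (r t) \<otimes> h t (s t))"
    unfolding comb_def using rs
    by (intro finprod_cong') (auto intro!: h_closed h_add coordsD)
  also have "\<dots> = comb r \<otimes> comb s"
    unfolding comb_def using rs by (intro finprod_multf) (auto intro!: h_closed coordsD)
  finally show ?thesis .
qed

lemma comb_Ints: "(\<And>t. t \<in> I \<Longrightarrow> r t \<in> \<int>) \<Longrightarrow> comb r = \<one>"
  unfolding comb_def by (rule finprod_one_eqI) (simp add: h_hom(2))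

lemma comb_nat: "r \<in> coords \<Longrightarrow> comb (\<lambda>t. of_nat m * r t) = comb r [^] int m"
proof (induction m)
  case 0
  then show ?case by (simp add: comb_Ints)
next
  case (Suc m)
  have "comb (\<lambda>t. of_nat (Suc m) * r t) = comb (\<lambda>t. of_nat m * r t + r t)"
    by (simp add: algebra_simps)
  also have "\<dots> = comb r [^] int m \<otimes> comb r"
    using comb_add[OF coords_mult[OF Suc.prems, of "int m"] Suc.prems] Suc by simp
  also have "\<dots> = comb r [^] int (Suc m)"
    using int_pow_mult[of "comb r" "int m" 1] Suc.prems by (simp add: algebra_simps)
  finally show ?case .
qed

lemma comb_cong:
  assumes r: "r \<in> coords" and s: "s \<in> coords" and eq: "\<And>t. t \<in> I \<Longrightarrow> r t - s t \<in> \<int>"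
  shows "comb r = comb s"
proof -
  have d: "(\<lambda>t. r t - s t) \<in> coords" using eq Ints_subset_zfrac by (auto simp: coords_def)
  have "comb r = comb (\<lambda>t. s t + (r t - s t))" by simp
  also have "\<dots> = comb s" using comb_add[OF s d] comb_Ints[OF eq] s by simp
  finally show ?thesis .
qed

text \<open>Integral coordinates contribute trivially, so only the copies for \<open>q\<close>
  remain, and there \<open>h\<close> takes a multiple of \<open>1 / q\<close> to a power of a basis
  element.\<close>

lemma comb_socle:
  assumes q: "q \<in> P" and c: "\<And>t. t \<in> I \<Longrightarrow> fst t \<noteq> q \<Longrightarrow> r t \<in> \<int>"
    "\<And>i. i < k q \<Longrightarrow> r (q, i) = of_int (c i) / of_nat q"
  shows "comb r = (\<Otimes>i\<in>{..<k q}. b q i [^] (c i :: int))"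
proof -
  have "comb r = (\<Otimes>t\<in>Pair q ` {..<k q}. b q (snd t) [^] c (snd t))"
    unfolding comb_def
  proof (rule finprod_mono_neutral_cong_right)
    show hb: "h t (r t) = b q (snd t) [^] c (snd t)" if "t \<in> Pair q ` {..<k q}" for t
      using that h_hom(3)[of t] c(2) q by (auto simp: I_def)
    show h1: "h t (r t) = \<one>" if "t \<in> I - Pair q ` {..<k q}" for t
    proof -
      have "t \<in> I" "fst t \<noteq> q" using that by (auto simp: I_def)
      then show ?thesis using c(1) h_hom(2) by simp
    qed
    show "(\<lambda>t. h t (r t)) \<in> I \<rightarrow> carrier G"
    proof
      fix t assume t: "t \<in> I"
      show "h t (r t) \<in> carrier G"
      proof (cases "t \<in> Pair q ` {..<k q}")
        case True
        then show ?thesis using hb[OF True] q b_closed by auto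
      qed (use t h1 in simp)
    qed
  qed (use finite_I q in \<open>auto simp: I_def\<close>)
  also have "\<dots> = (\<Otimes>i\<in>{..<k q}. b q i [^] c i)"
    by (subst finprod_reindex) (use b_closed[OF q] in \<open>auto simp: inj_on_def\<close>)
  finally show ?thesis .
qed

text \<open>Induction on a common denominator \<open>D = q * D'\<close>. The multiple by
  \<open>D'\<close> is again in the kernel and has denominator \<open>q\<close>, so it gives a
  relation between socle basis elements. Independence makes this multiple integral, and
  \<open>D'\<close> takes the place of \<open>D\<close>.\<close>

lemma comb_kernel_aux:
  assumes "D > 0" "r \<in> coords" "\<And>t. t \<in> I \<Longrightarrow> of_nat D * r t \<in> \<int>" "comb r = \<one>"
  shows "\<forall>t\<in>I. r t \<in> \<int>"
  using assms
proof (induction D arbitrary: r rule: less_induct)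
  case (less D)
  show ?case
  proof (cases "D = 1")
    case False
    then obtain q where q: "prime q" "q dvd D" using prime_factor_nat by blast
    then obtain D' where D: "D = q * D'" by auto
    have D': "D' > 0" "D' < D" using D less.prems(1) prime_gt_1_nat[OF q(1)] by auto
    define r' where "r' t = of_nat D' * r t" for t
    have r': "r' \<in> coords" unfolding r'_def using coords_mult[OF less.prems(2), of "int D'"] by simp
    have qr': "of_int (int q) * r' t \<in> \<int>" if "t \<in> I" for t
      using less.prems(3)[OF that] by (simp add: r'_def D mult.assoc)
    have comb1: "comb r' = \<one>"
      unfolding r'_def using comb_nat[OF less.prems(2)] less.prems(4) by simp
    \<comment> \<open>At primes other than \<open>q\<close> there is no \<open>q\<close>-torsion
      modulo the integers.\<close>
    have other: "r' t \<in> \<int>" if t: "t \<in> I" "fst t \<noteq> q" for t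
    proof (rule zfrac_Ints_if_coprime[OF coordsD[OF r' t(1)] qr'[OF t(1)]])
      show "coprime (int q) (int (fst t))"
        using t index_D(1)[OF t(1)] prime_P q(1) primes_coprime by (auto simp: coprime_int_iff)
    qed (rule index_D(3)[OF t(1)])
    have "r' t \<in> \<int>" if t: "t \<in> I" for t
    proof (cases "fst t = q")
      case True
      have qP: "q \<in> P" using index_D(1)[OF t] True by simp
      have "\<exists>c. r' (q, i) = of_int c / of_nat q" if "i < k q" for i
      proof -
        have "(q, i) \<in> I" using that qP by (simp add: I_def)
        from qr'[OF this] obtain c where "of_int (int q) * r' (q, i) = of_int c" by (rule Ints_cases)
        then show ?thesis using prime_gt_0_nat[OF q(1)] by (auto simp: field_simps)
      qed
      then obtain c where c: "\<And>i. i < k q \<Longrightarrow> r' (q, i) = of_int (c i) / of_nat q" by metis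
      have "int q dvd c (snd t)"
        using b_indep[OF qP, of c "snd t"] comb_socle[of q r' c, OF qP other c] comb1 index_D(2)[OF t] True by simp
      then obtain e where "c (snd t) = int q * e" by (elim dvdE)
      moreover have "r' t = of_int (c (snd t)) / of_nat q"
        using c[of "snd t"] index_D(2)[OF t] True by (cases t) auto
      ultimately show ?thesis using prime_gt_0_nat[OF q(1)] by simp
    qed (use other t in blast)
    then show ?thesis
      using less.IH[OF D'(2) D'(1) less.prems(2) _ less.prems(4)] by (simp add: r'_def)
  qed (use less.prems in simp)
qed

lemma comb_kernel:
  assumes r: "r \<in> coords" "comb r = \<one>" and t: "t \<in> I"
  shows "r t \<in> \<int>"
proof -
  have "\<exists>e>0. of_nat e * r u \<in> \<int>" if u: "u \<in> I" for u
  proof -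
    obtain a l where "r u = of_int a / of_nat (fst u) ^ l" using coordsD[OF r(1) u] by (rule zfracE)
    then have "of_nat (fst u ^ l) * r u = of_int a" using index_D(3)[OF u] by simp
    then show ?thesis using index_D(3)[OF u] by (metis Ints_of_int zero_less_power)
  qed
  then obtain e where e: "\<And>t. t \<in> I \<Longrightarrow> e t > 0" "\<And>t. t \<in> I \<Longrightarrow> of_nat (e t) * r t \<in> \<int>" by metis
  \<comment> \<open>As \<open>I\<close> is finite, the product of the individual denominators is a
    common one.\<close>
  define D where "D = (\<Prod>t\<in>I. e t)"
  have "D > 0" using e(1) by (simp add: D_def prod_pos)
  moreover have "of_nat D * r t \<in> \<int>" if "t \<in> I" for t
  proof -
    have "D = (\<Prod>t\<in>I - {t}. e t) * e t" unfolding D_def using prod.remove[OF finite_I that, of e] by (simp add: mult.commute)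
    then have "of_nat D * r t = of_nat (\<Prod>t\<in>I - {t}. e t) * (of_nat (e t) * r t)"
      by (simp only: of_nat_mult mult.assoc)
    then show ?thesis using e(2)[OF that] by (simp only: Ints_mult Ints_of_nat)
  qed
  ultimately show ?thesis using comb_kernel_aux r t by blast
qed

text \<open>Induction on an exponent \<open>n = q * m\<close> that kills \<open>y\<close>. The
  \<open>m\<close>-th power of \<open>y\<close> lies in the socle, hence in the image; dividing its
  coordinates by \<open>m\<close> gives an element with the same \<open>m\<close>-th power as
  \<open>y\<close>, and the quotient of the two is killed by the smaller exponent
  \<open>m\<close>.\<close>

lemma comb_surj_aux:
  assumes "n > 0" "y \<in> carrier G" "y [^] int n = \<one>" "\<And>p. prime p \<Longrightarrow> p dvd n \<Longrightarrow> p \<in> P"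
  shows "\<exists>r\<in>coords. comb r = y"
  using assms
proof (induction n arbitrary: y rule: less_induct)
  case (less n)
  show ?case
  proof (cases "n = 1")
    case True
    then have "y = \<one>" using less.prems by simp
    then show ?thesis
      by (intro bexI[of _ "\<lambda>_. 0"]) (simp_all add: comb_Ints coords_def)
  next
    case False
    then obtain q where q: "prime q" "q dvd n" using prime_factor_nat by blast
    then obtain m where n: "n = q * m" by auto
    have m: "m > 0" "m < n" using n less.prems(1) prime_gt_1_nat[OF q(1)] by auto
    have qP: "q \<in> P" using less.prems(4) q by blast
    have "(y [^] int m) [^] int q = \<one>" using less.prems n by (simp add: int_pow_pow mult.commute)
    then obtain c :: "nat \<Rightarrow> int" where c: "y [^] int m = (\<Otimes>i\<in>{..<k q}. b q i [^] c i)"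
      using b_span[OF qP] less.prems(2) by blast
    define r0 where "r0 t = (if fst t = q then of_int (c (snd t)) / of_nat (fst t) else 0 :: rat)" for t
    have r0: "r0 \<in> coords"
      unfolding coords_def r0_def by (auto simp: zfracI[of _ _ 1, simplified])
    have ym: "comb r0 = y [^] int m"
      unfolding c by (rule comb_socle[OF qP]) (auto simp: r0_def)
    \<comment> \<open>The division by \<open>m\<close> takes place in the coordinates, where it is
      explicit modulo the integers.\<close>
    have "\<exists>s\<in>zfrac (fst t). of_int (int m) * s - r0 t \<in> \<int>" if "t \<in> I" for t
      using coordsD[OF r0 that] m(1) prime_P[OF index_D(1)[OF that]] by (intro zfrac_divide_mod_Ints) auto
    then obtain r1 where r1': "\<And>t. t \<in> I \<Longrightarrow> r1 t \<in> zfrac (fst t)" "\<And>t. t \<in> I \<Longrightarrow> of_int (int m) * r1 t - r0 t \<in> \<int>"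
      by metis
    have r1: "r1 \<in> coords" using r1' by (simp add: coords_def)
    have "comb r1 [^] int m = y [^] int m"
      using comb_cong[OF coords_mult[OF r1, of "int m"] r0] r1'(2) comb_nat[OF r1, of m] ym by simp
    define z where "z = y \<otimes> inv (comb r1)"
    have z: "z \<in> carrier G" using less.prems(2) r1 by (simp add: z_def)
    have "z [^] int m = \<one>"
      unfolding z_def using less.prems(2) r1 \<open>comb r1 [^] int m = y [^] int m\<close>
      by (simp add: int_pow_distrib int_pow_inv)
    then obtain r2 where r2: "r2 \<in> coords" "comb r2 = z"
      using less.IH[OF m(2,1) z] less.prems(4) n by auto
    have "comb (\<lambda>t. r2 t + r1 t) = y"
      using comb_add[OF r2(1) r1] r2 less.prems(2) r1 by (simp add: z_def m_assoc)
    then show ?thesis using coords_add[OF r2(1) r1] by blast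
  qed
qed

lemma comb_surj: "y \<in> carrier G \<Longrightarrow> \<exists>r\<in>coords. comb r = y"
proof -
  assume y: "y \<in> carrier G"
  then obtain n where n: "n > 0" "y [^] (n::int) = \<one>" "\<And>p. prime p \<Longrightarrow> int p dvd n \<Longrightarrow> p \<in> P"
    using torsion by blast
  show ?thesis
    by (rule comb_surj_aux[of "nat n" y]) (use n y in \<open>auto simp: nat_dvd_iff int_dvd_int_iff[symmetric] simp del: int_dvd_int_iff\<close>)
qed

abbreviation "coset t r \<equiv> \<int> #>\<^bsub>rat_add_group (zfrac (fst t))\<^esub> r"

text \<open>Elements of the product are families of cosets, so rational representatives
  \<open>rep\<close> are chosen. Since \<open>comb\<close> ignores integers, the resulting map
  \<open>\<Phi>\<close> does not depend on this choice, and additivity, kernel and image are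
  inherited from \<open>comb\<close>.\<close>

theorem iso_product_pruefer:
  "product_group (SIGMA p:P. {..<k p}) (\<lambda>(p, i). pruefer_group p) \<cong> G"
proof -
  let ?Q = "product_group I (\<lambda>t. pruefer_group (fst t))"
  have Q: "product_group (SIGMA p:P. {..<k p}) (\<lambda>(p, i). pruefer_group p) = ?Q"
    by (simp add: I_def case_prod_unfold)
  have "\<exists>r. F = (\<lambda>t\<in>I. coset t (r t)) \<and> r \<in> coords" if F: "F \<in> carrier ?Q" for F
  proof -
    have "\<exists>s. F t = coset t s \<and> s \<in> zfrac (fst t)" if "t \<in> I" for t
    proof -
      have "F t \<in> carrier (pruefer_group (fst t))" using F that by (simp add: PiE_iff)
      then show ?thesis unfolding carrier_pruefer by blast
    qed
    then obtain r where r: "\<And>t. t \<in> I \<Longrightarrow> F t = coset t (r t)" "\<And>t. t \<in> I \<Longrightarrow> r t \<in> zfrac (fst t)" by metis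
    have "F = (\<lambda>t\<in>I. coset t (r t))"
      by (rule extensionalityI[of _ I]) (use F r(1) in \<open>auto simp: PiE_iff\<close>)
    then show ?thesis using r(2) by (auto simp: coords_def)
  qed
  then have "\<forall>F\<in>carrier ?Q. \<exists>r. F = (\<lambda>t\<in>I. coset t (r t)) \<and> r \<in> coords" by blast
  from bchoice[OF this] obtain rep where rep: "\<And>F. F \<in> carrier ?Q \<Longrightarrow> F = (\<lambda>t\<in>I. coset t (rep F t))"
    "\<And>F. F \<in> carrier ?Q \<Longrightarrow> rep F \<in> coords" by blast
  define \<Phi> where "\<Phi> F = comb (rep F)" for F
  have coset_in: "(\<lambda>t\<in>I. coset t (r t)) \<in> carrier ?Q" if "r \<in> coords" for r
    using coordsD[OF that] by (auto simp: carrier_pruefer)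
  have eq_iff: "(\<lambda>t\<in>I. coset t (r t)) = (\<lambda>t\<in>I. coset t (s t)) \<longleftrightarrow> (\<forall>t\<in>I. r t - s t \<in> \<int>)"
    if "r \<in> coords" "s \<in> coords" for r s
  proof -
    have "(\<lambda>t\<in>I. coset t (r t)) = (\<lambda>t\<in>I. coset t (s t)) \<longleftrightarrow> (\<forall>t\<in>I. coset t (r t) = coset t (s t))"
      by (auto simp: fun_eq_iff restrict_def)
    also have "\<dots> \<longleftrightarrow> (\<forall>t\<in>I. r t - s t \<in> \<int>)"
      by (intro ball_cong refl zfrac_coset_eq_iff index_D(3) coordsD that)
    finally show ?thesis .
  qed
  have \<Phi>: "\<Phi> (\<lambda>t\<in>I. coset t (r t)) = comb r" if "r \<in> coords" for r
  proof -
    let ?F = "\<lambda>t\<in>I. coset t (r t)"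
    have rc: "rep ?F \<in> coords" using rep(2)[OF coset_in[OF that]] .
    have "(\<lambda>t\<in>I. coset t (rep ?F t)) = ?F" using rep(1)[OF coset_in[OF that]] by (rule sym)
    then have "\<forall>t\<in>I. rep ?F t - r t \<in> \<int>" using eq_iff[OF rc that] by blast
    then show ?thesis unfolding \<Phi>_def using comb_cong[OF rc that] by blast
  qed
  have mult: "(\<lambda>t\<in>I. coset t (r t)) \<otimes>\<^bsub>?Q\<^esub> (\<lambda>t\<in>I. coset t (s t)) = (\<lambda>t\<in>I. coset t (r t + s t))"
    if "r \<in> coords" "s \<in> coords" for r s
  proof -
    have "coset t (r t) \<otimes>\<^bsub>pruefer_group (fst t)\<^esub> coset t (s t) = coset t (r t + s t)" if t: "t \<in> I" for t
      using normal.rcos_sum[OF Ints_normal_zfrac[OF index_D(3)[OF t]]] coordsD[OF \<open>r \<in> coords\<close> t] coordsD[OF \<open>s \<in> coords\<close> t]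
      by (simp add: pruefer_group_zfrac)
    then show ?thesis by (auto simp: fun_eq_iff)
  qed
  have "\<Phi> \<in> iso ?Q G"
  proof (rule isoI)
    show "\<Phi> \<in> hom ?Q G"
    proof (rule homI)
      show "\<Phi> F \<in> carrier G" if "F \<in> carrier ?Q" for F using rep(2)[OF that] by (simp add: \<Phi>_def)
      show "\<Phi> (F \<otimes>\<^bsub>?Q\<^esub> F') = \<Phi> F \<otimes> \<Phi> F'" if F: "F \<in> carrier ?Q" "F' \<in> carrier ?Q" for F F'
      proof -
        have "F \<otimes>\<^bsub>?Q\<^esub> F' = (\<lambda>t\<in>I. coset t (rep F t + rep F' t))"
          using mult[OF rep(2)[OF F(1)] rep(2)[OF F(2)]]
          unfolding rep(1)[OF F(1), symmetric] rep(1)[OF F(2), symmetric] .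
        then show ?thesis
          using \<Phi>[OF coords_add[OF rep(2)[OF F(1)] rep(2)[OF F(2)]]] comb_add[OF rep(2)[OF F(1)] rep(2)[OF F(2)]]
          by (simp only: \<Phi>_def)
      qed
    qed
    show "bij_betw \<Phi> (carrier ?Q) (carrier G)"
      unfolding bij_betw_def
    proof (intro conjI inj_onI)
      fix F F' assume F: "F \<in> carrier ?Q" "F' \<in> carrier ?Q" and eq: "\<Phi> F = \<Phi> F'"
      define r where "r = rep F"
      define s where "s = rep F'"
      have rs: "r \<in> coords" "s \<in> coords" using rep(2) F by (auto simp: r_def s_def)
      have ms: "(\<lambda>t. - s t) \<in> coords" using coords_mult[OF rs(2), of "-1"] by simp
      have d: "(\<lambda>t. r t + - s t) \<in> coords" using coords_add[OF rs(1) ms] .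
      have "comb s \<otimes> comb (\<lambda>t. - s t) = \<one>"
        using comb_add[OF rs(2) ms] comb_Ints[of "\<lambda>_. 0"] by simp
      then have "comb (\<lambda>t. r t + - s t) = \<one>"
        using eq comb_add[OF rs(1) ms] by (simp add: \<Phi>_def r_def s_def)
      then have "\<forall>t\<in>I. r t - s t \<in> \<int>" using comb_kernel[OF d] by simp
      then have "(\<lambda>t\<in>I. coset t (r t)) = (\<lambda>t\<in>I. coset t (s t))" using eq_iff[OF rs] by blast
      then show "F = F'"
        using rep(1)[OF F(1)] rep(1)[OF F(2)] unfolding r_def s_def by (rule box_equals[OF _ sym sym])
    next
      show "\<Phi> ` carrier ?Q = carrier G"
      proof
        show "\<Phi> ` carrier ?Q \<subseteq> carrier G" using rep(2) by (auto simp: \<Phi>_def)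
        show "carrier G \<subseteq> \<Phi> ` carrier ?Q"
        proof
          fix y assume "y \<in> carrier G"
          then obtain r where r: "r \<in> coords" "comb r = y" using comb_surj by blast
          show "y \<in> \<Phi> ` carrier ?Q"
            by (rule image_eqI[OF _ coset_in[OF r(1)]]) (simp only: \<Phi>[OF r(1)] r(2))
        qed
      qed
    qed
  qed
  then show ?thesis unfolding Q by (rule is_isoI)
qed

end

section \<open>The p-adic absolute value\<close>

lemma rat_localizationI: "\<not> int p dvd b \<Longrightarrow> of_int a / of_int b \<in> rat_localization p"
  unfolding rat_localization_def by blast

lemma rat_localizationE:
  assumes "x \<in> rat_localization p"
  obtains a b where "x = of_int a / of_int b" "\<not> int p dvd b" "b \<noteq> 0"
  using assms unfolding rat_localization_def by force

context
  fixes p :: nat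
  assumes p: "prime p"
begin

lemma rat_localization_of_int [simp]: "of_int a \<in> rat_localization p"
  using rat_localizationI[of p 1 a] p by (simp add: prime_nat_iff)

lemma rat_localization_0 [simp]: "0 \<in> rat_localization p"
  using rat_localization_of_int[of 0] by simp

lemma rat_localization_1 [simp]: "1 \<in> rat_localization p"
  using rat_localization_of_int[of 1] by simp

lemma rat_localization_mult:
  assumes "x \<in> rat_localization p" "y \<in> rat_localization p"
  shows "x * y \<in> rat_localization p"
proof -
  obtain a b where 1: "x = of_int a / of_int b" "\<not> int p dvd b" "b \<noteq> 0" using assms(1) by (rule rat_localizationE)
  obtain c d where 2: "y = of_int c / of_int d" "\<not> int p dvd d" "d \<noteq> 0" using assms(2) by (rule rat_localizationE)
  have "x * y = of_int (a * c) / of_int (b * d)" by (simp add: 1(1) 2(1))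
  moreover have "\<not> int p dvd b * d" using 1 2 p by (simp add: prime_dvd_mult_iff)
  ultimately show ?thesis using rat_localizationI by metis
qed

lemma rat_localization_add:
  assumes "x \<in> rat_localization p" "y \<in> rat_localization p"
  shows "x + y \<in> rat_localization p"
proof -
  obtain a b where 1: "x = of_int a / of_int b" "\<not> int p dvd b" "b \<noteq> 0" using assms(1) by (rule rat_localizationE)
  obtain c d where 2: "y = of_int c / of_int d" "\<not> int p dvd d" "d \<noteq> 0" using assms(2) by (rule rat_localizationE)
  have "x + y = of_int (a * d + c * b) / of_int (b * d)"
    using 1(3) 2(3) by (simp add: 1(1) 2(1) add_frac_eq)
  moreover have "\<not> int p dvd b * d" using 1 2 p by (simp add: prime_dvd_mult_iff)
  ultimately show ?thesis using rat_localizationI by metis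
qed

lemma rat_localization_uminus: "x \<in> rat_localization p \<Longrightarrow> - x \<in> rat_localization p"
  using rat_localization_mult[of "-1" x] rat_localization_of_int[of "-1"] by simp

lemma rat_localization_diff:
  "x \<in> rat_localization p \<Longrightarrow> y \<in> rat_localization p \<Longrightarrow> x - y \<in> rat_localization p"
  using rat_localization_add[of x "- y"] rat_localization_uminus by simp

lemma rat_localization_sum:
  "(\<And>i. i \<in> S \<Longrightarrow> f i \<in> rat_localization p) \<Longrightarrow> sum f S \<in> rat_localization p"
  by (induction S rule: infinite_finite_induct) (auto intro: rat_localization_add)

text \<open>The valuation is defined through the reduced fraction; cross multiplication and
  additivity of multiplicities show that any fraction may be used.\<close>

lemma padic_val_divide:
  assumes "a \<noteq> 0" "b \<noteq> 0"
  shows "padic_val p (of_int a / of_int b)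
    = int (multiplicity (int p) a) - int (multiplicity (int p) b)"
proof -
  obtain n d where nd: "quotient_of (of_int a / of_int b) = (n, d)" by (cases "quotient_of (of_int a / of_int b)") auto
  have d: "d > 0" using quotient_of_denom_pos[OF nd] .
  have eq: "(of_int a / of_int b :: rat) = of_int n / of_int d" using quotient_of_div[OF nd] .
  then have "(of_int (n * b) :: rat) = of_int (a * d)" using assms d by (simp add: field_simps)
  then have nb: "n * b = a * d" unfolding of_int_eq_iff .
  have n: "n \<noteq> 0" using nb assms d by auto
  have pe: "prime_elem (int p)" using p by simp
  have "multiplicity (int p) n + multiplicity (int p) b = multiplicity (int p) a + multiplicity (int p) d"
    using prime_elem_multiplicity_mult_distrib[OF pe n assms(2)]
      prime_elem_multiplicity_mult_distrib[OF pe assms(1), of d] d nb by simp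
  then show ?thesis by (simp add: padic_val_def nd)
qed

lemma padic_val_mult:
  assumes "x \<noteq> 0" "y \<noteq> 0"
  shows "padic_val p (x * y) = padic_val p x + padic_val p y"
proof -
  obtain a b where 1: "x = of_int a / of_int b" "b \<noteq> 0" by (metis Fract_of_int_quotient Rat_cases less_irrefl)
  obtain c d where 2: "y = of_int c / of_int d" "d \<noteq> 0" by (metis Fract_of_int_quotient Rat_cases less_irrefl)
  have nz: "a \<noteq> 0" "c \<noteq> 0" using assms 1 2 by auto
  have pe: "prime_elem (int p)" using p by simp
  have "x * y = of_int (a * c) / of_int (b * d)" by (simp add: 1(1) 2(1))
  then have "padic_val p (x * y) = int (multiplicity (int p) (a * c)) - int (multiplicity (int p) (b * d))"
    using padic_val_divide[of "a * c" "b * d"] nz 1(2) 2(2) by simp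
  then show ?thesis
    using nz 1(2) 2(2) by (simp add: 1(1) 2(1) padic_val_divide prime_elem_multiplicity_mult_distrib[OF pe])
qed

lemma padic_abs_0 [simp]: "padic_abs p 0 = 0"
  by (simp add: padic_abs_def)

lemma padic_abs_pos: "x \<noteq> 0 \<Longrightarrow> padic_abs p x > 0"
  using prime_gt_0_nat[OF p] by (simp add: padic_abs_def)

lemma padic_abs_nonneg [simp]: "padic_abs p x \<ge> 0"
  using padic_abs_pos[of x] by (cases "x = 0") auto

lemma padic_abs_mult: "padic_abs p (x * y) = padic_abs p x * padic_abs p y"
proof (cases "x = 0 \<or> y = 0")
  case False
  then show ?thesis
    using prime_gt_0_nat[OF p] by (simp add: padic_abs_def padic_val_mult power_int_diff power_int_minus field_simps)
qed auto

text \<open>In lowest terms, a denominator divisible by \<open>p\<close> would force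
  \<open>p\<close> into the numerator as well; so nonnegative valuation amounts to a denominator
  prime to \<open>p\<close>. This turns p-adic estimates into ring-theoretic membership.\<close>

lemma padic_abs_le_1_iff: "padic_abs p x \<le> 1 \<longleftrightarrow> x \<in> rat_localization p"
proof (cases "x = 0")
  case False
  have p1: "real p > 1" using prime_gt_1_nat[OF p] by simp
  obtain n d where nd: "quotient_of x = (n, d)" by (cases "quotient_of x") auto
  have d: "d > 0" using quotient_of_denom_pos[OF nd] .
  have x: "x = of_int n / of_int d" using quotient_of_div[OF nd] .
  have cop: "coprime n d" using quotient_of_coprime[OF nd] .
  have n: "n \<noteq> 0" using x False by auto
  have "padic_abs p x \<le> 1 \<longleftrightarrow> real p powi (- padic_val p x) \<le> real p powi 0"
    using False by (simp add: padic_abs_def)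
  also have "\<dots> \<longleftrightarrow> - padic_val p x \<le> 0"
    using power_int_le_imp_le_exp[OF p1, of "- padic_val p x" 0]
      power_int_increasing[of "- padic_val p x" 0 "real p"] p1 by auto
  finally have le: "padic_abs p x \<le> 1 \<longleftrightarrow> padic_val p x \<ge> 0" by simp
  show ?thesis
  proof
    assume "padic_abs p x \<le> 1"
    then have ge: "int (multiplicity (int p) n) \<ge> int (multiplicity (int p) d)"
      using le by (simp add: padic_val_def nd)
    have "\<not> int p dvd d"
    proof
      assume pd: "int p dvd d"
      then have "multiplicity (int p) d > 0" using d p by (simp add: prime_multiplicity_gt_zero_iff)
      then have "int p dvd n" using ge not_dvd_imp_multiplicity_0 by fastforce
      then have "is_unit (int p)" using pd cop coprime_common_divisor by blast
      then show False using p by (simp add: prime_nat_iff)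
    qed
    then show "x \<in> rat_localization p" unfolding x by (rule rat_localizationI)
  next
    assume "x \<in> rat_localization p"
    then obtain a b where ab: "x = of_int a / of_int b" "\<not> int p dvd b" "b \<noteq> 0" by (rule rat_localizationE)
    have "a \<noteq> 0" using ab False by auto
    then have "padic_val p x \<ge> 0"
      using padic_val_divide[of a b] ab by (simp add: not_dvd_imp_multiplicity_0)
    then show "padic_abs p x \<le> 1" using le by simp
  qed
qed simp

lemma padic_abs_of_int_le: "padic_abs p (of_int a) \<le> 1"
  by (simp add: padic_abs_le_1_iff)

lemma padic_abs_uminus [simp]: "padic_abs p (- x) = padic_abs p x"
proof -
  have le: "padic_abs p (- y) \<le> padic_abs p y" for y
    using padic_abs_mult[of "-1" y] padic_abs_of_int_le[of "-1"] mult_right_mono[OF _ padic_abs_nonneg[of y]]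
    by fastforce
  show ?thesis using le[of x] le[of "- x"] by simp
qed

text \<open>The ultrametric inequality comes from the localization being closed under addition:
  after division by the summand of larger absolute value both terms lie in it.\<close>

lemma padic_abs_add_le: "padic_abs p (x + y) \<le> max (padic_abs p x) (padic_abs p y)"
proof -
  have aux: "padic_abs p (x + y) \<le> padic_abs p y" if "padic_abs p x \<le> padic_abs p y" for x y
  proof (cases "y = 0")
    case True
    then show ?thesis using that padic_abs_pos[of x] by (cases "x = 0") auto
  next
    case False
    have "padic_abs p (x / y) * padic_abs p y = padic_abs p x"
      using padic_abs_mult[of "x / y" y] False by simp
    then have "padic_abs p (x / y) * padic_abs p y \<le> 1 * padic_abs p y" using that by simp
    then have "padic_abs p (x / y) \<le> 1" using padic_abs_pos[OF False] mult_le_cancel_right_pos by blast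
    then have "x / y + 1 \<in> rat_localization p"
      using padic_abs_le_1_iff rat_localization_add rat_localization_1 by blast
    then have "padic_abs p (x / y + 1) \<le> 1" using padic_abs_le_1_iff by blast
    then have "padic_abs p (x / y + 1) * padic_abs p y \<le> padic_abs p y"
      using mult_right_mono[OF _ padic_abs_nonneg[of y]] by fastforce
    moreover have "(x / y + 1) * y = x + y" using False by (simp add: field_simps)
    ultimately show ?thesis using padic_abs_mult[of "x / y + 1" y] by simp
  qed
  show ?thesis
  proof (cases "padic_abs p x \<le> padic_abs p y")
    case True
    then show ?thesis using aux[OF True] by simp
  next
    case False
    then show ?thesis using aux[of y x] by (simp add: add.commute)
  qed
qed

lemma padic_abs_add_less: "padic_abs p x < e \<Longrightarrow> padic_abs p y < e \<Longrightarrow> padic_abs p (x + y) < e"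
  using padic_abs_add_le[of x y] by simp

lemma padic_abs_prime_power_mult:
  assumes "y \<in> rat_localization p" shows "padic_abs p (of_nat p ^ m * y) \<le> (1 / real p) ^ m"
proof -
  have "padic_abs p (of_nat p) = 1 / real p"
    using prime_gt_0_nat[OF p] padic_val_divide[of "int p" 1] p
    by (simp add: padic_abs_def power_int_minus divide_inverse)
  then have "padic_abs p (of_nat p ^ m) = (1 / real p) ^ m"
  proof (induction m)
    case 0
    then show ?case using padic_val_divide[of 1 1] by (simp add: padic_abs_def)
  qed (simp add: padic_abs_mult)
  then show ?thesis
    using assms mult_left_mono[of "padic_abs p y" 1 "(1 / real p) ^ m"]
    by (simp add: padic_abs_mult padic_abs_le_1_iff)
qed

section \<open>The field of p-adic numbers as a quotient\<close>

lemma padic_cauchyD: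
  assumes "padic_cauchy p X" "e > 0"
  obtains M where "\<And>m n. m \<ge> M \<Longrightarrow> n \<ge> M \<Longrightarrow> padic_abs p (X m - X n) < e"
  using assms unfolding padic_cauchy_def by blast

lemma padic_cauchy_const [simp]: "padic_cauchy p (\<lambda>_. x)"
  by (simp add: padic_cauchy_def)

lemma padic_cauchy_add:
  assumes "padic_cauchy p X" "padic_cauchy p Y" shows "padic_cauchy p (\<lambda>n. X n + Y n)"
  unfolding padic_cauchy_def
proof (intro allI impI)
  fix e :: real assume e: "e > 0"
  obtain M1 where M1: "\<And>m n. m \<ge> M1 \<Longrightarrow> n \<ge> M1 \<Longrightarrow> padic_abs p (X m - X n) < e"
    using padic_cauchyD[OF assms(1) e] by blast
  obtain M2 where M2: "\<And>m n. m \<ge> M2 \<Longrightarrow> n \<ge> M2 \<Longrightarrow> padic_abs p (Y m - Y n) < e"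
    using padic_cauchyD[OF assms(2) e] by blast
  have "padic_abs p (X m + Y m - (X n + Y n)) < e" if "m \<ge> max M1 M2" "n \<ge> max M1 M2" for m n
    using padic_abs_add_less[OF M1[of m n] M2[of m n]] that by (simp add: algebra_simps)
  then show "\<exists>M. \<forall>m\<ge>M. \<forall>n\<ge>M. padic_abs p (X m + Y m - (X n + Y n)) < e" by blast
qed

lemma padic_cauchy_bounded:
  assumes "padic_cauchy p X" obtains B where "B > 0" "\<And>n. padic_abs p (X n) \<le> B"
proof -
  obtain M where M: "\<And>m n. m \<ge> M \<Longrightarrow> n \<ge> M \<Longrightarrow> padic_abs p (X m - X n) < 1"
    using padic_cauchyD[OF assms, of 1] by auto
  define B where "B = Max (insert 1 ((\<lambda>n. padic_abs p (X n)) ` {..M}))"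
  have B: "1 \<le> B" "\<And>n. n \<le> M \<Longrightarrow> padic_abs p (X n) \<le> B"
    unfolding B_def by (rule Max_ge; simp)+
  have "padic_abs p (X n) \<le> B" for n
  proof (cases "n \<le> M")
    case False
    have "padic_abs p (X n) = padic_abs p ((X n - X M) + X M)" by simp
    also have "\<dots> \<le> max (padic_abs p (X n - X M)) (padic_abs p (X M))" by (rule padic_abs_add_le)
    also have "\<dots> \<le> B" using M[of n M] False B(1) B(2)[of M] by simp
    finally show ?thesis .
  qed (use B in simp)
  moreover have "B > 0" using B(1) by simp
  ultimately show ?thesis using that by blast
qed

lemma padic_cauchy_mult:
  assumes "padic_cauchy p X" "padic_cauchy p Y" shows "padic_cauchy p (\<lambda>n. X n * Y n)"
  unfolding padic_cauchy_def
proof (intro allI impI)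
  fix e :: real assume e: "e > 0"
  obtain B where B: "B > 0" "\<And>n. padic_abs p (X n) \<le> B" using padic_cauchy_bounded[OF assms(1)] by blast
  obtain C where C: "C > 0" "\<And>n. padic_abs p (Y n) \<le> C" using padic_cauchy_bounded[OF assms(2)] by blast
  obtain M1 where M1: "\<And>m n. m \<ge> M1 \<Longrightarrow> n \<ge> M1 \<Longrightarrow> padic_abs p (X m - X n) < e / C"
    using padic_cauchyD[OF assms(1), of "e / C"] e C by auto
  obtain M2 where M2: "\<And>m n. m \<ge> M2 \<Longrightarrow> n \<ge> M2 \<Longrightarrow> padic_abs p (Y m - Y n) < e / B"
    using padic_cauchyD[OF assms(2), of "e / B"] e B by auto
  have "padic_abs p (X m * Y m - X n * Y n) < e" if "m \<ge> max M1 M2" "n \<ge> max M1 M2" for m n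
  proof -
    have eq: "X m * Y m - X n * Y n = (X m - X n) * Y m + X n * (Y m - Y n)" by (simp add: algebra_simps)
    have "padic_abs p ((X m - X n) * Y m) \<le> padic_abs p (X m - X n) * C"
      unfolding padic_abs_mult using C(2) by (intro mult_left_mono) auto
    also have "\<dots> < e" using M1[of m n] that C(1) by (simp add: pos_less_divide_eq)
    finally have 1: "padic_abs p ((X m - X n) * Y m) < e" .
    have "padic_abs p (X n * (Y m - Y n)) \<le> B * padic_abs p (Y m - Y n)"
      unfolding padic_abs_mult using B(2) by (intro mult_right_mono) auto
    also have "\<dots> < e" using M2[of m n] that B(1) by (simp add: pos_less_divide_eq mult.commute)
    finally have 2: "padic_abs p (X n * (Y m - Y n)) < e" .
    show ?thesis unfolding eq by (rule padic_abs_add_less[OF 1 2])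
  qed
  then show "\<exists>M. \<forall>m\<ge>M. \<forall>n\<ge>M. padic_abs p (X m * Y m - X n * Y n) < e" by blast
qed

lemma padic_cauchy_uminus: "padic_cauchy p X \<Longrightarrow> padic_cauchy p (\<lambda>n. - X n)"
  using padic_cauchy_mult[OF padic_cauchy_const[of "-1"]] by simp

lemma padic_cauchy_sum:
  "(\<And>i. i \<in> S \<Longrightarrow> padic_cauchy p (X i)) \<Longrightarrow> padic_cauchy p (\<lambda>n. \<Sum>i\<in>S. X i n)"
  by (induction S rule: infinite_finite_induct) (auto intro: padic_cauchy_add)

lemma padic_null_iff: "X \<in> padic_null p \<longleftrightarrow> (\<forall>e>0. \<exists>M. \<forall>n\<ge>M. padic_abs p (X n) < e)"
  by (simp add: padic_null_def LIMSEQ_iff)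

lemma padic_null_add:
  assumes "X \<in> padic_null p" "Y \<in> padic_null p" shows "(\<lambda>n. X n + Y n) \<in> padic_null p"
  unfolding padic_null_iff
proof (intro allI impI)
  fix e :: real assume e: "e > 0"
  obtain M1 where M1: "\<And>n. n \<ge> M1 \<Longrightarrow> padic_abs p (X n) < e" using assms(1) e unfolding padic_null_iff by blast
  obtain M2 where M2: "\<And>n. n \<ge> M2 \<Longrightarrow> padic_abs p (Y n) < e" using assms(2) e unfolding padic_null_iff by blast
  show "\<exists>M. \<forall>n\<ge>M. padic_abs p (X n + Y n) < e"
    using padic_abs_add_less M1 M2 by (intro exI[of _ "max M1 M2"]) simp
qed

lemma padic_null_cauchy: "X \<in> padic_null p \<Longrightarrow> padic_cauchy p X"
  unfolding padic_null_iff padic_cauchy_def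
  using padic_abs_add_less[of _ _ "- _"] by (metis padic_abs_uminus uminus_add_conv_diff add.commute)

lemma padic_null_mult:
  assumes "X \<in> padic_null p" "padic_cauchy p Y" shows "(\<lambda>n. Y n * X n) \<in> padic_null p"
  unfolding padic_null_iff
proof (intro allI impI)
  fix e :: real assume e: "e > 0"
  obtain C where C: "C > 0" "\<And>n. padic_abs p (Y n) \<le> C" using padic_cauchy_bounded[OF assms(2)] by blast
  have "e / C > 0" using e C by simp
  then obtain M where M: "\<And>n. n \<ge> M \<Longrightarrow> padic_abs p (X n) < e / C" using assms(1) unfolding padic_null_iff by blast
  have "padic_abs p (Y n * X n) < e" if "n \<ge> M" for n
  proof -
    have "padic_abs p (Y n * X n) \<le> C * padic_abs p (X n)"
      unfolding padic_abs_mult using C(2) by (intro mult_right_mono) auto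
    also have "\<dots> < e" using M[OF that] C(1) by (simp add: pos_less_divide_eq mult.commute)
    finally show ?thesis .
  qed
  then show "\<exists>M. \<forall>n\<ge>M. padic_abs p (Y n * X n) < e" by blast
qed

lemma padic_null_eventually_0: "(\<And>n. n \<ge> M \<Longrightarrow> X n = 0) \<Longrightarrow> X \<in> padic_null p"
  unfolding padic_null_iff by (metis padic_abs_0)

section \<open>The ring of Cauchy sequences modulo null sequences\<close>

abbreviation "\<C> \<equiv> padic_cauchy_ring p"

lemma padic_cauchy_ring_simps [simp]:
  "carrier \<C> = {X. padic_cauchy p X}" "X \<otimes>\<^bsub>\<C>\<^esub> Y = (\<lambda>n. X n * Y n)" "\<one>\<^bsub>\<C>\<^esub> = (\<lambda>_. 1)"
  "\<zero>\<^bsub>\<C>\<^esub> = (\<lambda>_. 0)" "X \<oplus>\<^bsub>\<C>\<^esub> Y = (\<lambda>n. X n + Y n)"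
  by (simp_all add: padic_cauchy_ring_def)

lemma cring_padic_cauchy_ring: "cring \<C>"
proof (rule cringI)
  show "abelian_group \<C>"
  proof (rule abelian_groupI)
    show "\<exists>Y\<in>carrier \<C>. Y \<oplus>\<^bsub>\<C>\<^esub> X = \<zero>\<^bsub>\<C>\<^esub>" if "X \<in> carrier \<C>" for X
      using that by (intro bexI[of _ "\<lambda>n. - X n"]) (auto intro: padic_cauchy_uminus)
  qed (auto intro: padic_cauchy_add simp: algebra_simps)
  show "comm_monoid \<C>"
    by (rule comm_monoidI) (auto intro: padic_cauchy_mult simp: algebra_simps)
qed (auto simp: algebra_simps)

lemma ideal_padic_null: "ideal (padic_null p) \<C>"
proof -
  interpret cring \<C> by (rule cring_padic_cauchy_ring)
  have inv: "inv\<^bsub>add_monoid \<C>\<^esub> X = (\<lambda>n. - X n)" if "padic_cauchy p X" for X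
  proof -
    have "(\<lambda>n. - X n) = \<ominus>\<^bsub>\<C>\<^esub> X"
      by (rule minus_equality[symmetric]) (use that padic_cauchy_uminus in auto)
    then show ?thesis by (simp add: a_inv_def)
  qed
  have neg: "(\<lambda>n. - X n) \<in> padic_null p" if "X \<in> padic_null p" for X
    using padic_null_mult[OF that padic_cauchy_const[of "-1"]] by simp
  show ?thesis
  proof (rule idealI)
    show "subgroup (padic_null p) (add_monoid \<C>)"
    proof (unfold_locales)
      show "padic_null p \<subseteq> carrier (add_monoid \<C>)" using padic_null_cauchy by auto
      show "\<one>\<^bsub>add_monoid \<C>\<^esub> \<in> padic_null p" by (auto intro: padic_null_eventually_0)
    qed (use padic_null_add neg inv padic_null_cauchy in \<open>auto\<close>)
    show "x \<otimes>\<^bsub>\<C>\<^esub> a \<in> padic_null p" "a \<otimes>\<^bsub>\<C>\<^esub> x \<in> padic_null p"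
      if "a \<in> padic_null p" "x \<in> carrier \<C>" for a x
      using padic_null_mult[of a x] that by (simp_all add: mult.commute)
  qed (rule ring_axioms)
qed

lemma ring_hom_padic_lim: "ring_hom_cring \<C> (Q_padic p) (padic_lim p)"
proof -
  have "padic_lim p = (+>\<^bsub>\<C>\<^esub>) (padic_null p)" by (simp add: padic_lim_def fun_eq_iff)
  then show ?thesis
    using ideal.rcos_ring_hom_cring[OF ideal_padic_null cring_padic_cauchy_ring] by (simp add: Q_padic_def)
qed

lemma padic_lim_ring_hom: "padic_lim p \<in> ring_hom \<C> (Q_padic p)"
  by (rule ring_hom_cring.homh[OF ring_hom_padic_lim])

lemma cring_Q_padic: "cring (Q_padic p)"
  using ring_hom_padic_lim by (simp add: ring_hom_cring_def)

lemma padic_lim_closed: "padic_cauchy p X \<Longrightarrow> padic_lim p X \<in> carrier (Q_padic p)"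
  using ring_hom_closed[OF padic_lim_ring_hom] by simp

lemma padic_lim_mult:
  "padic_cauchy p X \<Longrightarrow> padic_cauchy p Y \<Longrightarrow>
    padic_lim p X \<otimes>\<^bsub>Q_padic p\<^esub> padic_lim p Y = padic_lim p (\<lambda>n. X n * Y n)"
  using ring_hom_mult[OF padic_lim_ring_hom, of X Y] by simp

lemma padic_lim_sum:
  assumes "finite S" "\<And>i. i \<in> S \<Longrightarrow> padic_cauchy p (X i)"
  shows "(\<Oplus>\<^bsub>Q_padic p\<^esub>i\<in>S. padic_lim p (X i)) = padic_lim p (\<lambda>n. \<Sum>i\<in>S. X i n)"
  using assms
proof (induction S rule: finite_induct)
  interpret Q: cring "Q_padic p" by (rule cring_Q_padic)
  case empty
  show ?case
    using ring_hom_zero[OF padic_lim_ring_hom cring.axioms(1)[OF cring_padic_cauchy_ring] Q.ring_axioms] by simp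
next
  interpret Q: cring "Q_padic p" by (rule cring_Q_padic)
  case (insert i S)
  have "padic_lim p (X i) \<oplus>\<^bsub>Q_padic p\<^esub> padic_lim p (\<lambda>n. \<Sum>i\<in>S. X i n)
      = padic_lim p (\<lambda>n. X i n + (\<Sum>i\<in>S. X i n))"
    using ring_hom_add[OF padic_lim_ring_hom, of "X i" "\<lambda>n. \<Sum>i\<in>S. X i n"] insert padic_cauchy_sum[of S X]
    by simp
  then show ?case using insert padic_lim_closed by (simp add: Pi_def)
qed

lemma mem_padic_lim_iff: "Y \<in> padic_lim p X \<longleftrightarrow> (\<lambda>n. Y n - X n) \<in> padic_null p"
proof -
  have "padic_lim p X = (\<lambda>Z n. Z n + X n) ` padic_null p"
    by (auto simp: padic_lim_def a_r_coset_def')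
  also have "Y \<in> \<dots> \<longleftrightarrow> (\<lambda>n. Y n - X n) \<in> padic_null p"
    by (auto simp: image_iff intro!: bexI[of _ "\<lambda>n. Y n - X n"])
  finally show ?thesis .
qed

lemma padic_lim_eqI:
  assumes "padic_cauchy p X" "Y \<in> padic_lim p X"
  shows "padic_cauchy p Y" "padic_lim p Y = padic_lim p X"
proof -
  have n: "(\<lambda>n. Y n - X n) \<in> padic_null p" using assms(2) mem_padic_lim_iff by blast
  show "padic_cauchy p Y" using padic_cauchy_add[OF padic_null_cauchy[OF n] assms(1)] by simp
  have n': "(\<lambda>n. X n - Y n) \<in> padic_null p"
    using padic_null_mult[OF n padic_cauchy_const[of "-1"]] by simp
  have "Z \<in> padic_lim p Y \<longleftrightarrow> Z \<in> padic_lim p X" for Z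
    unfolding mem_padic_lim_iff
    using padic_null_add[OF _ n, of "\<lambda>n. Z n - Y n"] padic_null_add[OF _ n', of "\<lambda>n. Z n - X n"] by auto
  then show "padic_lim p Y = padic_lim p X" by blast
qed

text \<open>The unit ball asks for one representative bounded by 1. Representatives differ by null
  sequences, eventually of absolute value below 1, so any of them can be tested on its tail.\<close>

lemma padic_lim_in_Z_padic_iff:
  assumes X: "padic_cauchy p X"
  shows "padic_lim p X \<in> Z_padic p \<longleftrightarrow> (\<exists>M. \<forall>n\<ge>M. X n \<in> rat_localization p)"
proof
  assume "padic_lim p X \<in> Z_padic p"
  then obtain Y where Y: "Y \<in> padic_lim p X" "\<And>n. padic_abs p (Y n) \<le> 1" unfolding Z_padic_def by blast
  have "(\<lambda>n. Y n - X n) \<in> padic_null p" using Y(1) mem_padic_lim_iff by blast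
  then have "\<exists>M. \<forall>n\<ge>M. padic_abs p (Y n - X n) < 1" by (simp add: padic_null_iff)
  then obtain M where M: "\<And>n. n \<ge> M \<Longrightarrow> padic_abs p (Y n - X n) < 1" by blast
  have "X n \<in> rat_localization p" if "n \<ge> M" for n
  proof -
    have "Y n - X n \<in> rat_localization p" "Y n \<in> rat_localization p"
      unfolding padic_abs_le_1_iff[symmetric] using M[OF that] Y(2)[of n] by simp_all
    then show ?thesis using rat_localization_diff[of "Y n" "Y n - X n"] by simp
  qed
  then show "\<exists>M. \<forall>n\<ge>M. X n \<in> rat_localization p" by blast
next
  assume "\<exists>M. \<forall>n\<ge>M. X n \<in> rat_localization p"
  then obtain M where M: "\<And>n. n \<ge> M \<Longrightarrow> X n \<in> rat_localization p" by blast
  \<comment> \<open>Changing finitely many terms stays in the class, and 0 is a bounded value for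
    them.\<close>
  define Y where "Y n = (if n < M then 0 else X n)" for n
  have "Y \<in> padic_lim p X"
    unfolding mem_padic_lim_iff by (rule padic_null_eventually_0[of M]) (simp add: Y_def)
  moreover have "padic_abs p (Y n) \<le> 1" for n using M by (simp add: Y_def padic_abs_le_1_iff)
  ultimately have "\<exists>Y\<in>padic_lim p X. \<forall>n. padic_abs p (Y n) \<le> 1" by blast
  then show "padic_lim p X \<in> Z_padic p" using padic_lim_closed[OF X] by (simp add: Z_padic_def)
qed

lemma Z_padicE:
  assumes "x \<in> Z_padic p"
  obtains X where "padic_cauchy p X" "x = padic_lim p X" "\<And>n. X n \<in> rat_localization p"
proof -
  obtain X where X: "x \<in> carrier (Q_padic p)" "X \<in> x" "\<And>n. padic_abs p (X n) \<le> 1"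
    using assms unfolding Z_padic_def by blast
  obtain X0 where X0: "padic_cauchy p X0" "x = padic_lim p X0"
    using X(1) by (auto simp: Q_padic_def FactRing_def A_RCOSETS_def' padic_lim_def)
  show ?thesis
    using that[of X] padic_lim_eqI[OF X0(1), of X] X0(2) X(2,3) by (simp add: padic_abs_le_1_iff)
qed

end

section \<open>Idempotent powers and the duality\<close>

text \<open>There are only finitely many residue matrices modulo \<open>q\<close>, so two powers
  agree; the shift by 1 in \<open>f\<close> makes the exponent \<open>i\<close> positive.\<close>

lemma cong_mat_pow_eventually_periodic:
  fixes A :: "int mat"
  assumes A: "A \<in> carrier_mat n n" and q: "q > 0"
  obtains i d where "i \<ge> 1" "d \<ge> 1" "cong_mat q (A ^\<^sub>m (i + d)) (A ^\<^sub>m i)"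
proof -
  define f where "f k = mat n n (\<lambda>(i, j). (A ^\<^sub>m (k + 1)) $$ (i, j) mod q)" for k
  have "f k \<in> mat n n ` PiE ({..<n} \<times> {..<n}) (\<lambda>_. {0..<q})" for k
  proof (rule image_eqI)
    show "f k = mat n n (\<lambda>ij\<in>{..<n} \<times> {..<n}. (A ^\<^sub>m (k + 1)) $$ ij mod q)"
      by (rule eq_matI) (auto simp: f_def)
  qed (use q in auto)
  then have "range f \<subseteq> mat n n ` PiE ({..<n} \<times> {..<n}) (\<lambda>_. {0..<q})" by blast
  then have "finite (range f)" by (rule finite_subset) (simp add: finite_PiE)
  then have "\<not> inj f" using finite_imageD infinite_UNIV_nat by blast
  then obtain k l where kl: "k < l" "f k = f l" unfolding inj_def by (metis linorder_neqE_nat)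
  have "cong_mat q (A ^\<^sub>m (k + 1 + (l - k))) (A ^\<^sub>m (k + 1))"
  proof -
    have "q dvd (A ^\<^sub>m (l + 1)) $$ (i, j) - (A ^\<^sub>m (k + 1)) $$ (i, j)" if "i < n" "j < n" for i j
    proof -
      have "f l $$ (i, j) = f k $$ (i, j)" using kl by simp
      then show ?thesis using that by (simp add: f_def mod_eq_dvd_iff)
    qed
    moreover have "k + 1 + (l - k) = l + 1" using kl by simp
    ultimately show ?thesis using A unfolding cong_mat_def by (metis pow_mat_dim_square)
  qed
  then show ?thesis using that[of "k + 1" "l - k"] kl by simp
qed

text \<open>From \<open>i\<close> on the powers have period \<open>d\<close>, so an exponent that is
  at least \<open>i\<close> and a multiple of \<open>d\<close>, such as \<open>i * d\<close>, can be
  doubled without changing the power modulo \<open>q\<close>.\<close>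

lemma idempotent_power_exists:
  fixes A :: "int mat"
  assumes A: "A \<in> carrier_mat n n" and q: "q > 0"
  shows "\<exists>k\<ge>1. cong_mat q (A ^\<^sub>m k * A ^\<^sub>m k) (A ^\<^sub>m k)"
proof -
  obtain i d where id: "i \<ge> 1" "d \<ge> 1" "cong_mat q (A ^\<^sub>m (i + d)) (A ^\<^sub>m i)"
    using cong_mat_pow_eventually_periodic[OF A q] by blast
  have step: "cong_mat q (A ^\<^sub>m (a + d)) (A ^\<^sub>m a)" if "a \<ge> i" for a
  proof -
    have "cong_mat q (A ^\<^sub>m (a - i) * A ^\<^sub>m (i + d)) (A ^\<^sub>m (a - i) * A ^\<^sub>m i)"
      using id(3) A by (intro cong_mat_mult) auto
    then show ?thesis using that by (simp add: pow_mat_add[OF A, symmetric])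
  qed
  have "cong_mat q (A ^\<^sub>m (i * d + t * d)) (A ^\<^sub>m (i * d))" for t
  proof (induction t)
    case (Suc t)
    have "i * d + t * d \<ge> i" using id by (simp add: trans_le_add1)
    from cong_mat_trans[OF step[OF this] Suc] show ?case by (simp add: algebra_simps)
  qed simp
  from this[of i] have "cong_mat q (A ^\<^sub>m (i * d) * A ^\<^sub>m (i * d)) (A ^\<^sub>m (i * d))"
    by (simp add: pow_mat_add[OF A, symmetric])
  then show ?thesis using id by (intro exI[of _ "i * d"]) simp
qed

lemma idempotent_pow:
  fixes A :: "int mat"
  assumes A: "A \<in> carrier_mat n n" and k: "cong_mat q (A ^\<^sub>m k * A ^\<^sub>m k) (A ^\<^sub>m k)"
  shows "cong_mat q (A ^\<^sub>m (k * Suc t)) (A ^\<^sub>m k)"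
proof (induction t)
  case (Suc t)
  have "cong_mat q (A ^\<^sub>m (k * Suc t) * A ^\<^sub>m k) (A ^\<^sub>m k * A ^\<^sub>m k)"
    using Suc A by (intro cong_mat_mult) auto
  from cong_mat_trans[OF this k] show ?case
    by (simp add: pow_mat_add[OF A, symmetric] algebra_simps)
qed simp

lemma idem_exp:
  fixes A :: "int mat"
  assumes A: "A \<in> carrier_mat n n" and p: "p > 0"
  shows "idem_exp p A m \<ge> 1"
    "cong_mat (int p ^ m) (A ^\<^sub>m idem_exp p A m * A ^\<^sub>m idem_exp p A m) (A ^\<^sub>m idem_exp p A m)"
proof -
  define Q where "Q k \<longleftrightarrow> 1 \<le> k \<and> cong_mat (int p ^ m) (A ^\<^sub>m k * A ^\<^sub>m k) (A ^\<^sub>m k)" for k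
  have "Q k \<longleftrightarrow> 1 \<le> k \<and> (\<forall>i<dim_row A. \<forall>j<dim_row A.
      [(A ^\<^sub>m k * A ^\<^sub>m k) $$ (i, j) = (A ^\<^sub>m k) $$ (i, j)] (mod (int p ^ m)))" for k
    unfolding Q_def using A by (auto simp: cong_mat_def cong_iff_dvd_diff)
  then have e: "idem_exp p A m = (LEAST k. Q k)" by (simp only: idem_exp_def)
  have "\<exists>k. Q k"
    using idempotent_power_exists[OF A, of "int p ^ m"] p by (auto simp: Q_def)
  from LeastI_ex[OF this] have "Q (idem_exp p A m)" unfolding e .
  then show "idem_exp p A m \<ge> 1"
    "cong_mat (int p ^ m) (A ^\<^sub>m idem_exp p A m * A ^\<^sub>m idem_exp p A m) (A ^\<^sub>m idem_exp p A m)"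
    unfolding Q_def by blast+
qed

lemma idem_exp_pow:
  fixes A :: "int mat"
  assumes A: "A \<in> carrier_mat n n" and p: "p > 0" and k: "k \<ge> 1"
  shows "cong_mat (int p ^ m) (A ^\<^sub>m (idem_exp p A m * k)) (A ^\<^sub>m idem_exp p A m)"
  using idempotent_pow[OF A idem_exp(2)[OF A p], of m "k - 1"] k by simp

text \<open>Both \<open>A\<^sup>k\<close> and \<open>A\<^sup>l\<close> are congruent to \<open>A\<^sup>k\<^sup>l\<close>.\<close>

lemma idem_exp_compatible:
  fixes A :: "int mat"
  assumes A: "A \<in> carrier_mat n n" and p: "p > 0" and "m \<le> m'"
  shows "cong_mat (int p ^ m) (A ^\<^sub>m idem_exp p A m') (A ^\<^sub>m idem_exp p A m)"
proof -
  let ?k = "idem_exp p A m'" and ?l = "idem_exp p A m"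
  have "cong_mat (int p ^ m') (A ^\<^sub>m (?k * ?l)) (A ^\<^sub>m ?k)"
    by (rule idem_exp_pow[OF A p idem_exp(1)[OF A p]])
  then have "cong_mat (int p ^ m) (A ^\<^sub>m (?k * ?l)) (A ^\<^sub>m ?k)"
    using le_imp_power_dvd[OF \<open>m \<le> m'\<close>] by (rule cong_mat_dvd[rotated])
  moreover have "cong_mat (int p ^ m) (A ^\<^sub>m (?l * ?k)) (A ^\<^sub>m ?l)"
    by (rule idem_exp_pow[OF A p idem_exp(1)[OF A p]])
  ultimately show ?thesis using cong_mat_trans cong_mat_sym by (metis mult.commute)
qed

lemma rat_mat_pow_vec_add:
  assumes A: "A \<in> carrier_mat n n" and v: "v \<in> carrier_vec n"
  shows "rat_mat (A ^\<^sub>m (k + l)) *\<^sub>v v = rat_mat (A ^\<^sub>m k) *\<^sub>v (rat_mat (A ^\<^sub>m l) *\<^sub>v v)"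
  unfolding of_int_hom.mat_hom_pow[OF A] using A v by (intro pow_mat_add_vec) auto

text \<open>The quotient of \<open>M - M'\<close> by \<open>d\<close> is the integer matrix
  \<open>T\<close>. Congruent matrices thus act alike on a rational vector up to integer
  combinations of the entries of \<open>d v\<close>, which are harmless once \<open>d\<close> clears
  the denominators.\<close>

lemma cong_mat_mult_vec:
  assumes M: "M \<in> carrier_mat n n" and MM': "cong_mat d M M'" and v: "v \<in> carrier_vec n"
  shows "\<exists>T\<in>carrier_mat n n. rat_mat M *\<^sub>v v = rat_mat M' *\<^sub>v v + rat_mat T *\<^sub>v (of_int d \<cdot>\<^sub>v v)"
proof -
  have M': "M' \<in> carrier_mat n n" using M MM' by (auto simp: cong_mat_def)
  define T where "T = mat n n (\<lambda>ij. (M $$ ij - M' $$ ij) div d)"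
  have T: "of_int (M $$ (i, j)) = (of_int (M' $$ (i, j)) + of_int (T $$ (i, j)) * of_int d :: rat)"
    if "i < n" "j < n" for i j
  proof -
    have "d dvd M $$ (i, j) - M' $$ (i, j)" using MM' M that by (auto simp: cong_mat_def)
    then have "M $$ (i, j) = M' $$ (i, j) + T $$ (i, j) * d" using that by (simp add: T_def)
    then show ?thesis by (simp only: of_int_add of_int_mult)
  qed
  have "(rat_mat M *\<^sub>v v) $ i = (rat_mat M' *\<^sub>v v + rat_mat T *\<^sub>v (of_int d \<cdot>\<^sub>v v)) $ i" if i: "i < n" for i
  proof -
    have "(rat_mat M *\<^sub>v v) $ i = (\<Sum>j\<in>{0..<n}. of_int (M $$ (i, j)) * v $ j)"
      using M v i by (auto simp: scalar_prod_def intro!: sum.cong)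
    also have "\<dots> = (\<Sum>j\<in>{0..<n}. of_int (M' $$ (i, j)) * v $ j + of_int (T $$ (i, j)) * (of_int d * v $ j))"
      using i by (intro sum.cong) (auto simp: T algebra_simps)
    also have "\<dots> = (rat_mat M' *\<^sub>v v + rat_mat T *\<^sub>v (of_int d \<cdot>\<^sub>v v)) $ i"
      using M' v i by (auto simp: scalar_prod_def sum.distrib T_def intro!: arg_cong2[of _ _ _ _ plus] sum.cong)
    finally show ?thesis .
  qed
  then have "rat_mat M *\<^sub>v v = rat_mat M' *\<^sub>v v + rat_mat T *\<^sub>v (of_int d \<cdot>\<^sub>v v)"
    using M M' by (intro eq_vecI) (auto simp: T_def)
  then show ?thesis by (intro bexI[of _ T]) (simp_all add: T_def)
qed

section \<open>Integral and locally integral vectors\<close>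

lemma Q_vec_inv: "v \<in> carrier_vec n \<Longrightarrow> inv\<^bsub>Q_vec n\<^esub> v = - v"
proof -
  interpret V: comm_group "Q_vec n" by (rule comm_group_vec)
  assume "v \<in> carrier_vec n"
  then show ?thesis by (intro V.inv_equality) (auto simp: monoid_vec_simps)
qed

lemma Z_vec_carrier: "v \<in> Z_vec n \<Longrightarrow> v \<in> carrier_vec n"
  by (auto simp: Z_vec_def)

lemma Z_vec_iff: "v \<in> Z_vec n \<longleftrightarrow> v \<in> carrier_vec n \<and> (\<forall>i<n. v $ i \<in> \<int>)"
proof
  assume v: "v \<in> carrier_vec n \<and> (\<forall>i<n. v $ i \<in> \<int>)"
  then have "v = map_vec of_int (vec n (\<lambda>i. \<lfloor>v $ i\<rfloor>))" by (auto intro!: eq_vecI)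
  then show "v \<in> Z_vec n" unfolding Z_vec_def by (rule image_eqI) simp
qed (auto simp: Z_vec_def)

lemma Z_vec_0 [simp]: "0\<^sub>v n \<in> Z_vec n"
  by (simp add: Z_vec_iff)

lemma Z_vec_add: "u \<in> Z_vec n \<Longrightarrow> v \<in> Z_vec n \<Longrightarrow> u + v \<in> Z_vec n"
  by (auto simp: Z_vec_iff)

lemma Z_vec_smult: "u \<in> Z_vec n \<Longrightarrow> of_int m \<cdot>\<^sub>v u \<in> Z_vec n"
  by (auto simp: Z_vec_iff)

lemma Z_vec_mult_mat: "M \<in> carrier_mat m n \<Longrightarrow> u \<in> Z_vec n \<Longrightarrow> rat_mat M *\<^sub>v u \<in> Z_vec m"
  unfolding Z_vec_iff by (auto simp: scalar_prod_def intro!: Ints_sum Ints_mult)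

lemma common_denominator:
  fixes u :: "rat vec" and b :: "nat \<Rightarrow> int"
  assumes u: "u \<in> carrier_vec n" and b: "\<And>i. i < n \<Longrightarrow> of_int (b i) * u $ i \<in> \<int>"
  shows "of_int (\<Prod>i<n. b i) \<cdot>\<^sub>v u \<in> Z_vec n"
proof -
  have "of_int (\<Prod>i<n. b i) * u $ i \<in> \<int>" if i: "i < n" for i
  proof -
    have "(\<Prod>i<n. b i) = (\<Prod>j\<in>{..<n} - {i}. b j) * b i"
      using prod.remove[of "{..<n}" i b] i by (simp add: mult.commute)
    then have "of_int (\<Prod>i<n. b i) * u $ i = of_int (\<Prod>j\<in>{..<n} - {i}. b j) * (of_int (b i) * u $ i)"
      by (simp only: of_int_mult mult.assoc)
    then show ?thesis using b[OF i] by (simp only: Ints_mult Ints_of_int)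
  qed
  then show ?thesis using u by (simp add: Z_vec_iff)
qed

definition local_vec :: "nat \<Rightarrow> nat \<Rightarrow> rat vec set" where
  "local_vec p n = {v \<in> carrier_vec n. \<forall>i<n. v $ i \<in> rat_localization p}"

context
  fixes p :: nat
  assumes p: "prime p"
begin

lemma local_vec_add: "u \<in> local_vec p n \<Longrightarrow> w \<in> local_vec p n \<Longrightarrow> u + w \<in> local_vec p n"
  by (auto simp: local_vec_def rat_localization_add[OF p])

lemma local_vec_mult_mat:
  assumes "M \<in> carrier_mat n n" "v \<in> local_vec p n"
  shows "rat_mat M *\<^sub>v v \<in> local_vec p n"
  using assms unfolding local_vec_def
  by (auto simp: scalar_prod_def intro!: rat_localization_sum[OF p] rat_localization_mult[OF p] rat_localization_of_int[OF p])

text \<open>The error caused by the congruence only involves \<open>p ^ a\<close> times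
  \<open>v\<close>, which is \<open>p\<close>-integral by assumption.\<close>

lemma local_vec_cong:
  assumes M: "M \<in> carrier_mat n n" and MM': "cong_mat (int p ^ a) M M'"
    and v: "v \<in> carrier_vec n" "of_nat p ^ a \<cdot>\<^sub>v v \<in> local_vec p n"
    and M'v: "rat_mat M' *\<^sub>v v \<in> local_vec p n"
  shows "rat_mat M *\<^sub>v v \<in> local_vec p n"
proof -
  obtain T where T: "T \<in> carrier_mat n n"
    "rat_mat M *\<^sub>v v = rat_mat M' *\<^sub>v v + rat_mat T *\<^sub>v (of_int (int p ^ a) \<cdot>\<^sub>v v)"
    using cong_mat_mult_vec[OF M MM' v(1)] by blast
  have "rat_mat T *\<^sub>v (of_int (int p ^ a) \<cdot>\<^sub>v v) \<in> local_vec p n"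
    using local_vec_mult_mat[OF T(1) v(2)] by simp
  then show ?thesis unfolding T(2) by (rule local_vec_add[OF M'v])
qed

lemma local_vec_denominator:
  assumes v: "v \<in> carrier_vec n"
  obtains a where "of_nat p ^ a \<cdot>\<^sub>v v \<in> local_vec p n"
proof -
  have "\<exists>a. of_nat p ^ a * x \<in> rat_localization p" for x :: rat
  proof -
    obtain c d where cd: "x = of_int c / of_int d" "d \<noteq> 0" by (metis Fract_of_int_quotient Rat_cases less_irrefl)
    obtain e d' where d': "d = int p ^ e * d'" "\<not> int p dvd d'"
      using multiplicity_decompose'[of d "int p"] cd(2) p by (metis not_prime_unit prime_nat_int_transfer)
    have "of_nat p ^ e * x = of_int c / of_int d'"
      using prime_gt_0_nat[OF p] by (simp add: cd(1) d'(1))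
    then show ?thesis using rat_localizationI[OF d'(2)] by metis
  qed
  then have "\<forall>i. \<exists>a. of_nat p ^ a * v $ i \<in> rat_localization p" by blast
  then obtain a where a: "\<And>i. of_nat p ^ a i * v $ i \<in> rat_localization p" by metis
  \<comment> \<open>The sum of the finitely many exponents bounds each of them.\<close>
  define b where "b = (\<Sum>i<n. a i)"
  have "of_nat p ^ b * v $ i \<in> rat_localization p" if "i < n" for i
  proof -
    have "a i \<le> b" unfolding b_def using that by (intro member_le_sum) auto
    then have "of_nat p ^ b * v $ i = of_int (int p ^ (b - a i)) * (of_nat p ^ a i * v $ i)"
      by (simp flip: mult.assoc power_add)
    then show ?thesis using rat_localization_mult[OF p rat_localization_of_int[OF p] a] by metis
  qed
  then show ?thesis using that[of b] v by (simp add: local_vec_def)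
qed

text \<open>If \<open>p ^ a\<close> removes \<open>p\<close> from the denominators of
  \<open>v\<close>, powers of \<open>A\<close> matter only modulo \<open>p ^ a\<close>. There the
  idempotent power agrees with all its positive powers, and one of large exponent factors through
  the given \<open>k\<close>.\<close>

lemma idem_exp_local_vec_iff:
  assumes A: "A \<in> carrier_mat n n" and v: "v \<in> carrier_vec n"
  shows "(\<exists>k. rat_mat (A ^\<^sub>m k) *\<^sub>v v \<in> local_vec p n) \<longleftrightarrow>
    (\<exists>M. \<forall>m\<ge>M. rat_mat (A ^\<^sub>m idem_exp p A m) *\<^sub>v v \<in> local_vec p n)"
proof
  assume "\<exists>k. rat_mat (A ^\<^sub>m k) *\<^sub>v v \<in> local_vec p n"
  then obtain k where k: "rat_mat (A ^\<^sub>m k) *\<^sub>v v \<in> local_vec p n" by blast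
  obtain a where a: "of_nat p ^ a \<cdot>\<^sub>v v \<in> local_vec p n" using local_vec_denominator[OF v] by blast
  have "rat_mat (A ^\<^sub>m idem_exp p A m) *\<^sub>v v \<in> local_vec p n" if "m \<ge> a" for m
  proof -
    let ?e = "idem_exp p A m"
    have p0: "p > 0" using prime_gt_0_nat[OF p] .
    have e: "?e \<ge> 1" by (rule idem_exp(1)[OF A p0])
    have "k \<le> ?e * Suc k" using mult_le_mono[OF e, of k "Suc k"] by simp
    then have "rat_mat (A ^\<^sub>m (?e * Suc k)) *\<^sub>v v
        = rat_mat (A ^\<^sub>m (?e * Suc k - k)) *\<^sub>v (rat_mat (A ^\<^sub>m k) *\<^sub>v v)"
      using rat_mat_pow_vec_add[OF A v, of "?e * Suc k - k" k] by (simp only: le_add_diff_inverse2)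
    also have "\<dots> \<in> local_vec p n" by (rule local_vec_mult_mat[OF pow_carrier_mat[OF A] k])
    finally have loc: "rat_mat (A ^\<^sub>m (?e * Suc k)) *\<^sub>v v \<in> local_vec p n" .
    have "cong_mat (int p ^ m) (A ^\<^sub>m ?e) (A ^\<^sub>m (?e * Suc k))"
      by (rule cong_mat_sym[OF idem_exp_pow[OF A p0]]) simp
    then have "cong_mat (int p ^ a) (A ^\<^sub>m ?e) (A ^\<^sub>m (?e * Suc k))"
      using le_imp_power_dvd[OF that] by (rule cong_mat_dvd[rotated])
    from local_vec_cong[OF pow_carrier_mat[OF A] this v a loc] show ?thesis .
  qed
  then show "\<exists>M. \<forall>m\<ge>M. rat_mat (A ^\<^sub>m idem_exp p A m) *\<^sub>v v \<in> local_vec p n" by blast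
qed blast

section \<open>Pairing with the eventual row space as a limit of rational sequences\<close>

lemma padic_cauchy_idem:
  assumes A: "A \<in> carrier_mat n n" and ij: "i < n" "j < n"
  shows "padic_cauchy p (\<lambda>m. of_int ((A ^\<^sub>m idem_exp p A m) $$ (i, j)))"
  unfolding padic_cauchy_def
proof (intro allI impI)
  fix e :: real assume e: "e > 0"
  define E where "E m = (A ^\<^sub>m idem_exp p A m) $$ (i, j)" for m
  have "1 / real p < 1" using prime_gt_1_nat[OF p] by simp
  then obtain M where M: "(1 / real p) ^ M < e" using real_arch_pow_inv[OF e] by blast
  have EM: "padic_abs p (of_int (E m) - of_int (E M)) < e" if "m \<ge> M" for m
  proof -
    have "int p ^ M dvd E m - E M"
      using idem_exp_compatible[OF A prime_gt_0_nat[OF p] that] ij A by (auto simp: cong_mat_def E_def)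
    then obtain t where "E m - E M = int p ^ M * t" by (elim dvdE)
    then have "(of_int (E m) - of_int (E M) :: rat) = of_nat p ^ M * of_int t"
      by (metis of_int_diff of_int_mult of_int_power of_int_of_nat_eq)
    then show ?thesis
      using padic_abs_prime_power_mult[OF p rat_localization_of_int[OF p], of M t] M by simp
  qed
  have "padic_abs p (of_int (E m) - of_int (E n)) < e" if "m \<ge> M" "n \<ge> M" for m n
  proof -
    have "padic_abs p (- (of_int (E n) - of_int (E M))) < e"
      unfolding padic_abs_uminus[OF p] by (rule EM[OF that(2)])
    from padic_abs_add_less[OF p EM[OF that(1)] this] show ?thesis by simp
  qed
  then show "\<exists>M. \<forall>m\<ge>M. \<forall>n\<ge>M. padic_abs p (of_int ((A ^\<^sub>m idem_exp p A m) $$ (i, j)) - of_int ((A ^\<^sub>m idem_exp p A n) $$ (i, j))) < e"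
    unfolding E_def by blast
qed

text \<open>Exchanging the two sums turns the pairing of a combination of rows with \<open>v\<close>
  into a limit of combinations of the coordinates of \<open>A ^\<^sub>m idem_exp p A m\<close>
  applied to \<open>v\<close>. After this only rational sequences have to be considered.\<close>

lemma padic_pairing_row:
  assumes A: "A \<in> carrier_mat n n" and v: "v \<in> carrier_vec n"
    and C: "\<And>i. i < n \<Longrightarrow> padic_cauchy p (C i)"
  defines "X \<equiv> \<lambda>m. \<Sum>i<n. C i m * (rat_mat (A ^\<^sub>m idem_exp p A m) *\<^sub>v v) $ i"
  shows "padic_cauchy p X"
    "padic_pairing p (vec n (\<lambda>j. \<Oplus>\<^bsub>Q_padic p\<^esub>i\<in>{..<n}. padic_lim p (C i) \<otimes>\<^bsub>Q_padic p\<^esub> padic_idem p A $$ (i, j))) v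
      = padic_lim p X"
proof -
  define E where "E i j m = (of_int ((A ^\<^sub>m idem_exp p A m) $$ (i, j)) :: rat)" for i j m
  have E: "padic_cauchy p (E i j)" if "i < n" "j < n" for i j
    using padic_cauchy_idem[OF A that] by (simp add: E_def[abs_def])
  have CE: "padic_cauchy p (\<lambda>m. C i m * E i j m)" if "i < n" "j < n" for i j
    by (rule padic_cauchy_mult[OF p C[OF that(1)] E[OF that]])
  have S: "padic_cauchy p (\<lambda>m. \<Sum>i<n. C i m * E i j m)" if "j < n" for j
    by (rule padic_cauchy_sum[OF p]) (use CE that in auto)
  have Sv: "padic_cauchy p (\<lambda>m. (\<Sum>i<n. C i m * E i j m) * v $ j)" if "j < n" for j
    by (rule padic_cauchy_mult[OF p S[OF that] padic_cauchy_const[OF p]])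
  interpret Q: cring "Q_padic p" by (rule cring_Q_padic[OF p])
  have idem: "padic_idem p A $$ (i, j) = padic_lim p (E i j)" if "i < n" "j < n" for i j
    using A that by (simp add: padic_idem_def E_def[abs_def])
  have w: "(\<Oplus>\<^bsub>Q_padic p\<^esub>i\<in>{..<n}. padic_lim p (C i) \<otimes>\<^bsub>Q_padic p\<^esub> padic_idem p A $$ (i, j))
      = padic_lim p (\<lambda>m. \<Sum>i<n. C i m * E i j m)" if j: "j < n" for j
  proof -
    have "(\<Oplus>\<^bsub>Q_padic p\<^esub>i\<in>{..<n}. padic_lim p (C i) \<otimes>\<^bsub>Q_padic p\<^esub> padic_idem p A $$ (i, j))
        = (\<Oplus>\<^bsub>Q_padic p\<^esub>i\<in>{..<n}. padic_lim p (\<lambda>m. C i m * E i j m))"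
      by (rule Q.finsum_cong') (use idem C E CE j padic_lim_closed[OF p] padic_lim_mult[OF p] in auto)
    also have "\<dots> = padic_lim p (\<lambda>m. \<Sum>i<n. C i m * E i j m)"
      by (rule padic_lim_sum[OF p]) (use CE j in auto)
    finally show ?thesis .
  qed
  let ?w = "vec n (\<lambda>j. \<Oplus>\<^bsub>Q_padic p\<^esub>i\<in>{..<n}. padic_lim p (C i) \<otimes>\<^bsub>Q_padic p\<^esub> padic_idem p A $$ (i, j))"
  have X: "X = (\<lambda>m. \<Sum>j<n. (\<Sum>i<n. C i m * E i j m) * v $ j)"
  proof
    fix m
    have "(rat_mat (A ^\<^sub>m idem_exp p A m) *\<^sub>v v) $ i = (\<Sum>j<n. E i j m * v $ j)" if "i < n" for i
      using A v that by (auto simp: scalar_prod_def E_def lessThan_atLeast0 intro!: sum.cong)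
    then have "X m = (\<Sum>i<n. \<Sum>j<n. C i m * (E i j m * v $ j))"
      by (simp add: X_def sum_distrib_left)
    also have "\<dots> = (\<Sum>j<n. \<Sum>i<n. C i m * (E i j m * v $ j))" by (rule sum.swap)
    also have "\<dots> = (\<Sum>j<n. (\<Sum>i<n. C i m * E i j m) * v $ j)"
      by (simp add: sum_distrib_right mult.assoc)
    finally show "X m = (\<Sum>j<n. (\<Sum>i<n. C i m * E i j m) * v $ j)" .
  qed
  show "padic_cauchy p X" unfolding X by (rule padic_cauchy_sum[OF p]) (use Sv in auto)
  have "padic_pairing p ?w v = (\<Oplus>\<^bsub>Q_padic p\<^esub>j\<in>{..<n}. padic_lim p (\<lambda>m. (\<Sum>i<n. C i m * E i j m) * v $ j))"
    unfolding padic_pairing_def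
  proof (rule Q.finsum_cong')
    show "?w $ j \<otimes>\<^bsub>Q_padic p\<^esub> padic_of_rat p (v $ j) = padic_lim p (\<lambda>m. (\<Sum>i<n. C i m * E i j m) * v $ j)"
      if "j \<in> {..<n}" for j
      using that w[of j] padic_lim_mult[OF p S[of j] padic_cauchy_const[OF p]] by (simp add: padic_of_rat_def)
  qed (use v Sv padic_lim_closed[OF p] in auto)
  also have "\<dots> = padic_lim p X"
    unfolding X by (rule padic_lim_sum[OF p]) (use Sv in auto)
  finally show "padic_pairing p ?w v = padic_lim p X" .
qed

text \<open>Pairing with single rows tests the coordinates of the idempotent powers applied to
  \<open>v\<close> one at a time; conversely \<open>p\<close>-integral coefficients preserve
  integrality. The passage to an arbitrary exponent is
  \<open>idem_exp_local_vec_iff\<close>.\<close>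

theorem padic_dual_iff:
  assumes A: "A \<in> carrier_mat n n" and v: "v \<in> carrier_vec n"
  shows "(\<forall>w\<in>padic_row_space p A. padic_pairing p w v \<in> Z_padic p) \<longleftrightarrow>
    (\<exists>k. rat_mat (A ^\<^sub>m k) *\<^sub>v v \<in> local_vec p n)"
proof -
  define y where "y m = rat_mat (A ^\<^sub>m idem_exp p A m) *\<^sub>v v" for m
  have y: "y m \<in> carrier_vec n" for m
    unfolding y_def using v by (rule mult_mat_vec_carrier[rotated]) (use A in simp)
  have dim: "dim_row A = n" using A by simp
  have "(\<forall>w\<in>padic_row_space p A. padic_pairing p w v \<in> Z_padic p) \<longleftrightarrow>
      (\<exists>M. \<forall>m\<ge>M. y m \<in> local_vec p n)"
  proof
    assume L: "\<forall>w\<in>padic_row_space p A. padic_pairing p w v \<in> Z_padic p"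
    have "\<exists>M. \<forall>m\<ge>M. y m $ i \<in> rat_localization p" if i: "i < n" for i
    proof -
      \<comment> \<open>Constant coefficients that select row \<open>i\<close> of the idempotent
        matrix.\<close>
      define C where "C i' m = (if i' = i then 1 else 0 :: rat)" for i' :: nat and m :: nat
      have C: "padic_cauchy p (C i')" for i' by (simp add: C_def[abs_def] padic_cauchy_const[OF p])
      have "padic_lim p (C i') \<in> Z_padic p" for i'
        using padic_lim_in_Z_padic_iff[OF p C] rat_localization_0[OF p] rat_localization_1[OF p] by (auto simp: C_def)
      then have "vec n (\<lambda>j. \<Oplus>\<^bsub>Q_padic p\<^esub>i\<in>{..<n}. padic_lim p (C i) \<otimes>\<^bsub>Q_padic p\<^esub> padic_idem p A $$ (i, j)) \<in> padic_row_space p A"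
        unfolding padic_row_space_def dim by (intro CollectI exI[of _ "\<lambda>i. padic_lim p (C i)"]) simp
      from bspec[OF L this] have "padic_lim p (\<lambda>m. \<Sum>i<n. C i m * y m $ i) \<in> Z_padic p"
        unfolding y_def padic_pairing_row(2)[OF A v, of C, OF C] .
      moreover have "(\<lambda>m. \<Sum>i<n. C i m * y m $ i) = (\<lambda>m. y m $ i)"
        using i by (auto simp: C_def if_distrib[of "\<lambda>x. x * _"] cong: if_cong)
      moreover have "padic_cauchy p (\<lambda>m. \<Sum>i<n. C i m * y m $ i)"
        unfolding y_def by (rule padic_pairing_row(1)[OF A v, of C, OF C])
      ultimately show ?thesis using padic_lim_in_Z_padic_iff[OF p, of "\<lambda>m. y m $ i"] by simp
    qed
    then obtain M where M: "\<And>i m. i < n \<Longrightarrow> m \<ge> M i \<Longrightarrow> y m $ i \<in> rat_localization p" by metis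
    have "y m \<in> local_vec p n" if "m \<ge> (\<Sum>i<n. M i)" for m
    proof -
      have "M i \<le> m" if "i < n" for i
        using member_le_sum[of i "{..<n}" M] that \<open>m \<ge> _\<close> by simp
      then show ?thesis using M y by (simp add: local_vec_def)
    qed
    then show "\<exists>M. \<forall>m\<ge>M. y m \<in> local_vec p n" by blast
  next
    assume "\<exists>M. \<forall>m\<ge>M. y m \<in> local_vec p n"
    then obtain M where M: "\<And>m. m \<ge> M \<Longrightarrow> y m \<in> local_vec p n" by blast
    show "\<forall>w\<in>padic_row_space p A. padic_pairing p w v \<in> Z_padic p"
    proof
      fix w assume "w \<in> padic_row_space p A"
      then obtain c where wc: "w = vec n (\<lambda>j. \<Oplus>\<^bsub>Q_padic p\<^esub>i\<in>{..<n}. c i \<otimes>\<^bsub>Q_padic p\<^esub> padic_idem p A $$ (i, j))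
          \<and> (\<forall>i<n. c i \<in> Z_padic p)"
        unfolding padic_row_space_def dim mem_Collect_eq by (elim exE)
      note w = conjunct1[OF wc]
      have c: "c i \<in> Z_padic p" if "i < n" for i using wc that by simp
      have "\<exists>X. padic_cauchy p X \<and> c i = padic_lim p X \<and> (\<forall>m. X m \<in> rat_localization p)" if "i < n" for i
        by (rule Z_padicE[OF p c[OF that]]) blast
      then obtain C where C: "\<And>i. i < n \<Longrightarrow> padic_cauchy p (C i)" "\<And>i. i < n \<Longrightarrow> c i = padic_lim p (C i)"
        "\<And>i m. i < n \<Longrightarrow> C i m \<in> rat_localization p" by metis
      interpret Q: cring "Q_padic p" by (rule cring_Q_padic[OF p])
      have "w = vec n (\<lambda>j. \<Oplus>\<^bsub>Q_padic p\<^esub>i\<in>{..<n}. padic_lim p (C i) \<otimes>\<^bsub>Q_padic p\<^esub> padic_idem p A $$ (i, j))"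
        unfolding w
      proof (rule eq_vecI)
        fix j assume "j < dim_vec (vec n (\<lambda>j. \<Oplus>\<^bsub>Q_padic p\<^esub>i\<in>{..<n}. padic_lim p (C i) \<otimes>\<^bsub>Q_padic p\<^esub> padic_idem p A $$ (i, j)))"
        then have j: "j < n" by simp
        have idem: "padic_idem p A $$ (i, j) \<in> carrier (Q_padic p)" if "i < n" for i
          using A j that padic_lim_closed[OF p padic_cauchy_idem[OF A that j]] by (simp add: padic_idem_def)
        have "(\<Oplus>\<^bsub>Q_padic p\<^esub>i\<in>{..<n}. c i \<otimes>\<^bsub>Q_padic p\<^esub> padic_idem p A $$ (i, j))
           = (\<Oplus>\<^bsub>Q_padic p\<^esub>i\<in>{..<n}. padic_lim p (C i) \<otimes>\<^bsub>Q_padic p\<^esub> padic_idem p A $$ (i, j))"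
          by (rule Q.finsum_cong') (use C idem padic_lim_closed[OF p] in auto)
        then show "vec n (\<lambda>j. \<Oplus>\<^bsub>Q_padic p\<^esub>i\<in>{..<n}. c i \<otimes>\<^bsub>Q_padic p\<^esub> padic_idem p A $$ (i, j)) $ j
          = vec n (\<lambda>j. \<Oplus>\<^bsub>Q_padic p\<^esub>i\<in>{..<n}. padic_lim p (C i) \<otimes>\<^bsub>Q_padic p\<^esub> padic_idem p A $$ (i, j)) $ j"
          using j by simp
      qed simp
      then have "padic_pairing p w v = padic_lim p (\<lambda>m. \<Sum>i<n. C i m * y m $ i)"
        using padic_pairing_row(2)[OF A v, of C, OF C(1)] by (simp add: y_def)
      moreover have "padic_cauchy p (\<lambda>m. \<Sum>i<n. C i m * y m $ i)"
        unfolding y_def by (rule padic_pairing_row(1)[OF A v, of C, OF C(1)])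
      moreover have "(\<Sum>i<n. C i m * y m $ i) \<in> rat_localization p" if "m \<ge> M" for m
        using M[OF that] C(3) by (intro rat_localization_sum[OF p] rat_localization_mult[OF p]) (auto simp: local_vec_def)
      ultimately show "padic_pairing p w v \<in> Z_padic p" using padic_lim_in_Z_padic_iff[OF p] by auto
    qed
  qed
  then show ?thesis using idem_exp_local_vec_iff[OF A v] by (simp add: y_def)
qed

text \<open>The right-hand side is a subgroup that is closed under \<open>p\<close>-integral scalars
  and contains the dimension group. Conversely, if a power of \<open>A\<close> makes
  \<open>v\<close> locally integral, the remaining denominators are prime to \<open>p\<close>, and
  multiplying \<open>v\<close> by their product lands in the dimension group.\<close>

lemma tensor_localization:
  assumes A: "A \<in> carrier_mat n n"
  shows "tensor_subring n (dimension_group A) (rat_localization p)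
    = {v \<in> carrier_vec n. \<exists>k. rat_mat (A ^\<^sub>m k) *\<^sub>v v \<in> local_vec p n}" (is "_ = ?T")
proof
  interpret V: comm_group "Q_vec n" by (rule comm_group_vec)
  have dim: "dim_row A = n" using A by simp
  have rat_pow: "rat_mat A ^\<^sub>m k = rat_mat (A ^\<^sub>m k)" for k by (rule of_int_hom.mat_hom_pow[OF A, symmetric])
  have Ak: "rat_mat (A ^\<^sub>m k) \<in> carrier_mat n n" for k using A by simp
  have smult: "r \<cdot>\<^sub>v u \<in> local_vec p n" if "r \<in> rat_localization p" "u \<in> local_vec p n" for r u
    using rat_localization_mult[OF p that(1)] that(2) by (auto simp: local_vec_def)
  have T_smult: "r \<cdot>\<^sub>v u \<in> ?T" if "r \<in> rat_localization p" "u \<in> ?T" for r u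
    using that smult mult_mat_vec[OF Ak] by auto
  \<comment> \<open>Exponents may be raised, so two vectors can share one.\<close>
  have step: "rat_mat (A ^\<^sub>m (l + k)) *\<^sub>v u \<in> local_vec p n"
    if "u \<in> carrier_vec n" "rat_mat (A ^\<^sub>m k) *\<^sub>v u \<in> local_vec p n" for u k l
    unfolding rat_mat_pow_vec_add[OF A that(1)] by (rule local_vec_mult_mat[OF pow_carrier_mat[OF A] that(2)])
  have "subgroup ?T (Q_vec n)"
  proof (rule V.subgroupI)
    show "?T \<subseteq> carrier (Q_vec n)" by (auto simp: monoid_vec_simps)
    have "rat_mat (A ^\<^sub>m 0) *\<^sub>v 0\<^sub>v n = 0\<^sub>v n" by (rule eq_vecI) (use A in auto)
    moreover have "0\<^sub>v n \<in> local_vec p n" by (simp add: local_vec_def rat_localization_0[OF p])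
    ultimately have "0\<^sub>v n \<in> ?T" by (metis (mono_tags, lifting) mem_Collect_eq zero_carrier_vec)
    then show "?T \<noteq> {}" by blast
    show "inv\<^bsub>Q_vec n\<^esub> u \<in> ?T" if "u \<in> ?T" for u
    proof -
      have "- u = (- 1) \<cdot>\<^sub>v u" by auto
      moreover have "- 1 \<in> rat_localization p" using rat_localization_of_int[OF p, of "-1"] by simp
      ultimately show ?thesis using T_smult[OF _ that] Q_vec_inv that by simp
    qed
    show "u \<otimes>\<^bsub>Q_vec n\<^esub> w \<in> ?T" if uw: "u \<in> ?T" "w \<in> ?T" for u w
    proof -
      obtain k l where "rat_mat (A ^\<^sub>m k) *\<^sub>v u \<in> local_vec p n" "rat_mat (A ^\<^sub>m l) *\<^sub>v w \<in> local_vec p n"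
        using uw by blast
      then have "rat_mat (A ^\<^sub>m (l + k)) *\<^sub>v u \<in> local_vec p n" "rat_mat (A ^\<^sub>m (k + l)) *\<^sub>v w \<in> local_vec p n"
        using step uw by blast+
      then have "rat_mat (A ^\<^sub>m (k + l)) *\<^sub>v (u + w) \<in> local_vec p n"
        using uw mult_add_distrib_mat_vec[OF Ak, of u w "k + l"] local_vec_add
        by (simp add: add.commute[of l k])
      then show ?thesis using uw by (auto simp: monoid_vec_simps)
    qed
  qed
  moreover have "{r \<cdot>\<^sub>v g | r g. r \<in> rat_localization p \<and> g \<in> dimension_group A} \<subseteq> ?T"
  proof -
    have "g \<in> ?T" if g: "g \<in> dimension_group A" for g
    proof -
      obtain k where k: "g \<in> carrier_vec n" "rat_mat (A ^\<^sub>m k) *\<^sub>v g \<in> Z_vec n"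
        using g by (auto simp: dimension_group_def inv_pow_def dim rat_pow)
      then have "rat_mat (A ^\<^sub>m k) *\<^sub>v g \<in> local_vec p n"
        by (auto simp: Z_vec_def local_vec_def rat_localization_of_int[OF p])
      then show ?thesis using k by blast
    qed
    then show ?thesis using T_smult by blast
  qed
  ultimately show "tensor_subring n (dimension_group A) (rat_localization p) \<subseteq> ?T"
    unfolding tensor_subring_def by (intro V.generate_subgroup_incl)
  show "?T \<subseteq> tensor_subring n (dimension_group A) (rat_localization p)"
  proof
    fix v assume "v \<in> ?T"
    then obtain k where v: "v \<in> carrier_vec n" "rat_mat (A ^\<^sub>m k) *\<^sub>v v \<in> local_vec p n" by blast
    define u where "u = rat_mat (A ^\<^sub>m k) *\<^sub>v v"
    have u: "u \<in> carrier_vec n" "\<And>i. i < n \<Longrightarrow> u $ i \<in> rat_localization p" using v by (auto simp: u_def local_vec_def)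
    have "\<exists>b a. \<not> int p dvd b \<and> of_int b * u $ i = of_int a" if "i < n" for i
      using u(2)[OF that] by (elim rat_localizationE) (metis nonzero_eq_divide_eq of_int_eq_0_iff mult.commute)
    then obtain b a where ba: "\<And>i. i < n \<Longrightarrow> \<not> int p dvd b i" "\<And>i. i < n \<Longrightarrow> of_int (b i) * u $ i = of_int (a i)" by metis
    define B where "B = (\<Prod>i<n. b i)"
    have B: "\<not> int p dvd B" unfolding B_def using ba(1) p by (simp add: prime_dvd_prod_iff)
    then have B0: "B \<noteq> 0" by auto
    have "of_int B \<cdot>\<^sub>v u \<in> Z_vec n"
      unfolding B_def by (rule common_denominator[OF u(1)]) (simp add: ba(2))
    moreover have "rat_mat (A ^\<^sub>m k) *\<^sub>v (of_int B \<cdot>\<^sub>v v) = of_int B \<cdot>\<^sub>v u"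
      unfolding u_def by (rule mult_mat_vec[OF Ak v(1)])
    ultimately have "rat_mat (A ^\<^sub>m k) *\<^sub>v (of_int B \<cdot>\<^sub>v v) \<in> Z_vec n" by simp
    then have "of_int B \<cdot>\<^sub>v v \<in> dimension_group A"
      using v(1) by (auto simp: dimension_group_def inv_pow_def dim rat_pow)
    moreover have "1 / of_int B \<in> rat_localization p" using rat_localizationI[OF B, of 1] by simp
    moreover have "v = (1 / of_int B) \<cdot>\<^sub>v (of_int B \<cdot>\<^sub>v v)" using B0 by (simp add: smult_smult_assoc)
    ultimately have "v \<in> {r \<cdot>\<^sub>v g | r g. r \<in> rat_localization p \<and> g \<in> dimension_group A}" by blast
    then show "v \<in> tensor_subring n (dimension_group A) (rat_localization p)"
      unfolding tensor_subring_def by (rule generate.incl)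
  qed
qed

end

section \<open>Coordinates with respect to a lattice\<close>

text \<open>Truncation at \<open>j\<close> permits induction over the columns of a matrix, in step
  with group products over \<open>{..<j}\<close>.\<close>

definition trunc_vec :: "nat \<Rightarrow> nat \<Rightarrow> (nat \<Rightarrow> int) \<Rightarrow> rat vec" where
  "trunc_vec n j c = vec n (\<lambda>i. if i < j then of_int (c i) else 0)"

lemma trunc_vec_carrier [simp]: "trunc_vec n j c \<in> carrier_vec n"
  by (simp add: trunc_vec_def)

lemma mult_mat_trunc_vec_0:
  assumes "M \<in> carrier_mat m n" shows "M *\<^sub>v trunc_vec n 0 c = 0\<^sub>v m"
  by (rule eq_vecI) (use assms in \<open>auto simp: trunc_vec_def scalar_prod_def\<close>)

lemma mult_mat_unit_vec:
  fixes M :: "rat mat"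
  assumes "M \<in> carrier_mat m n" "j < n" shows "M *\<^sub>v unit_vec n j = col M j"
  using assms by (auto intro!: eq_vecI)

lemma mult_mat_trunc_vec_Suc:
  assumes M: "M \<in> carrier_mat m n" and j: "j < n"
  shows "M *\<^sub>v trunc_vec n (Suc j) c = M *\<^sub>v trunc_vec n j c + of_int (c j) \<cdot>\<^sub>v col M j"
proof -
  have "trunc_vec n (Suc j) c = trunc_vec n j c + of_int (c j) \<cdot>\<^sub>v unit_vec n j"
    using j by (auto simp: trunc_vec_def unit_vec_def less_Suc_eq intro!: eq_vecI)
  moreover have "M *\<^sub>v unit_vec n j = col M j" using M j by (rule mult_mat_unit_vec)
  ultimately show ?thesis
    using M mult_add_distrib_mat_vec[OF M, of "trunc_vec n j c" "of_int (c j) \<cdot>\<^sub>v unit_vec n j"]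
      mult_mat_vec[OF M, of "unit_vec n j"] by simp
qed

lemma trunc_vec_full: "trunc_vec n n c = map_vec of_int (vec n c)"
  by (auto simp: trunc_vec_def intro!: eq_vecI)

lemma rat_vec_denominator:
  fixes u :: "rat vec"
  assumes u: "u \<in> carrier_vec n" obtains d :: int where "d \<noteq> 0" "of_int d \<cdot>\<^sub>v u \<in> Z_vec n"
proof -
  have "\<exists>b::int. b \<noteq> 0 \<and> of_int b * x \<in> \<int>" for x :: rat
  proof -
    obtain c d where "x = of_int c / of_int d" "d \<noteq> 0" by (metis Fract_of_int_quotient Rat_cases less_irrefl)
    then show ?thesis by (intro exI[of _ d]) simp
  qed
  then have "\<forall>i. \<exists>b::int. b \<noteq> 0 \<and> of_int b * u $ i \<in> \<int>" by blast
  then obtain b :: "nat \<Rightarrow> int" where b: "\<And>i. b i \<noteq> 0" "\<And>i. of_int (b i) * u $ i \<in> \<int>" by metis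
  have "(\<Prod>i<n. b i) \<noteq> 0" using b(1) by simp
  then show ?thesis using that common_denominator[OF u, of b] b(2) by blast
qed

text \<open>A rational kernel vector can be scaled to a nonzero integral one.\<close>

lemma det_nonzero_if_inj_Z_vec:
  fixes P :: "rat mat"
  assumes P: "P \<in> carrier_mat n n" and inj: "\<And>z. z \<in> Z_vec n \<Longrightarrow> P *\<^sub>v z = 0\<^sub>v n \<Longrightarrow> z = 0\<^sub>v n"
  shows "det P \<noteq> 0"
proof
  assume "det P = 0"
  then obtain v where v: "v \<in> carrier_vec n" "v \<noteq> 0\<^sub>v n" "P *\<^sub>v v = 0\<^sub>v n"
    using det_0_iff_vec_prod_zero[OF P] by blast
  obtain d :: int where d: "d \<noteq> 0" "of_int d \<cdot>\<^sub>v v \<in> Z_vec n" using rat_vec_denominator[OF v(1)] by blast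
  have "P *\<^sub>v (of_int d \<cdot>\<^sub>v v) = 0\<^sub>v n" using mult_mat_vec[OF P v(1)] v(3) by auto
  then have "of_int d \<cdot>\<^sub>v v = 0\<^sub>v n" using inj d(2) by blast
  then have "v = 0\<^sub>v n" using d(1) v(1) by (auto simp: vec_eq_iff)
  then show False using v(2) by blast
qed

lemma additive_int_multiple:
  fixes f :: "int \<Rightarrow> rat vec"
  assumes f: "\<And>k. f k \<in> carrier_vec n" "\<And>k l. f (k + l) = f k + f l"
  shows "f k = of_int k \<cdot>\<^sub>v f 1"
proof -
  have step: "f (k + 1) $ i = f k $ i + f 1 $ i" if "i < n" for k i
    unfolding f(2) using carrier_vecD[OF f(1)] that by simp
  have "f 0 $ i = 0" if "i < n" for i using step[OF that, of 0] by simp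
  then have "f k $ i = of_int k * f 1 $ i" if "i < n" for i
  proof (induction k rule: int_induct[where k = 0])
    case (step1 k)
    then show ?case using step[OF that, of k] by (simp add: algebra_simps)
  next
    case (step2 k)
    then show ?case using step[OF that, of "k - 1"] by (simp add: algebra_simps)
  qed (use that in simp)
  moreover have "dim_vec (f k) = n" for k using f(1) by (rule carrier_vecD)
  ultimately show ?thesis by (intro eq_vecI) simp_all
qed

text \<open>The columns of \<open>P\<close> are the images of the free generators. They are
  independent over the integers because the isomorphism is injective, hence over the rationals after
  clearing denominators; being \<open>n\<close> in number, they make \<open>P\<close>
  invertible.\<close>

theorem lattice_basis:
  assumes L: "is_lattice n L"
  obtains P where "P \<in> carrier_mat n n" "det P \<noteq> 0" "L = (\<lambda>z. P *\<^sub>v z) ` Z_vec n"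
proof -
  let ?F = "free_Abelian_group {..<n}"
  let ?L = "(Q_vec n)\<lparr>carrier := L\<rparr>"
  have sub: "subgroup L (Q_vec n)" and iso: "?L \<cong> ?F" using L by (auto simp: is_lattice_def)
  have grp: "group ?L" using sub comm_group_vec by (intro subgroup.subgroup_is_group) (auto simp: comm_group_def)
  have Lc: "L \<subseteq> carrier_vec n" using subgroup.subset[OF sub] by (simp add: monoid_vec_simps)
  obtain \<psi> where \<psi>: "\<psi> \<in> iso ?F ?L" using group.iso_sym[OF grp iso] unfolding is_iso_def by blast
  have \<psi>_add: "\<psi> (x + y) = \<psi> x + \<psi> y" if "Poly_Mapping.keys x \<subseteq> {..<n}" "Poly_Mapping.keys y \<subseteq> {..<n}" for x y
  proof -
    have "\<psi> (x \<otimes>\<^bsub>?F\<^esub> y) = \<psi> x \<otimes>\<^bsub>?L\<^esub> \<psi> y"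
      using \<psi> that by (intro hom_mult[of \<psi> ?F ?L]) (auto simp: iso_def)
    then show ?thesis by (simp add: monoid_vec_simps)
  qed
  have bij: "bij_betw \<psi> {x. Poly_Mapping.keys x \<subseteq> {..<n}} L"
    using \<psi> by (auto simp: iso_def free_Abelian_group_def)
  have \<psi>_L: "\<psi> x \<in> L" if "Poly_Mapping.keys x \<subseteq> {..<n}" for x
    using bij that by (auto simp: bij_betw_def)
  then have \<psi>_c: "\<psi> x \<in> carrier_vec n" if "Poly_Mapping.keys x \<subseteq> {..<n}" for x using Lc that by blast
  define P where "P = mat n n (\<lambda>(i, j). \<psi> (frag_of j) $ i)"
  have P: "P \<in> carrier_mat n n" by (simp add: P_def)
  have col: "col P j = \<psi> (frag_of j)" if "j < n" for j
    using that \<psi>_c[of "frag_of j"] by (auto simp: P_def)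
  \<comment> \<open>Partial sums of a formal combination, so that \<open>\<psi>\<close> can be
    evaluated one generator at a time.\<close>
  define comb where "comb j c = (\<Sum>i<j. frag_cmul (c i) (frag_of i))" for j :: nat and c :: "nat \<Rightarrow> int"
  have lookup: "Poly_Mapping.lookup (comb j c) i = (if i < j then c i else 0)" for j c i
    by (simp add: comb_def lookup_sum if_distrib[of "\<lambda>x. _ * x"] cong: if_cong)
  have keys: "Poly_Mapping.keys (comb j c) \<subseteq> {..<j}" for j c
    using lookup by (auto simp: in_keys_iff split: if_splits)
  have keys1: "Poly_Mapping.keys (frag_cmul a (frag_of j)) \<subseteq> {..<n}" if "j < n" for a and j :: nat
    using that by auto
  have cmul: "\<psi> (frag_cmul a (frag_of j)) = of_int a \<cdot>\<^sub>v col P j" if j: "j < n" for a j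
  proof -
    have "\<psi> (frag_cmul a (frag_of j)) = of_int a \<cdot>\<^sub>v \<psi> (frag_cmul 1 (frag_of j))"
    proof (rule additive_int_multiple)
      show "\<psi> (frag_cmul k (frag_of j)) \<in> carrier_vec n" for k by (rule \<psi>_c[OF keys1[OF j]])
      show "\<psi> (frag_cmul (k + l) (frag_of j)) = \<psi> (frag_cmul k (frag_of j)) + \<psi> (frag_cmul l (frag_of j))" for k l
        unfolding frag_cmul_distrib by (rule \<psi>_add[OF keys1[OF j] keys1[OF j]])
    qed
    then show ?thesis using col[OF j] by simp
  qed
  have \<psi>0: "\<psi> 0 = 0\<^sub>v n"
  proof -
    have "\<psi> 0 = \<psi> 0 + \<psi> 0" using \<psi>_add[of 0 0] by simp
    then show ?thesis using \<psi>_c[of 0] by (auto simp: vec_eq_iff)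
  qed
  have comb: "\<psi> (comb j c) = P *\<^sub>v trunc_vec n j c" if "j \<le> n" for j c
    using that
  proof (induction j)
    case 0
    then show ?case by (simp add: comb_def \<psi>0 mult_mat_trunc_vec_0[OF P])
  next
    case (Suc j)
    have "\<psi> (comb (Suc j) c) = \<psi> (comb j c + frag_cmul (c j) (frag_of j))" by (simp add: comb_def)
    also have "\<dots> = \<psi> (comb j c) + \<psi> (frag_cmul (c j) (frag_of j))"
      using keys[of j c] Suc.prems by (intro \<psi>_add keys1) auto
    finally show ?case using Suc cmul[of j "c j"] by (simp add: mult_mat_trunc_vec_Suc[OF P])
  qed
  have Z: "z \<in> Z_vec n \<longleftrightarrow> (\<exists>c. z = trunc_vec n n c)" for z
  proof
    assume "z \<in> Z_vec n"
    then obtain u where "u \<in> carrier_vec n" "z = map_vec of_int u" by (auto simp: Z_vec_def)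
    then have "z = trunc_vec n n (\<lambda>i. u $ i)" by (auto simp: trunc_vec_def intro!: eq_vecI)
    then show "\<exists>c. z = trunc_vec n n c" by blast
  qed (auto simp: trunc_vec_def Z_vec_iff)
  have "L = (\<lambda>z. P *\<^sub>v z) ` Z_vec n"
  proof (intro equalityI subsetI)
    fix v assume "v \<in> L"
    then obtain x where x: "Poly_Mapping.keys x \<subseteq> {..<n}" "v = \<psi> x" using bij by (auto simp: bij_betw_def)
    have "x = comb n (Poly_Mapping.lookup x)"
      by (rule poly_mapping_eqI) (use x(1) in \<open>auto simp: lookup in_keys_iff subset_iff\<close>)
    then have "v = P *\<^sub>v trunc_vec n n (Poly_Mapping.lookup x)" using comb[of n "Poly_Mapping.lookup x"] x(2) by simp
    then show "v \<in> (\<lambda>z. P *\<^sub>v z) ` Z_vec n" using Z by blast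
  next
    fix v assume "v \<in> (\<lambda>z. P *\<^sub>v z) ` Z_vec n"
    then obtain c where "v = P *\<^sub>v trunc_vec n n c" using Z by auto
    then have "v = \<psi> (comb n c)" using comb[of n c] by simp
    then show "v \<in> L" using \<psi>_L[OF keys[of n c]] by simp
  qed
  moreover have "det P \<noteq> 0"
  proof (rule det_nonzero_if_inj_Z_vec[OF P])
    fix z assume z: "z \<in> Z_vec n" "P *\<^sub>v z = 0\<^sub>v n"
    then obtain c where c: "z = trunc_vec n n c" using Z by blast
    then have "\<psi> (comb n c) = \<psi> 0" using comb[of n c] z(2) \<psi>0 by simp
    then have "comb n c = 0"
      using inj_onD[OF bij_betw_imp_inj_on[OF bij]] keys[of n c] by simp
    then have "c i = 0" if "i < n" for i using lookup[of n c i] that by simp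
    then show "z = 0\<^sub>v n" unfolding c trunc_vec_def by (auto intro!: eq_vecI)
  qed
  ultimately show ?thesis using that P by blast
qed

lemma invertible_rat_mat:
  fixes P :: "rat mat"
  assumes P: "P \<in> carrier_mat n n" and det: "det P \<noteq> 0"
  obtains R where "R \<in> carrier_mat n n" "P * R = 1\<^sub>m n" "R * P = 1\<^sub>m n"
proof -
  let ?R = "(1 / det P) \<cdot>\<^sub>m adj_mat P"
  have "P * ?R = (1 / det P) \<cdot>\<^sub>m (P * adj_mat P)"
    using adj_mat(1)[OF P] by (intro mult_smult_distrib[OF P])
  also have "\<dots> = 1\<^sub>m n" unfolding adj_mat(2)[OF P] using det by (intro eq_matI) auto
  finally have 1: "P * ?R = 1\<^sub>m n" .
  have "?R * P = (1 / det P) \<cdot>\<^sub>m (adj_mat P * P)"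
    by (intro mult_smult_assoc_mat[OF adj_mat(1)[OF P] P])
  also have "\<dots> = 1\<^sub>m n" unfolding adj_mat(3)[OF P] using det by (intro eq_matI) auto
  finally have 2: "?R * P = 1\<^sub>m n" .
  show ?thesis using that[of ?R] 1 2 adj_mat(1)[OF P] by simp
qed

text \<open>Invariance of the lattice means that conjugating \<open>A\<close> by \<open>P\<close>
  gives integer entries: the columns of \<open>B\<close> are the coordinates of the images of the
  basis vectors. Similarity holds over the rationals, and the embedding of the integers is injective
  on polynomials.\<close>

lemma invariant_lattice_matrix:
  fixes P :: "rat mat"
  assumes A: "A \<in> carrier_mat n n" and P: "P \<in> carrier_mat n n" "det P \<noteq> 0"
    and inv: "\<And>z. z \<in> Z_vec n \<Longrightarrow> rat_mat A *\<^sub>v (P *\<^sub>v z) \<in> (\<lambda>z. P *\<^sub>v z) ` Z_vec n"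
  obtains B where "B \<in> carrier_mat n n" "rat_mat A * P = P * rat_mat B"
    "char_poly A = char_poly B" "det A = det B"
proof -
  have "\<exists>z. z \<in> carrier_vec n \<and> rat_mat A *\<^sub>v col P j = P *\<^sub>v map_vec of_int z" if j: "j < n" for j
  proof -
    have "unit_vec n j \<in> Z_vec n" using j by (simp add: Z_vec_iff unit_vec_def)
    then have "rat_mat A *\<^sub>v (P *\<^sub>v unit_vec n j) \<in> (\<lambda>z. P *\<^sub>v z) ` Z_vec n" by (rule inv)
    then show ?thesis unfolding mult_mat_unit_vec[OF P(1) j] Z_vec_def by blast
  qed
  then obtain z where z: "\<And>j. j < n \<Longrightarrow> z j \<in> carrier_vec n"
    "\<And>j. j < n \<Longrightarrow> rat_mat A *\<^sub>v col P j = P *\<^sub>v map_vec of_int (z j)" by metis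
  define B where "B = mat n n (\<lambda>(i, j). z j $ i)"
  have B: "B \<in> carrier_mat n n" by (simp add: B_def)
  have rA: "rat_mat A \<in> carrier_mat n n" and rB: "rat_mat B \<in> carrier_mat n n" using A B by auto
  have eq: "rat_mat A * P = P * rat_mat B"
  proof (rule mat_col_eqI)
    fix j assume "j < dim_col (P * rat_mat B)"
    then have j: "j < n" using B by simp
    have "col (rat_mat B) j = map_vec of_int (z j)" using z(1)[OF j] j by (auto simp: B_def)
    then show "col (rat_mat A * P) j = col (P * rat_mat B) j"
      using z(2)[OF j] col_mult2[OF rA P(1) j] col_mult2[OF P(1) rB j] by simp
  qed (use A P B in auto)
  obtain R where R: "R \<in> carrier_mat n n" "P * R = 1\<^sub>m n" "R * P = 1\<^sub>m n"
    using invertible_rat_mat[OF P] by blast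
  have "rat_mat A = rat_mat A * (P * R)" using rA R by simp
  also have "\<dots> = rat_mat A * P * R" using rA P(1) R(1) by (rule assoc_mult_mat[symmetric])
  finally have "rat_mat A = P * rat_mat B * R" unfolding eq .
  then have sim: "similar_mat (rat_mat A) (rat_mat B)"
    using rA rB P R by (intro similar_matI[of _ _ P R n]) auto
  have "map_poly rat_of_int (char_poly A) = map_poly rat_of_int (char_poly B)"
    using char_poly_similar[OF sim] by (simp add: of_int_hom.char_poly_hom[OF A] of_int_hom.char_poly_hom[OF B])
  then have "char_poly A = char_poly B" by (simp add: poly_eq_iff coeff_map_poly)
  moreover have "det A = det B" using det_similar[OF sim] by simp
  ultimately show ?thesis using that B eq by blast
qed

text \<open>\<open>charpoly_coeff\<close> counts from the leading term and \<open>low_order\<close>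
  from the constant one, so the largest index corresponds to the least exponent by reflection in
  \<open>n\<close>.\<close>

lemma pruefer_rank_low_order:
  assumes A: "A \<in> carrier_mat n n" and p: "prime p"
  shows "pruefer_rank A p = low_order (int p) (char_poly A)"
proof -
  define l where "l = low_order (int p) (char_poly A)"
  have monic: "\<not> int p dvd coeff (char_poly A) n"
    using degree_monic_char_poly[OF A] p by (simp add: prime_nat_iff)
  have l: "\<not> int p dvd coeff (char_poly A) l" "l \<le> n"
    unfolding l_def low_order_def using monic by (rule LeastI, rule Least_le)
  have "last_unit_index A p = n - l"
    unfolding last_unit_index_def
  proof (rule Greatest_equality)
    show "n - l \<le> dim_row A \<and> \<not> int p dvd charpoly_coeff A (n - l)"
      using l A by (simp add: charpoly_coeff_def)
    fix j assume "j \<le> dim_row A \<and> \<not> int p dvd charpoly_coeff A j"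
    then have "\<not> int p dvd coeff (char_poly A) (n - j)" "j \<le> n" using A by (auto simp: charpoly_coeff_def)
    then have "l \<le> n - j" unfolding l_def low_order_def by (intro Least_le)
    then show "j \<le> n - l" using \<open>j \<le> n\<close> l(2) by simp
  qed
  then show ?thesis using l(2) A by (simp add: pruefer_rank_def l_def)
qed

section \<open>The quotient of the dimension group by a lattice\<close>

text \<open>The dimension group as it appears in lattice coordinates; for \<open>A\<close> itself it
  is \<open>dimension_group A\<close>.\<close>

definition eventual_lattice :: "int mat \<Rightarrow> nat \<Rightarrow> rat vec set" where
  "eventual_lattice B n = {u \<in> carrier_vec n. \<exists>k. rat_mat (B ^\<^sub>m k) *\<^sub>v u \<in> Z_vec n}"

context
  fixes B :: "int mat" and n :: nat
  assumes B: "B \<in> carrier_mat n n"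
begin

lemma rat_pow_carrier: "rat_mat (B ^\<^sub>m k) \<in> carrier_mat n n"
  using B by simp

lemma eventual_lattice_carrier: "u \<in> eventual_lattice B n \<Longrightarrow> u \<in> carrier_vec n"
  by (simp add: eventual_lattice_def)

lemma eventual_lattice_mono:
  assumes "u \<in> carrier_vec n" "rat_mat (B ^\<^sub>m k) *\<^sub>v u \<in> Z_vec n" "k \<le> l"
  shows "rat_mat (B ^\<^sub>m l) *\<^sub>v u \<in> Z_vec n"
proof -
  have "rat_mat (B ^\<^sub>m ((l - k) + k)) *\<^sub>v u \<in> Z_vec n"
    unfolding rat_mat_pow_vec_add[OF B assms(1)] by (rule Z_vec_mult_mat[OF pow_carrier_mat[OF B] assms(2)])
  then show ?thesis using assms(3) by simp
qed

lemma eventual_lattice_add: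
  assumes "u \<in> eventual_lattice B n" "v \<in> eventual_lattice B n"
  shows "u + v \<in> eventual_lattice B n"
proof -
  obtain k l where uv: "u \<in> carrier_vec n" "v \<in> carrier_vec n"
    and k: "rat_mat (B ^\<^sub>m k) *\<^sub>v u \<in> Z_vec n" and l: "rat_mat (B ^\<^sub>m l) *\<^sub>v v \<in> Z_vec n"
    using assms by (auto simp: eventual_lattice_def)
  have "rat_mat (B ^\<^sub>m (k + l)) *\<^sub>v u \<in> Z_vec n" "rat_mat (B ^\<^sub>m (k + l)) *\<^sub>v v \<in> Z_vec n"
    using eventual_lattice_mono[OF uv(1) k] eventual_lattice_mono[OF uv(2) l] by simp_all
  then have "rat_mat (B ^\<^sub>m (k + l)) *\<^sub>v (u + v) \<in> Z_vec n"
    unfolding mult_add_distrib_mat_vec[OF rat_pow_carrier uv] by (rule Z_vec_add)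
  then show ?thesis using uv by (auto simp: eventual_lattice_def)
qed

lemma eventual_lattice_smult:
  assumes "u \<in> eventual_lattice B n" shows "of_int m \<cdot>\<^sub>v u \<in> eventual_lattice B n"
proof -
  obtain k where u: "u \<in> carrier_vec n" and k: "rat_mat (B ^\<^sub>m k) *\<^sub>v u \<in> Z_vec n"
    using assms by (auto simp: eventual_lattice_def)
  have "rat_mat (B ^\<^sub>m k) *\<^sub>v (of_int m \<cdot>\<^sub>v u) \<in> Z_vec n"
    unfolding mult_mat_vec[OF rat_pow_carrier u] by (rule Z_vec_smult[OF k])
  then show ?thesis using u by (auto simp: eventual_lattice_def)
qed

lemma Z_vec_subset_eventual_lattice: "Z_vec n \<subseteq> eventual_lattice B n"
proof
  fix u :: "rat vec" assume u: "u \<in> Z_vec n"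
  then have "rat_mat (B ^\<^sub>m 0) *\<^sub>v u \<in> Z_vec n" by (rule Z_vec_mult_mat[OF pow_carrier_mat[OF B]])
  then show "u \<in> eventual_lattice B n" using Z_vec_carrier[OF u] unfolding eventual_lattice_def by blast
qed

text \<open>The adjugate of a power of \<open>B\<close> that makes \<open>u\<close> integral shows
  that a power of \<open>det B\<close> clears the denominators of \<open>u\<close>.\<close>

lemma eventual_lattice_torsion:
  assumes det: "det B \<noteq> 0" and u: "u \<in> eventual_lattice B n"
  shows "\<exists>d>0. of_int d \<cdot>\<^sub>v u \<in> Z_vec n \<and> (\<forall>p. prime p \<longrightarrow> int p dvd d \<longrightarrow> int p dvd det B)"
proof -
  obtain k where u: "u \<in> carrier_vec n" and k: "rat_mat (B ^\<^sub>m k) *\<^sub>v u \<in> Z_vec n"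
    using u by (auto simp: eventual_lattice_def)
  have det_pow: "det (B ^\<^sub>m k) = det B ^ k" for k
  proof (induction k)
    case (Suc k)
    then show ?case using det_mult[OF pow_carrier_mat[OF B] B] by simp
  qed (use B in simp)
  define M where "M = B ^\<^sub>m k"
  have M: "M \<in> carrier_mat n n" using B by (simp add: M_def)
  have "rat_mat (adj_mat M) *\<^sub>v (rat_mat M *\<^sub>v u) = (rat_mat (adj_mat M) * rat_mat M) *\<^sub>v u"
    using adj_mat(1)[OF M] M u by (intro assoc_mult_mat_vec[symmetric]) auto
  also have "rat_mat (adj_mat M) * rat_mat M = rat_mat (det M \<cdot>\<^sub>m 1\<^sub>m n)"
    unfolding of_int_hom.mat_hom_mult[OF adj_mat(1)[OF M] M, symmetric] adj_mat(3)[OF M] ..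
  also have "rat_mat (det M \<cdot>\<^sub>m 1\<^sub>m n) = of_int (det M) \<cdot>\<^sub>m 1\<^sub>m n" by (rule eq_matI) auto
  also have "(of_int (det M) \<cdot>\<^sub>m 1\<^sub>m n) *\<^sub>v u = of_int (det M) \<cdot>\<^sub>v u"
    using u by (auto intro!: eq_vecI)
  finally have "of_int (det M) \<cdot>\<^sub>v u \<in> Z_vec n"
    using Z_vec_mult_mat[OF adj_mat(1)[OF M] k[folded M_def]] by simp
  \<comment> \<open>\<open>det M\<close> may be negative; its square is positive and has the same
    prime factors.\<close>
  then have "of_int (det M) \<cdot>\<^sub>v (of_int (det M) \<cdot>\<^sub>v u) \<in> Z_vec n" by (rule Z_vec_smult)
  then have "of_int (det M * det M) \<cdot>\<^sub>v u \<in> Z_vec n" by (simp add: smult_smult_assoc)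
  moreover have "det M * det M > 0"
  proof -
    have "det M \<noteq> 0" using det by (simp add: M_def det_pow)
    then show ?thesis by (auto simp: zero_less_mult_iff)
  qed
  moreover have "int p dvd det B" if "prime p" "int p dvd det M * det M" for p
  proof -
    have pp: "prime (int p)" using that(1) by simp
    have "int p dvd det B ^ k" using that(2) pp by (auto simp: M_def det_pow prime_dvd_mult_iff)
    then show ?thesis using pp prime_dvd_power by blast
  qed
  ultimately show ?thesis by blast
qed

text \<open>If \<open>F = B\<^sup>e\<close> is idempotent modulo a multiple of the denominator of \<open>u / p\<close> and \<open>F u\<close> is
  integral, then \<open>(1 - F) (u / p)\<close> is a \<open>p\<close>-th root of \<open>u\<close> modulo \<open>\<int>\<^sup>n\<close> on which \<open>B\<close> is eventually
  integral.\<close>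

lemma eventual_lattice_divisible:
  assumes p: "p > 0" and u: "u \<in> eventual_lattice B n" and pu: "of_int (int p ^ a) \<cdot>\<^sub>v u \<in> Z_vec n"
  shows "\<exists>w\<in>eventual_lattice B n. \<exists>t\<in>Z_vec n. of_int (int p) \<cdot>\<^sub>v w = u + t"
proof -
  obtain k where uc: "u \<in> carrier_vec n" and k: "rat_mat (B ^\<^sub>m k) *\<^sub>v u \<in> Z_vec n"
    using u by (auto simp: eventual_lattice_def)
  \<comment> \<open>One factor \<open>p\<close> more than for \<open>u\<close>, since the
    denominators of \<open>z = u / p\<close> have to be cleared.\<close>
  define q where "q = int p ^ Suc a"
  obtain i where i: "i \<ge> 1" "cong_mat q (B ^\<^sub>m i * B ^\<^sub>m i) (B ^\<^sub>m i)"
    using idempotent_power_exists[OF B, of q] p by (auto simp: q_def)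
  \<comment> \<open>A multiple of the idempotent exponent \<open>i\<close>, taken at least
    \<open>k\<close> so that \<open>F u\<close> is integral.\<close>
  define e where "e = i * Suc k"
  have ke: "k \<le> e" using mult_le_mono[OF i(1), of k "Suc k"] by (simp add: e_def)
  define z where "z = (1 / of_int (int p)) \<cdot>\<^sub>v u"
  have z: "z \<in> carrier_vec n" using uc by (simp add: z_def)
  have pz: "of_int (int p) \<cdot>\<^sub>v z = u" using p by (simp add: z_def smult_smult_assoc)
  have "of_int q \<cdot>\<^sub>v z = of_int (int p ^ a) \<cdot>\<^sub>v (of_int (int p) \<cdot>\<^sub>v z)"
    by (simp add: q_def smult_smult_assoc mult.commute)
  then have qz: "of_int q \<cdot>\<^sub>v z \<in> Z_vec n" using pu by (simp only: pz)
  define F where "F = B ^\<^sub>m e"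
  have F: "F \<in> carrier_mat n n" using B by (simp add: F_def)
  have Fz: "rat_mat F *\<^sub>v z \<in> carrier_vec n" using F z by (intro mult_mat_vec_carrier) auto
  have Fu: "rat_mat F *\<^sub>v u \<in> Z_vec n" unfolding F_def by (rule eventual_lattice_mono[OF uc k ke])
  define w where "w = z + (- 1) \<cdot>\<^sub>v (rat_mat F *\<^sub>v z)"
  have w: "w \<in> carrier_vec n" using z Fz by (simp add: w_def)
  have "of_int (int p) \<cdot>\<^sub>v w = u + of_int (- 1) \<cdot>\<^sub>v (rat_mat F *\<^sub>v u)"
  proof -
    have "rat_mat F *\<^sub>v u = of_int (int p) \<cdot>\<^sub>v (rat_mat F *\<^sub>v z)"
      using mult_mat_vec[of "rat_mat F" n n z "of_int (int p)"] F z pz by simp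
    then show ?thesis unfolding w_def using z Fz pz[symmetric]
      by (simp add: smult_add_distrib_vec smult_smult_assoc)
  qed
  moreover have "of_int (- 1) \<cdot>\<^sub>v (rat_mat F *\<^sub>v u) \<in> Z_vec n" by (rule Z_vec_smult[OF Fu])
  moreover have "w \<in> eventual_lattice B n"
  proof -
    \<comment> \<open>As \<open>i + e\<close> is again a multiple of \<open>i\<close>, the matrix
      \<open>B ^\<^sub>m i\<close> does not distinguish \<open>z\<close> from \<open>F z\<close>
      modulo integer vectors, so it makes \<open>w\<close> integral.\<close>
    have c1: "cong_mat q (B ^\<^sub>m i) (B ^\<^sub>m (i + e))"
      using cong_mat_sym[OF idempotent_pow[OF B i(2), of "Suc k"]] by (simp add: e_def)
    obtain T where T: "T \<in> carrier_mat n n"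
      "rat_mat (B ^\<^sub>m i) *\<^sub>v z = rat_mat (B ^\<^sub>m (i + e)) *\<^sub>v z + rat_mat T *\<^sub>v (of_int q \<cdot>\<^sub>v z)"
      using cong_mat_mult_vec[OF pow_carrier_mat[OF B] c1 z] by blast
    have x: "rat_mat (B ^\<^sub>m (i + e)) *\<^sub>v z \<in> carrier_vec n" "rat_mat T *\<^sub>v (of_int q \<cdot>\<^sub>v z) \<in> carrier_vec n"
      using T(1) z rat_pow_carrier by (auto intro!: mult_mat_vec_carrier[of _ n n])
    have "rat_mat (B ^\<^sub>m i) *\<^sub>v w
        = rat_mat (B ^\<^sub>m i) *\<^sub>v z + (- 1) \<cdot>\<^sub>v (rat_mat (B ^\<^sub>m i) *\<^sub>v (rat_mat F *\<^sub>v z))"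
      unfolding w_def using z Fz
      by (simp add: mult_add_distrib_mat_vec[OF rat_pow_carrier] mult_mat_vec[OF rat_pow_carrier])
    also have "rat_mat (B ^\<^sub>m i) *\<^sub>v (rat_mat F *\<^sub>v z) = rat_mat (B ^\<^sub>m (i + e)) *\<^sub>v z"
      unfolding F_def by (rule rat_mat_pow_vec_add[OF B z, symmetric])
    also have "rat_mat (B ^\<^sub>m i) *\<^sub>v z + (- 1) \<cdot>\<^sub>v (rat_mat (B ^\<^sub>m (i + e)) *\<^sub>v z) = rat_mat T *\<^sub>v (of_int q \<cdot>\<^sub>v z)"
      unfolding T(2) using carrier_vecD[OF x(1)] carrier_vecD[OF x(2)] by (intro eq_vecI) simp_all
    finally have "rat_mat (B ^\<^sub>m i) *\<^sub>v w \<in> Z_vec n" using Z_vec_mult_mat[OF T(1) qz] by simp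
    then show ?thesis using w by (auto simp: eventual_lattice_def)
  qed
  ultimately show ?thesis by blast
qed

text \<open>For an integer vector \<open>x\<close>, the quotient \<open>x / p\<close> lies in
  \<open>eventual_lattice B n\<close> exactly if some power of \<open>B\<close> kills
  \<open>x\<close> modulo \<open>p\<close>, and its class modulo integer vectors depends only on
  \<open>x\<close> modulo \<open>p\<close>. Division by \<open>p\<close> thus carries a basis of the
  generalized kernel to one of the socle.\<close>

definition socle_basis :: "nat \<Rightarrow> rat mat" where
  "socle_basis p = (1 / of_nat p) \<cdot>\<^sub>m rat_mat (SOME C. generalized_kernel_basis (int p) B C)"

lemma cong_vec_iff_Z_vec:
  assumes "p > 0" "x \<in> carrier_vec n" "y \<in> carrier_vec n"
  shows "cong_vec (int p) x y \<longleftrightarrow>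
    (1 / of_nat p) \<cdot>\<^sub>v map_vec rat_of_int x + (- 1 / of_nat p) \<cdot>\<^sub>v map_vec rat_of_int y \<in> Z_vec n"
proof -
  have "int p dvd a \<longleftrightarrow> (of_int a / of_nat p :: rat) \<in> \<int>" for a
    using assms(1) of_int_div_of_int_in_Ints_iff[of a "int p", where 'a = rat] by simp
  then have "int p dvd x $ i - y $ i \<longleftrightarrow> (of_int (x $ i - y $ i) / of_nat p :: rat) \<in> \<int>" for i .
  moreover have "((1 / of_nat p) \<cdot>\<^sub>v map_vec rat_of_int x + (- 1 / of_nat p) \<cdot>\<^sub>v map_vec rat_of_int y) $ i
      = (of_int (x $ i - y $ i) / of_nat p :: rat)" if "i < n" for i
    using assms that by (simp add: diff_divide_distrib)
  ultimately show ?thesis using assms unfolding cong_vec_def Z_vec_iff by auto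
qed

lemma socle_basis:
  assumes p: "prime p"
  defines "k \<equiv> low_order (int p) (char_poly B)"
  shows "socle_basis p \<in> carrier_mat n k"
    and "\<And>i. i < k \<Longrightarrow> col (socle_basis p) i \<in> eventual_lattice B n"
    and "\<And>i. i < k \<Longrightarrow> of_int (int p) \<cdot>\<^sub>v col (socle_basis p) i \<in> Z_vec n"
    and "\<And>u. u \<in> eventual_lattice B n \<Longrightarrow> of_int (int p) \<cdot>\<^sub>v u \<in> Z_vec n \<Longrightarrow>
      \<exists>c. \<exists>t\<in>Z_vec n. u = socle_basis p *\<^sub>v trunc_vec k k c + t"
    and "\<And>c i. socle_basis p *\<^sub>v trunc_vec k k c \<in> Z_vec n \<Longrightarrow> i < k \<Longrightarrow> int p dvd c i"
proof -
  have p0: "p > 0" using prime_gt_0_nat[OF p] .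
  define C where "C = (SOME C. generalized_kernel_basis (int p) B C)"
  have pp: "prime (int p)" using p by simp
  have gk: "generalized_kernel_basis (int p) B C"
    unfolding C_def by (rule someI_ex[OF generalized_kernel_mod_prime[OF pp B]])
  have dim: "dim_row B = n" using B by simp
  have C: "C \<in> carrier_mat n k"
    using gk unfolding generalized_kernel_basis_def dim k_def by blast
  then have dimC: "dim_col C = k" by simp
  have kernel: "\<And>x. x \<in> carrier_vec n \<Longrightarrow> (\<exists>m. cong_vec (int p) (B ^\<^sub>m m *\<^sub>v x) (0\<^sub>v n)) \<longleftrightarrow>
        (\<exists>c\<in>carrier_vec k. cong_vec (int p) x (C *\<^sub>v c))"
    and indep: "\<And>c. c \<in> carrier_vec k \<Longrightarrow> cong_vec (int p) (C *\<^sub>v c) (0\<^sub>v n) \<Longrightarrow> cong_vec (int p) c (0\<^sub>v k)"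
    using gk unfolding generalized_kernel_basis_def dim dimC k_def[symmetric] by blast+
  have M: "socle_basis p = (1 / of_nat p) \<cdot>\<^sub>m rat_mat C" by (simp add: socle_basis_def C_def)
  show Mc: "socle_basis p \<in> carrier_mat n k" using C by (simp add: M)
  have mult: "socle_basis p *\<^sub>v map_vec rat_of_int c = (1 / of_nat p) \<cdot>\<^sub>v map_vec rat_of_int (C *\<^sub>v c)"
    if "c \<in> carrier_vec k" for c
    unfolding M of_int_hom.mult_mat_vec_hom[OF C that] using C that by (auto intro!: eq_vecI)
  have Z_iff: "(1 / of_nat p) \<cdot>\<^sub>v map_vec rat_of_int x \<in> Z_vec n \<longleftrightarrow> cong_vec (int p) x (0\<^sub>v n)"
    if "x \<in> carrier_vec n" for x
  proof -
    have "(1 / of_nat p) \<cdot>\<^sub>v map_vec rat_of_int x + (- 1 / of_nat p) \<cdot>\<^sub>v map_vec rat_of_int (0\<^sub>v n :: int vec)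
        = ((1 / of_nat p) \<cdot>\<^sub>v map_vec rat_of_int x :: rat vec)"
      using that by (intro eq_vecI) auto
    then show ?thesis using cong_vec_iff_Z_vec[OF p0 that, of "0\<^sub>v n"] by simp
  qed
  have lattice_iff: "(1 / of_nat p) \<cdot>\<^sub>v map_vec rat_of_int x \<in> eventual_lattice B n \<longleftrightarrow>
      (\<exists>m. cong_vec (int p) (B ^\<^sub>m m *\<^sub>v x) (0\<^sub>v n))" if x: "x \<in> carrier_vec n" for x
  proof -
    have "rat_mat (B ^\<^sub>m m) *\<^sub>v ((1 / of_nat p) \<cdot>\<^sub>v map_vec rat_of_int x)
        = (1 / of_nat p) \<cdot>\<^sub>v map_vec rat_of_int (B ^\<^sub>m m *\<^sub>v x)" for m
      unfolding of_int_hom.mult_mat_vec_hom[OF pow_carrier_mat[OF B] x]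
      using x by (intro mult_mat_vec[OF rat_pow_carrier]) simp
    moreover have "B ^\<^sub>m m *\<^sub>v x \<in> carrier_vec n" for m
      using pow_carrier_mat[OF B] x by (rule mult_mat_vec_carrier)
    ultimately show ?thesis using Z_iff x by (simp add: eventual_lattice_def)
  qed
  have Cc: "C *\<^sub>v c \<in> carrier_vec n" if "c \<in> carrier_vec k" for c
    using C that by (rule mult_mat_vec_carrier)
  have span_mem: "socle_basis p *\<^sub>v map_vec rat_of_int c \<in> eventual_lattice B n" if c: "c \<in> carrier_vec k" for c
    unfolding mult[OF c] lattice_iff[OF Cc[OF c]] kernel[OF Cc[OF c]] using c cong_vec_refl by blast
  have col: "col (socle_basis p) i = socle_basis p *\<^sub>v map_vec rat_of_int (unit_vec k i)" if "i < k" for i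
  proof -
    have "map_vec rat_of_int (unit_vec k i) = unit_vec k i" by (auto simp: unit_vec_def intro!: eq_vecI)
    then show ?thesis using mult_mat_unit_vec[OF Mc that] by simp
  qed
  show "col (socle_basis p) i \<in> eventual_lattice B n" if "i < k" for i
    unfolding col[OF that] by (rule span_mem) simp
  show "of_int (int p) \<cdot>\<^sub>v col (socle_basis p) i \<in> Z_vec n" if "i < k" for i
  proof -
    have "of_int (int p) \<cdot>\<^sub>v col (socle_basis p) i = map_vec rat_of_int (C *\<^sub>v unit_vec k i)"
      unfolding col[OF that] mult[OF unit_vec_carrier] using p0 by (simp add: smult_smult_assoc)
    then show ?thesis using Cc[of "unit_vec k i"] by (simp add: Z_vec_def)
  qed
  show "\<exists>c. \<exists>t\<in>Z_vec n. u = socle_basis p *\<^sub>v trunc_vec k k c + t"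
    if u: "u \<in> eventual_lattice B n" and pu: "of_int (int p) \<cdot>\<^sub>v u \<in> Z_vec n" for u
  proof -
    have uc: "u \<in> carrier_vec n" using u by (rule eventual_lattice_carrier)
    obtain x where x: "x \<in> carrier_vec n" "of_int (int p) \<cdot>\<^sub>v u = map_vec rat_of_int x"
      using pu by (auto simp: Z_vec_def)
    have ux: "u = (1 / of_nat p) \<cdot>\<^sub>v map_vec rat_of_int x"
      unfolding x(2)[symmetric] using p0 by (simp add: smult_smult_assoc)
    obtain c where c: "c \<in> carrier_vec k" "cong_vec (int p) x (C *\<^sub>v c)"
      using u kernel[OF x(1)] unfolding ux lattice_iff[OF x(1)] by blast
    define t where "t = (1 / of_nat p) \<cdot>\<^sub>v map_vec rat_of_int x + (- 1 / of_nat p) \<cdot>\<^sub>v map_vec rat_of_int (C *\<^sub>v c)"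
    have t: "t \<in> Z_vec n" using c(2) cong_vec_iff_Z_vec[OF p0 x(1) Cc[OF c(1)]] by (simp add: t_def)
    have tr: "trunc_vec k k (\<lambda>i. c $ i) = map_vec rat_of_int c"
      using c(1) by (auto simp: trunc_vec_def intro!: eq_vecI)
    have "u = socle_basis p *\<^sub>v map_vec rat_of_int c + t"
      unfolding mult[OF c(1)] ux t_def
      using carrier_vecD[OF x(1)] carrier_vecD[OF Cc[OF c(1)]] by (intro eq_vecI) simp_all
    then show ?thesis using t unfolding tr[symmetric] by blast
  qed
  show "int p dvd c i" if *: "socle_basis p *\<^sub>v trunc_vec k k c \<in> Z_vec n" and i: "i < k" for c i
  proof -
    have "cong_vec (int p) (C *\<^sub>v vec k c) (0\<^sub>v n)"
      using * unfolding trunc_vec_full mult[OF vec_carrier] Z_iff[OF Cc[OF vec_carrier]] .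
    then have "cong_vec (int p) (vec k c) (0\<^sub>v k)" by (rule indep[OF vec_carrier])
    then show ?thesis using i by (simp add: cong_vec_def)
  qed
qed

end

section \<open>Additive maps from vectors to a multiplicative abelian group\<close>

lemma (in comm_group) hom_smult_int:
  assumes W: "\<And>u v. u \<in> W \<Longrightarrow> v \<in> W \<Longrightarrow> u + v \<in> W" "\<And>u m. u \<in> W \<Longrightarrow> of_int m \<cdot>\<^sub>v u \<in> W" "W \<subseteq> carrier_vec n"
    and q: "\<And>u. u \<in> W \<Longrightarrow> q u \<in> carrier G" "\<And>u v. u \<in> W \<Longrightarrow> v \<in> W \<Longrightarrow> q (u + v) = q u \<otimes> q v"
      "q (0\<^sub>v n) = \<one>" and u: "u \<in> W"
  shows "q (of_int m \<cdot>\<^sub>v u) = q u [^] (m::int)"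
proof -
  have uc: "u \<in> carrier_vec n" using W(3) u by blast
  have step: "q (of_int (m + 1) \<cdot>\<^sub>v u) = q (of_int m \<cdot>\<^sub>v u) \<otimes> q u" for m
  proof -
    have "of_int (m + 1) \<cdot>\<^sub>v u = of_int m \<cdot>\<^sub>v u + u"
      using uc by (intro eq_vecI) (simp_all add: algebra_simps)
    then show ?thesis using q(2)[OF W(2)[OF u] u] by simp
  qed
  show ?thesis
  proof (induction m rule: int_induct[where k = 0])
    case base
    have "of_int 0 \<cdot>\<^sub>v u = 0\<^sub>v n" using uc by (intro eq_vecI) simp_all
    then show ?case using q(3) by simp
  next
    case (step1 m)
    then show ?case using step[of m] int_pow_mult[OF q(1)[OF u], of m 1] q(1)[OF u] by simp
  next
    case (step2 m)
    have "q u [^] m = q (of_int (m - 1) \<cdot>\<^sub>v u) \<otimes> q u" using step[of "m - 1"] step2 by simp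
    also have "q u [^] m = q u [^] (m - 1) \<otimes> q u"
      using int_pow_mult[OF q(1)[OF u], of "m - 1" 1] q(1)[OF u] by simp
    finally show ?case using q(1)[OF u] q(1)[OF W(2)[OF u]] by (metis int_pow_closed right_cancel)
  qed
qed

text \<open>Integer combinations of columns become products of powers, the form in which
  \<open>pruefer_coordinates\<close> expresses span and independence.\<close>

lemma (in comm_group) hom_mult_trunc_vec:
  assumes W: "\<And>u v. u \<in> W \<Longrightarrow> v \<in> W \<Longrightarrow> u + v \<in> W" "\<And>u m. u \<in> W \<Longrightarrow> of_int m \<cdot>\<^sub>v u \<in> W" "W \<subseteq> carrier_vec n"
      "0\<^sub>v n \<in> W"
    and q: "\<And>u. u \<in> W \<Longrightarrow> q u \<in> carrier G" "\<And>u v. u \<in> W \<Longrightarrow> v \<in> W \<Longrightarrow> q (u + v) = q u \<otimes> q v"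
      "q (0\<^sub>v n) = \<one>"
    and M: "M \<in> carrier_mat n k" "\<And>i. i < k \<Longrightarrow> col M i \<in> W" and j: "j \<le> k"
  shows "M *\<^sub>v trunc_vec k j c \<in> W \<and> q (M *\<^sub>v trunc_vec k j c) = (\<Otimes>i\<in>{..<j}. q (col M i) [^] c i)"
  using j
proof (induction j)
  case 0
  then show ?case using W(4) q(3) by (simp add: mult_mat_trunc_vec_0[OF M(1)])
next
  case (Suc j)
  then have j: "j < k" and IH: "M *\<^sub>v trunc_vec k j c \<in> W"
    "q (M *\<^sub>v trunc_vec k j c) = (\<Otimes>i\<in>{..<j}. q (col M i) [^] c i)" by auto
  have cj: "of_int (c j) \<cdot>\<^sub>v col M j \<in> W" by (rule W(2)[OF M(2)[OF j]])
  have "q (of_int (c j) \<cdot>\<^sub>v col M j) = q (col M j) [^] c j"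
    by (rule hom_smult_int[OF W(1-3) q M(2)[OF j]])
  then have "q (M *\<^sub>v trunc_vec k j c + of_int (c j) \<cdot>\<^sub>v col M j)
      = (\<Otimes>i\<in>{..<j}. q (col M i) [^] c i) \<otimes> q (col M j) [^] c j"
    using q(2)[OF IH(1) cj] IH(2) by simp
  also have "\<dots> = (\<Otimes>i\<in>{..<Suc j}. q (col M i) [^] c i)"
  proof -
    have "(\<lambda>i. q (col M i) [^] c i) \<in> {..<j} \<rightarrow> carrier G" "q (col M j) [^] c j \<in> carrier G"
      using q(1) M(2) j by auto
    then show ?thesis unfolding lessThan_Suc by (subst finprod_insert) (auto intro: m_comm)
  qed
  finally show ?case using W(1)[OF IH(1) cj] by (simp add: mult_mat_trunc_vec_Suc[OF M(1) j])
qed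

text \<open>The quotient enters only through a surjective additive map \<open>q\<close> with kernel
  the integer vectors, so that it can be any group described by lattice coordinates. The assumptions
  of \<open>pruefer_coordinates\<close> are then statements about representatives
  \<open>u\<close>.\<close>

theorem quotient_iso_pruefer:
  assumes H: "comm_group H" and B: "B \<in> carrier_mat n n" and det: "det B \<noteq> 0"
    and q: "\<And>u. u \<in> eventual_lattice B n \<Longrightarrow> q u \<in> carrier H"
      "\<And>u v. u \<in> eventual_lattice B n \<Longrightarrow> v \<in> eventual_lattice B n \<Longrightarrow> q (u + v) = q u \<otimes>\<^bsub>H\<^esub> q v"
      "\<And>u. u \<in> eventual_lattice B n \<Longrightarrow> q u = \<one>\<^bsub>H\<^esub> \<longleftrightarrow> u \<in> Z_vec n"
      "\<And>y. y \<in> carrier H \<Longrightarrow> \<exists>u\<in>eventual_lattice B n. y = q u"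
  shows "product_group (SIGMA p:{p. prime p \<and> int p dvd det B}. {..<low_order (int p) (char_poly B)})
      (\<lambda>(p, i). pruefer_group p) \<cong> H"
proof -
  interpret comm_group H by (rule H)
  let ?W = "eventual_lattice B n"
  let ?k = "\<lambda>p. low_order (int p) (char_poly B)"
  have Wc: "?W \<subseteq> carrier_vec n" using eventual_lattice_carrier[OF B] by blast
  have ZW: "z \<in> ?W" if "z \<in> Z_vec n" for z using Z_vec_subset_eventual_lattice[OF B] that by blast
  have W0: "0\<^sub>v n \<in> ?W" by (rule ZW) simp
  have q0: "q (0\<^sub>v n) = \<one>\<^bsub>H\<^esub>" using q(3)[OF W0] by simp
  note Wadd = eventual_lattice_add[OF B] and Wsmult = eventual_lattice_smult[OF B]
  have q_pow: "q (of_int m \<cdot>\<^sub>v u) = q u [^]\<^bsub>H\<^esub> m" if "u \<in> ?W" for m u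
    by (rule hom_smult_int[OF Wadd Wsmult Wc q(1,2) q0 that])
  have q_add_Z: "q (u + z) = q u" if "u \<in> ?W" "z \<in> Z_vec n" for u z
    using q(2)[OF that(1) ZW[OF that(2)]] q(3)[OF ZW[OF that(2)]] that(2) q(1)[OF that(1)] by simp
  have q_comb: "socle_basis B p *\<^sub>v trunc_vec (?k p) (?k p) c \<in> ?W"
      "q (socle_basis B p *\<^sub>v trunc_vec (?k p) (?k p) c)
        = (\<Otimes>\<^bsub>H\<^esub>i\<in>{..<?k p}. q (col (socle_basis B p) i) [^]\<^bsub>H\<^esub> c i)"
    if p: "prime p" for p c
    using hom_mult_trunc_vec[OF Wadd Wsmult Wc W0 q(1,2) q0 socle_basis(1)[OF B p] socle_basis(2)[OF B p] order_refl, where c = c]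
    by blast+
  have "pruefer_coordinates H {p. prime p \<and> int p dvd det B} ?k (\<lambda>p i. q (col (socle_basis B p) i))"
  proof (unfold_locales)
    have "{p. prime p \<and> int p dvd det B} \<subseteq> {..nat \<bar>det B\<bar>}"
      using det by (auto dest!: dvd_imp_le_int)
    then show "finite {p. prime p \<and> int p dvd det B}" by (rule finite_subset) simp
    show "\<exists>m>0. y [^]\<^bsub>H\<^esub> (m::int) = \<one>\<^bsub>H\<^esub> \<and>
        (\<forall>p. prime p \<longrightarrow> int p dvd m \<longrightarrow> p \<in> {p. prime p \<and> int p dvd det B})" if y: "y \<in> carrier H" for y
    proof -
      obtain u where u: "u \<in> ?W" "y = q u" using q(4)[OF y] by blast
      obtain d where d: "d > 0" "of_int d \<cdot>\<^sub>v u \<in> Z_vec n"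
        "\<And>p. prime p \<Longrightarrow> int p dvd d \<Longrightarrow> int p dvd det B"
        using eventual_lattice_torsion[OF B det u(1)] by blast
      have "y [^]\<^bsub>H\<^esub> d = \<one>\<^bsub>H\<^esub>" using q_pow[OF u(1), of d] q(3)[OF Wsmult[OF u(1)], of d] d(2) u(2) by simp
      then show ?thesis using d(1,3) by (intro exI[of _ d]) simp
    qed
    show "\<exists>z\<in>carrier H. z [^]\<^bsub>H\<^esub> int p = y"
      if p: "p \<in> {p. prime p \<and> int p dvd det B}" and y: "y \<in> carrier H" and ya: "y [^]\<^bsub>H\<^esub> (int p ^ a) = \<one>\<^bsub>H\<^esub>" for p y a
    proof -
      obtain u where u: "u \<in> ?W" "y = q u" using q(4)[OF y] by blast
      have "of_int (int p ^ a) \<cdot>\<^sub>v u \<in> Z_vec n"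
        using q_pow[OF u(1), of "int p ^ a"] q(3)[OF Wsmult[OF u(1)], of "int p ^ a"] ya u(2) by simp
      moreover have "p > 0" using p prime_gt_0_nat by simp
      ultimately obtain w t where w: "w \<in> ?W" "t \<in> Z_vec n" "of_int (int p) \<cdot>\<^sub>v w = u + t"
        using eventual_lattice_divisible[OF B _ u(1)] by blast
      have "q w [^]\<^bsub>H\<^esub> int p = y" using q_pow[OF w(1), of "int p"] w(3) q_add_Z[OF u(1) w(2)] u(2) by simp
      then show ?thesis using q(1)[OF w(1)] by blast
    qed
    fix p assume "p \<in> {p. prime p \<and> int p dvd det B}"
    then show p: "prime p" by simp
    note sb = socle_basis[OF B p]
    show "q (col (socle_basis B p) i) \<in> carrier H" if "i < ?k p" for i using q(1) sb(2) that by blast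
    show "q (col (socle_basis B p) i) [^]\<^bsub>H\<^esub> int p = \<one>\<^bsub>H\<^esub>" if "i < ?k p" for i
      using q_pow[OF sb(2)[OF that], of "int p"] q(3)[OF Wsmult[OF sb(2)[OF that]], of "int p"] sb(3)[OF that] by simp
    show "\<exists>c::nat \<Rightarrow> int. y = (\<Otimes>\<^bsub>H\<^esub>i\<in>{..<?k p}. q (col (socle_basis B p) i) [^]\<^bsub>H\<^esub> c i)"
      if y: "y \<in> carrier H" and yp: "y [^]\<^bsub>H\<^esub> int p = \<one>\<^bsub>H\<^esub>" for y
    proof -
      obtain u where u: "u \<in> ?W" "y = q u" using q(4)[OF y] by blast
      have "of_int (int p) \<cdot>\<^sub>v u \<in> Z_vec n"
        using q_pow[OF u(1), of "int p"] q(3)[OF Wsmult[OF u(1)], of "int p"] yp u(2) by simp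
      then obtain c t where ct: "t \<in> Z_vec n" "u = socle_basis B p *\<^sub>v trunc_vec (?k p) (?k p) c + t"
        using sb(4)[OF u(1)] by blast
      have "y = q (socle_basis B p *\<^sub>v trunc_vec (?k p) (?k p) c)"
        unfolding u(2) ct(2) by (rule q_add_Z[OF q_comb(1)[OF p] ct(1)])
      then show ?thesis using q_comb(2)[OF p] by blast
    qed
    show "int p dvd c i"
      if "(\<Otimes>\<^bsub>H\<^esub>i\<in>{..<?k p}. q (col (socle_basis B p) i) [^]\<^bsub>H\<^esub> (c i :: int)) = \<one>\<^bsub>H\<^esub>" "i < ?k p" for c i
      using that(1) q(3)[OF q_comb(1)[OF p]] sb(5)[OF _ that(2)] unfolding q_comb(2)[OF p, symmetric] by blast
  qed
  then show ?thesis by (rule pruefer_coordinates.iso_product_pruefer)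
qed

section \<open>Transport along a basis of the lattice\<close>

lemma eventual_lattice_subgroup:
  assumes B: "B \<in> carrier_mat n n" shows "subgroup (eventual_lattice B n) (Q_vec n)"
proof -
  interpret V: comm_group "Q_vec n" by (rule comm_group_vec)
  show ?thesis
  proof (rule V.subgroupI)
    show "eventual_lattice B n \<subseteq> carrier (Q_vec n)"
      using eventual_lattice_carrier[OF B] by (auto simp: monoid_vec_simps)
    show "eventual_lattice B n \<noteq> {}"
      using Z_vec_subset_eventual_lattice[OF B] Z_vec_0 by blast
    show "inv\<^bsub>Q_vec n\<^esub> u \<in> eventual_lattice B n" if u: "u \<in> eventual_lattice B n" for u
    proof -
      have "- u = of_int (- 1) \<cdot>\<^sub>v u" by auto
      then show ?thesis
        using eventual_lattice_smult[OF B u, of "- 1"] Q_vec_inv[OF eventual_lattice_carrier[OF B u]] by simp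
    qed
    show "u \<otimes>\<^bsub>Q_vec n\<^esub> v \<in> eventual_lattice B n"
      if "u \<in> eventual_lattice B n" "v \<in> eventual_lattice B n" for u v
      using eventual_lattice_add[OF B that] by (simp add: monoid_vec_simps)
  qed
qed

lemma dimension_group_eventual_lattice:
  assumes A: "A \<in> carrier_mat n n" shows "dimension_group A = eventual_lattice A n"
  using A by (auto simp: dimension_group_def inv_pow_def eventual_lattice_def of_int_hom.mat_hom_pow[OF A])

lemma pow_mat_vec_intertwine:
  assumes A: "A \<in> carrier_mat n n" and B: "B \<in> carrier_mat n n" and P: "P \<in> carrier_mat n n"
    and eq: "rat_mat A * P = P * rat_mat B" and u: "u \<in> carrier_vec n"
  shows "rat_mat (A ^\<^sub>m k) *\<^sub>v (P *\<^sub>v u) = P *\<^sub>v (rat_mat (B ^\<^sub>m k) *\<^sub>v u)"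
proof -
  have rA: "rat_mat A \<in> carrier_mat n n" and rB: "rat_mat B \<in> carrier_mat n n" using A B by auto
  have Pu: "P *\<^sub>v u \<in> carrier_vec n" using P u by (rule mult_mat_vec_carrier)
  have "(rat_mat A ^\<^sub>m k) *\<^sub>v (P *\<^sub>v u) = P *\<^sub>v ((rat_mat B ^\<^sub>m k) *\<^sub>v u)"
  proof (induction k)
    case (Suc k)
    have Bu: "(rat_mat B ^\<^sub>m k) *\<^sub>v u \<in> carrier_vec n"
      using pow_carrier_mat[OF rB] u by (rule mult_mat_vec_carrier)
    have "(rat_mat A ^\<^sub>m Suc k) *\<^sub>v (P *\<^sub>v u) = rat_mat A *\<^sub>v (P *\<^sub>v ((rat_mat B ^\<^sub>m k) *\<^sub>v u))"
      unfolding pow_mat_Suc_vec[OF rA Pu] Suc ..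
    also have "\<dots> = P *\<^sub>v (rat_mat B *\<^sub>v ((rat_mat B ^\<^sub>m k) *\<^sub>v u))"
      using assoc_mult_mat_vec[OF rA P Bu] assoc_mult_mat_vec[OF P rB Bu] by (simp add: eq)
    finally show ?case unfolding pow_mat_Suc_vec[OF rB u] .
  qed (use A B P u Pu in simp)
  then show ?thesis by (simp only: of_int_hom.mat_hom_pow[OF A] of_int_hom.mat_hom_pow[OF B])
qed

text \<open>The basis matrix \<open>P\<close> carries the integer vectors onto \<open>L\<close> and
  \<open>eventual_lattice B N\<close> onto the dimension group, so sending \<open>u\<close> to the
  coset of \<open>P u\<close> is a surjection with the required kernel.\<close>

theorem quotient_iso:
  fixes N :: nat and A :: "int mat" and L :: "rat vec set"
  assumes A: "A \<in> carrier_mat N N"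
    and det: "det A \<noteq> 0"
    and L: "is_lattice N L"
    and LG: "L \<subseteq> dimension_group A"
    and AL: "(\<lambda>v. rat_mat A *\<^sub>v v) ` L \<subseteq> L"
    and G: "(\<Union>n. inv_pow A n L) = dimension_group A"
  shows "(Q_vec N)\<lparr>carrier := dimension_group A\<rparr> Mod L
           \<cong> product_group
               (SIGMA p:{p. prime p \<and> int p dvd det A}. {..<pruefer_rank A p})
               (\<lambda>(p, i). pruefer_group p)"
proof -
  let ?G = "dimension_group A"
  let ?K = "(Q_vec N)\<lparr>carrier := ?G\<rparr>"
  interpret V: comm_group "Q_vec N" by (rule comm_group_vec)
  have subG: "subgroup ?G (Q_vec N)"
    unfolding dimension_group_eventual_lattice[OF A] by (rule eventual_lattice_subgroup[OF A])
  have subL: "subgroup L (Q_vec N)" using L by (simp add: is_lattice_def)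
  interpret K: comm_group ?K
  proof (rule group.group_comm_groupI)
    show "group ?K" by (rule subgroup.subgroup_is_group[OF subG V.is_group])
    show "x \<otimes>\<^bsub>?K\<^esub> y = y \<otimes>\<^bsub>?K\<^esub> x" if "x \<in> carrier ?K" "y \<in> carrier ?K" for x y
      using that V.m_comm subgroup.mem_carrier[OF subG] by simp
  qed
  have subLK: "subgroup L ?K" by (rule V.subgroup_incl[OF subL subG LG])
  interpret L: normal L ?K by (rule K.subgroup_imp_normal[OF subLK])
  obtain P where P: "P \<in> carrier_mat N N" "det P \<noteq> 0" "L = (\<lambda>z. P *\<^sub>v z) ` Z_vec N"
    using lattice_basis[OF L] by blast
  obtain R where R: "R \<in> carrier_mat N N" "P * R = 1\<^sub>m N" "R * P = 1\<^sub>m N"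
    using invertible_rat_mat[OF P(1,2)] by blast
  have RP: "R *\<^sub>v (P *\<^sub>v u) = u" if "u \<in> carrier_vec N" for u
    unfolding assoc_mult_mat_vec[OF R(1) P(1) that, symmetric] R(3) using that by (rule one_mult_mat_vec)
  have PR: "P *\<^sub>v (R *\<^sub>v u) = u" if "u \<in> carrier_vec N" for u
    unfolding assoc_mult_mat_vec[OF P(1) R(1) that, symmetric] R(2) using that by (rule one_mult_mat_vec)
  have Pc: "P *\<^sub>v u \<in> carrier_vec N" if "u \<in> carrier_vec N" for u
    using P(1) that by (rule mult_mat_vec_carrier)
  have P_L_iff: "P *\<^sub>v u \<in> L \<longleftrightarrow> u \<in> Z_vec N" if u: "u \<in> carrier_vec N" for u
  proof
    assume "P *\<^sub>v u \<in> L"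
    then obtain z where z: "z \<in> Z_vec N" "P *\<^sub>v u = P *\<^sub>v z" unfolding P(3) by blast
    then have "u = z" using RP[OF u] RP[OF Z_vec_carrier[OF z(1)]] by metis
    then show "u \<in> Z_vec N" using z by simp
  qed (simp add: P(3))
  have "rat_mat A *\<^sub>v (P *\<^sub>v z) \<in> (\<lambda>z. P *\<^sub>v z) ` Z_vec N" if z: "z \<in> Z_vec N" for z
    using AL z unfolding P(3) by blast
  then obtain B where B: "B \<in> carrier_mat N N" "rat_mat A * P = P * rat_mat B"
    "char_poly A = char_poly B" "det A = det B"
    using invariant_lattice_matrix[OF A P(1,2)] by blast
  have P_G_iff: "P *\<^sub>v u \<in> ?G \<longleftrightarrow> u \<in> eventual_lattice B N" if u: "u \<in> carrier_vec N" for u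
  proof -
    have Bu: "rat_mat (B ^\<^sub>m k) *\<^sub>v u \<in> carrier_vec N" for k
      using rat_pow_carrier[OF B(1)] u by (rule mult_mat_vec_carrier)
    have dim: "dim_row A = N" using A by simp
    \<comment> \<open>The hypothesis that the preimages of \<open>L\<close> exhaust the dimension
      group allows membership to be tested with \<open>L\<close> in place of the standard
      lattice.\<close>
    have "P *\<^sub>v u \<in> ?G \<longleftrightarrow> (\<exists>k. rat_mat (A ^\<^sub>m k) *\<^sub>v (P *\<^sub>v u) \<in> L)"
      unfolding G[symmetric] inv_pow_def dim of_int_hom.mat_hom_pow[OF A] using Pc[OF u] by blast
    also have "\<dots> \<longleftrightarrow> u \<in> eventual_lattice B N"
      unfolding pow_mat_vec_intertwine[OF A B(1) P(1) B(2) u] P_L_iff[OF Bu]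
      using u by (simp add: eventual_lattice_def)
    finally show ?thesis .
  qed
  define q where "q u = L #>\<^bsub>?K\<^esub> (P *\<^sub>v u)" for u
  have "product_group (SIGMA p:{p. prime p \<and> int p dvd det B}. {..<low_order (int p) (char_poly B)})
      (\<lambda>(p, i). pruefer_group p) \<cong> ?K Mod L"
  proof (rule quotient_iso_pruefer[where q = q])
    show "comm_group (?K Mod L)" by (rule K.abelian_FactGroup[OF subLK])
    show "B \<in> carrier_mat N N" by (rule B(1))
    show "det B \<noteq> 0" using det B(4) by simp
    note Wc = eventual_lattice_carrier[OF B(1)]
    have PG: "P *\<^sub>v u \<in> carrier ?K" if "u \<in> eventual_lattice B N" for u
      using P_G_iff[OF Wc[OF that]] that by simp
    show "q u \<in> carrier (?K Mod L)" if "u \<in> eventual_lattice B N" for u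
      unfolding carrier_FactGroup q_def using PG[OF that] by (rule imageI)
    show "q (u + v) = q u \<otimes>\<^bsub>?K Mod L\<^esub> q v"
      if "u \<in> eventual_lattice B N" "v \<in> eventual_lattice B N" for u v
      using L.rcos_sum[OF PG[OF that(1)] PG[OF that(2)]] mult_add_distrib_mat_vec[OF P(1) Wc[OF that(1)] Wc[OF that(2)]]
      by (simp add: q_def monoid_vec_simps)
    show "q u = \<one>\<^bsub>?K Mod L\<^esub> \<longleftrightarrow> u \<in> Z_vec N" if u: "u \<in> eventual_lattice B N" for u
      using K.coset_join1[OF _ PG[OF u] subLK] K.coset_join2[OF PG[OF u] subLK] P_L_iff[OF Wc[OF u]]
      unfolding q_def one_FactGroup by blast
    show "\<exists>u\<in>eventual_lattice B N. y = q u" if y: "y \<in> carrier (?K Mod L)" for y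
    proof -
      obtain v where v: "v \<in> ?G" "y = L #>\<^bsub>?K\<^esub> v" using y by (auto simp: carrier_FactGroup)
      have vc: "v \<in> carrier_vec N" using v(1) subgroup.subset[OF subG] by (auto simp: monoid_vec_simps)
      have Rv: "R *\<^sub>v v \<in> carrier_vec N" using R(1) vc by (rule mult_mat_vec_carrier)
      have "R *\<^sub>v v \<in> eventual_lattice B N" using P_G_iff[OF Rv] PR[OF vc] v(1) by simp
      moreover have "y = q (R *\<^sub>v v)" unfolding q_def PR[OF vc] by (rule v(2))
      ultimately show ?thesis by blast
    qed
  qed
  moreover have "(SIGMA p:{p. prime p \<and> int p dvd det B}. {..<low_order (int p) (char_poly B)})
      = (SIGMA p:{p. prime p \<and> int p dvd det A}. {..<pruefer_rank A p})"
    using pruefer_rank_low_order[OF A] B(3,4) by (intro Sigma_cong) auto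
  ultimately have iso: "product_group (SIGMA p:{p. prime p \<and> int p dvd det A}. {..<pruefer_rank A p})
      (\<lambda>(p, i). pruefer_group p) \<cong> ?K Mod L" by simp
  \<comment> \<open>Reversing the isomorphism uses that its source is a group.\<close>
  have "group (product_group (SIGMA p:{p. prime p \<and> int p dvd det A}. {..<pruefer_rank A p})
      (\<lambda>(p, i). pruefer_group p))"
  proof (rule product_group)
    show "group (case t of (p, i) \<Rightarrow> pruefer_group p)"
      if "t \<in> (SIGMA p:{p. prime p \<and> int p dvd det A}. {..<pruefer_rank A p})" for t
      using that group_pruefer[OF prime_gt_0_nat] by (cases t) simp
  qed
  then show ?thesis using iso by (rule group.iso_sym)
qed

theorem proposition10p2:
  fixes N :: nat and A :: "int mat" and L :: "rat vec set"
  assumes "A \<in> carrier_mat N N"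
    and "det A \<noteq> 0"
    and "is_lattice N L"
    and "L \<subseteq> dimension_group A"
    and "(\<lambda>v. rat_mat A *\<^sub>v v) ` L \<subseteq> L"
    and "(\<Union>n. inv_pow A n L) = dimension_group A"
  shows "(Q_vec N)\<lparr>carrier := dimension_group A\<rparr> Mod L
           \<cong> product_group
               (SIGMA p:{p. prime p \<and> int p dvd det A}. {..<pruefer_rank A p})
               (\<lambda>(p, i). pruefer_group p)
         \<and> (\<forall>p. prime p \<and> int p dvd det A \<longrightarrow>
           tensor_subring N (dimension_group A) (rat_localization p)
           = {v \<in> carrier_vec N. \<forall>w \<in> padic_row_space p A. padic_pairing p w v \<in> Z_padic p})"
proof (intro conjI allI impI)
  show "(Q_vec N)\<lparr>carrier := dimension_group A\<rparr> Mod L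
      \<cong> product_group (SIGMA p:{p. prime p \<and> int p dvd det A}. {..<pruefer_rank A p})
          (\<lambda>(p, i). pruefer_group p)"
    using assms by (rule quotient_iso)
next
  fix p assume "prime p \<and> int p dvd det A"
  then have p: "prime p" by simp
  show "tensor_subring N (dimension_group A) (rat_localization p)
      = {v \<in> carrier_vec N. \<forall>w \<in> padic_row_space p A. padic_pairing p w v \<in> Z_padic p}"
    unfolding tensor_localization[OF p assms(1)] using padic_dual_iff[OF p assms(1)] by blast
qed

end
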